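(* Let $A_1\xrightarrow{\alpha_1}A_2\xrightarrow{\alpha_2}\cdots\xrightarrow{\alpha_{n-1}}A_n\xrightarrow{\alpha_n}A_{n+1}$ be a sequence of simplicial morphisms between NCCW complexes of dimensions $m_1,m_2,\dots,m_{n+1}$ respectively. Then the NC mapping conical telescope $T_nC$ of this sequence is an NCCW complex of dimension $\max\{m_1,1+m_2,1+m_3,\dots,1+m_{n+1}\}$.
   Context: Morphisms of C*-algebras are $*$-homomorphisms. Notation: $\mathbb{I}=[0,1]$, $\mathbb{I}^k=[0,1]^k$, $\mathbb{I}_0^k=(0,1)^k$. For a C*-algebra $F$: $\mathbb{I}F=C(\mathbb{I}\to F)$, $\mathbb{I}^kF=C(\mathbb{I}^k\to F)$, $\mathbb{I}_0^kF=C_0(\mathbb{I}_0^k\to F)$, $S^{k-1}F=C(S^{k-1}\to F)$, where $S^{k-1}$ is identified with the boundary $\mathbb{I}^k\setminus\mathbb{I}_0^k$; all have pointwise operations and supremum norm. $\partial:\mathbb{I}^kF\to S^{k-1}F$ is restriction. NCCW complexes: an NCCW complex of dimension $0$ is a finite-dimensional C*-algebra $D_0$. An NCCW complex of dimension $d$ is given by a sequence of C*-algebras $\{D_0,D_1,\dots,D_d\}$, where $D_0$ is finite-dimensional and for each $1\le k\le d$ there are a finite-dimensional C*-algebra $F_k$ and an arbitrary morphism $\sigma_k:D_{k-1}\to S^{k-1}F_k$ with $D_k=\mathbb{I}^kF_k\bigoplus_{S^{k-1}F_k}D_{k-1}=\{f\oplus a\in \mathbb{I}^kF_k\oplus D_{k-1}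 : \partial f=\sigma_k(a)\}$ (the pullback); thus there is an extension $0\to\mathbb{I}_0^kF_k\to D_k\to D_{k-1}\to 0$. One calls $D=D_d$ itself the NCCW complex. It has a decreasing family of closed ideals (canonical ideals) $D=I_0\supset I_1\supset\dots\supset I_d\neq 0$, where for $k\ge 1$, $I_k$ is the kernel of the projection $D\to D_{k-1}$; so $I_d=\mathbb{I}_0^dF_d$, $I_k/I_{k+1}=\mathbb{I}_0^kF_k$ (with $F_0=D_0$, $I_{d+1}=0$), and $D/I_{k+1}=D_k$. Simplicial morphisms: let $D$, $E$ be NCCW complexes of dimensions $d,e$ with canonical ideals $I_0\supset\dots\supset I_d$ and $J_0\supset\dots\supset J_e$, and $I_k/I_{k+1}=\mathbb{I}_0^kF_k$, $J_k/J_{k+1}=\mathbb{I}_0^kG_k$. A morphism $\alpha:D\to E$ is simplicial if (i) $\alpha(I_k)\subset J_k$ for all $k$ (in particular $\alpha(I_k)=0$ for $k>e$), and (ii) for $0\le k\le d$, the induced homomorphism $\tilde\alpha_k:\mathbb{I}_0^kF_k\to\mathbb{I}_0^kG_k$ has the form $\tilde\alpha_k=i_k^*\otimes\varphi_k$ for some morphism $\varphi_k:F_k\to G_k$ and some homeomorphism $i_k$ of $\mathbb{I}^k$, where $i_k^*$ is the induced map on $C_0(\mathbb{I}_0^k)$ and $\mathbb{I}_0^kF_k$ is identified with $C_0(\mathbb{I}_0^k)\otimes F_k$ (similarly for $G_k$). NC cone: $CA=\{f\in\mathbb{I}A : f(0)=0\}$. NC mapping conical telescope of the sequence $A_1\xrightarrow{\alpha_1}\cdots\xrightarrow{\alpha_n}A_{n+1}$: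 $$T_nC=\{a\oplus f_2\oplus\dots\oplus f_{n+1}\in A_1\oplus CA_2\oplus\dots\oplus CA_{n+1} : f_{k+1}(1)=\alpha_k\circ\alpha_{k-1}\circ\dots\circ\alpha_1(a),\ k=1,\dots,n\}.$$ *)

theory Defs
  imports "HOL-Analysis.Analysis"
begin

section \<open>C*-algebras\<close>

text \<open>C*-algebras need not be unital, and the zero algebra is allowed.\<close>

record 'a cstar =
  cs_carrier :: "'a set"
  cs_zero :: 'a
  cs_add :: "'a \<Rightarrow> 'a \<Rightarrow> 'a"
  cs_scale :: "complex \<Rightarrow> 'a \<Rightarrow> 'a"
  cs_mult :: "'a \<Rightarrow> 'a \<Rightarrow> 'a"
  cs_star :: "'a \<Rightarrow> 'a"
  cs_norm :: "'a \<Rightarrow> real"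

text \<open>The guard is needed because the locale \<open>Metric_space\<close> requires symmetry and
  nonnegativity of the distance on the whole type.\<close>

definition cs_dist :: "'a cstar \<Rightarrow> 'a \<Rightarrow> 'a \<Rightarrow> real" where
  "cs_dist A x y =
     (if x \<in> cs_carrier A \<and> y \<in> cs_carrier A
      then cs_norm A (cs_add A x (cs_scale A (-1) y)) else 0)"

definition cs_topology :: "'a cstar \<Rightarrow> 'a topology" where
  "cs_topology A = Metric_space.mtopology (cs_carrier A) (cs_dist A)"

locale cstar_algebra =
  fixes A :: "'a cstar"
  assumes zero_closed: "cs_zero A \<in> cs_carrier A"
    and add_closed: "\<lbrakk>x \<in> cs_carrier A; y \<in> cs_carrier A\<rbrakk> \<Longrightarrow> cs_add A x y \<in> cs_carrier A"
    and scale_closed: "x \<in> cs_carrier A \<Longrightarrow> cs_scale A c x \<in> cs_carrier A"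
    and mult_closed: "\<lbrakk>x \<in> cs_carrier A; y \<in> cs_carrier A\<rbrakk> \<Longrightarrow> cs_mult A x y \<in> cs_carrier A"
    and star_closed: "x \<in> cs_carrier A \<Longrightarrow> cs_star A x \<in> cs_carrier A"
    and add_assoc: "\<lbrakk>x \<in> cs_carrier A; y \<in> cs_carrier A; z \<in> cs_carrier A\<rbrakk> \<Longrightarrow>
        cs_add A (cs_add A x y) z = cs_add A x (cs_add A y z)"
    and add_commute: "\<lbrakk>x \<in> cs_carrier A; y \<in> cs_carrier A\<rbrakk> \<Longrightarrow> cs_add A x y = cs_add A y x"
    and add_zero: "x \<in> cs_carrier A \<Longrightarrow> cs_add A x (cs_zero A) = x"
    and add_uminus: "x \<in> cs_carrier A \<Longrightarrow> cs_add A x (cs_scale A (-1) x) = cs_zero A"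
    and scale_add_right: "\<lbrakk>x \<in> cs_carrier A; y \<in> cs_carrier A\<rbrakk> \<Longrightarrow>
        cs_scale A c (cs_add A x y) = cs_add A (cs_scale A c x) (cs_scale A c y)"
    and scale_add_left: "x \<in> cs_carrier A \<Longrightarrow>
        cs_scale A (b + c) x = cs_add A (cs_scale A b x) (cs_scale A c x)"
    and scale_scale: "x \<in> cs_carrier A \<Longrightarrow> cs_scale A b (cs_scale A c x) = cs_scale A (b * c) x"
    and scale_one: "x \<in> cs_carrier A \<Longrightarrow> cs_scale A 1 x = x"
    and mult_assoc: "\<lbrakk>x \<in> cs_carrier A; y \<in> cs_carrier A; z \<in> cs_carrier A\<rbrakk> \<Longrightarrow>
        cs_mult A (cs_mult A x y) z = cs_mult A x (cs_mult A y z)"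
    and mult_add_left: "\<lbrakk>x \<in> cs_carrier A; y \<in> cs_carrier A; z \<in> cs_carrier A\<rbrakk> \<Longrightarrow>
        cs_mult A (cs_add A x y) z = cs_add A (cs_mult A x z) (cs_mult A y z)"
    and mult_add_right: "\<lbrakk>x \<in> cs_carrier A; y \<in> cs_carrier A; z \<in> cs_carrier A\<rbrakk> \<Longrightarrow>
        cs_mult A x (cs_add A y z) = cs_add A (cs_mult A x y) (cs_mult A x z)"
    and mult_scale_left: "\<lbrakk>x \<in> cs_carrier A; y \<in> cs_carrier A\<rbrakk> \<Longrightarrow>
        cs_mult A (cs_scale A c x) y = cs_scale A c (cs_mult A x y)"
    and mult_scale_right: "\<lbrakk>x \<in> cs_carrier A; y \<in> cs_carrier A\<rbrakk> \<Longrightarrow>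
        cs_mult A x (cs_scale A c y) = cs_scale A c (cs_mult A x y)"
    and star_star: "x \<in> cs_carrier A \<Longrightarrow> cs_star A (cs_star A x) = x"
    and star_add: "\<lbrakk>x \<in> cs_carrier A; y \<in> cs_carrier A\<rbrakk> \<Longrightarrow>
        cs_star A (cs_add A x y) = cs_add A (cs_star A x) (cs_star A y)"
    and star_scale: "x \<in> cs_carrier A \<Longrightarrow>
        cs_star A (cs_scale A c x) = cs_scale A (cnj c) (cs_star A x)"
    and star_mult: "\<lbrakk>x \<in> cs_carrier A; y \<in> cs_carrier A\<rbrakk> \<Longrightarrow>
        cs_star A (cs_mult A x y) = cs_mult A (cs_star A y) (cs_star A x)"
    and norm_nonneg: "x \<in> cs_carrier A \<Longrightarrow> 0 \<le> cs_norm A x"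
    and norm_eq_zero: "x \<in> cs_carrier A \<Longrightarrow> cs_norm A x = 0 \<longleftrightarrow> x = cs_zero A"
    and norm_scale: "x \<in> cs_carrier A \<Longrightarrow> cs_norm A (cs_scale A c x) = cmod c * cs_norm A x"
    and norm_triangle: "\<lbrakk>x \<in> cs_carrier A; y \<in> cs_carrier A\<rbrakk> \<Longrightarrow>
        cs_norm A (cs_add A x y) \<le> cs_norm A x + cs_norm A y"
    and norm_mult: "\<lbrakk>x \<in> cs_carrier A; y \<in> cs_carrier A\<rbrakk> \<Longrightarrow>
        cs_norm A (cs_mult A x y) \<le> cs_norm A x * cs_norm A y"
    and cstar_identity: "x \<in> cs_carrier A \<Longrightarrow>
        cs_norm A (cs_mult A (cs_star A x) x) = (cs_norm A x)\<^sup>2"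
    and complete: "Metric_space.mcomplete (cs_carrier A) (cs_dist A)"

definition cs_subspace :: "'a cstar \<Rightarrow> 'a set \<Rightarrow> bool" where
  "cs_subspace A V \<longleftrightarrow> V \<subseteq> cs_carrier A \<and> cs_zero A \<in> V \<and>
     (\<forall>x\<in>V. \<forall>y\<in>V. cs_add A x y \<in> V) \<and> (\<forall>c. \<forall>x\<in>V. cs_scale A c x \<in> V)"

definition finite_dim_cstar :: "'a cstar \<Rightarrow> bool" where
  "finite_dim_cstar A \<longleftrightarrow> cstar_algebra A \<and>
     (\<exists>B. finite B \<and> B \<subseteq> cs_carrier A \<and> cs_subspace A hull B = cs_carrier A)"

text \<open>Morphisms are *-homomorphisms; only the values on the carrier matter. A bijective
  *-homomorphism of C*-algebras is automatically isometric.\<close>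

definition cstar_hom :: "'a cstar \<Rightarrow> 'b cstar \<Rightarrow> ('a \<Rightarrow> 'b) set" where
  "cstar_hom A B = {h \<in> cs_carrier A \<rightarrow> cs_carrier B.
     (\<forall>x\<in>cs_carrier A. \<forall>y\<in>cs_carrier A. h (cs_add A x y) = cs_add B (h x) (h y)) \<and>
     (\<forall>c. \<forall>x\<in>cs_carrier A. h (cs_scale A c x) = cs_scale B c (h x)) \<and>
     (\<forall>x\<in>cs_carrier A. \<forall>y\<in>cs_carrier A. h (cs_mult A x y) = cs_mult B (h x) (h y)) \<and>
     (\<forall>x\<in>cs_carrier A. h (cs_star A x) = cs_star B (h x))}"

definition cstar_isomorphic :: "'a cstar \<Rightarrow> 'b cstar \<Rightarrow> bool" where
  "cstar_isomorphic A B \<longleftrightarrow>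
     (\<exists>h \<in> cstar_hom A B. bij_betw h (cs_carrier A) (cs_carrier B))"


section \<open>Constructions\<close>

definition subalgebra :: "'a cstar \<Rightarrow> ('a \<Rightarrow> bool) \<Rightarrow> 'a cstar" where
  "subalgebra A P = A\<lparr>cs_carrier := {x \<in> cs_carrier A. P x}\<rparr>"

text \<open>\<open>C(X \<rightarrow> A)\<close> for a compact space \<open>X\<close>. Here and below functions are made
  extensional, so that they are determined by their values on \<open>X\<close>; the \<open>insert 0\<close> only
  matters for empty \<open>X\<close> (respectively an empty index set).\<close>

definition cont_alg :: "'x topology \<Rightarrow> 'a cstar \<Rightarrow> ('x \<Rightarrow> 'a) cstar" where
  "cont_alg X A =
     \<lparr>cs_carrier = {f \<in> extensional (topspace X). continuous_map X (cs_topology A) f},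
      cs_zero = (\<lambda>x\<in>topspace X. cs_zero A),
      cs_add = (\<lambda>f g. \<lambda>x\<in>topspace X. cs_add A (f x) (g x)),
      cs_scale = (\<lambda>c f. \<lambda>x\<in>topspace X. cs_scale A c (f x)),
      cs_mult = (\<lambda>f g. \<lambda>x\<in>topspace X. cs_mult A (f x) (g x)),
      cs_star = (\<lambda>f. \<lambda>x\<in>topspace X. cs_star A (f x)),
      cs_norm = (\<lambda>f. Sup (insert 0 ((\<lambda>x. cs_norm A (f x)) ` topspace X)))\<rparr>"

definition direct_sum :: "'i set \<Rightarrow> ('i \<Rightarrow> 'a cstar) \<Rightarrow> ('i \<Rightarrow> 'a) cstar" where
  "direct_sum I A =
     \<lparr>cs_carrier = (\<Pi>\<^sub>E i\<in>I. cs_carrier (A i)),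
      cs_zero = (\<lambda>i\<in>I. cs_zero (A i)),
      cs_add = (\<lambda>x y. \<lambda>i\<in>I. cs_add (A i) (x i) (y i)),
      cs_scale = (\<lambda>c x. \<lambda>i\<in>I. cs_scale (A i) c (x i)),
      cs_mult = (\<lambda>x y. \<lambda>i\<in>I. cs_mult (A i) (x i) (y i)),
      cs_star = (\<lambda>x. \<lambda>i\<in>I. cs_star (A i) (x i)),
      cs_norm = (\<lambda>x. Sup (insert 0 ((\<lambda>i. cs_norm (A i) (x i)) ` I)))\<rparr>"

definition direct_sum2 :: "'a cstar \<Rightarrow> 'b cstar \<Rightarrow> ('a \<times> 'b) cstar" where
  "direct_sum2 A B =
     \<lparr>cs_carrier = cs_carrier A \<times> cs_carrier B,
      cs_zero = (cs_zero A, cs_zero B),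
      cs_add = (\<lambda>(a, b) (a', b'). (cs_add A a a', cs_add B b b')),
      cs_scale = (\<lambda>c (a, b). (cs_scale A c a, cs_scale B c b)),
      cs_mult = (\<lambda>(a, b) (a', b'). (cs_mult A a a', cs_mult B b b')),
      cs_star = (\<lambda>(a, b). (cs_star A a, cs_star B b)),
      cs_norm = (\<lambda>(a, b). max (cs_norm A a) (cs_norm B b))\<rparr>"

definition cone :: "'a cstar \<Rightarrow> (real \<Rightarrow> 'a) cstar" where
  "cone A = subalgebra (cont_alg (top_of_set {0..1}) A) (\<lambda>f. f 0 = cs_zero A)"

primrec iter_comp :: "(nat \<Rightarrow> 'a \<Rightarrow> 'a) \<Rightarrow> nat \<Rightarrow> 'a \<Rightarrow> 'a" where
  "iter_comp \<alpha> 0 = id"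
| "iter_comp \<alpha> (Suc k) = \<alpha> (Suc k) \<circ> iter_comp \<alpha> k"

text \<open>The algebras are \<open>A 1, \<dots>, A (n + 1)\<close> and the morphisms are
  \<open>\<alpha> k : A k \<rightarrow> A (k + 1)\<close>, \<open>1 \<le> k \<le> n\<close>; so \<open>iter_comp \<alpha> k = \<alpha> k \<circ> \<dots> \<circ> \<alpha> 1\<close>.\<close>

definition conical_telescope ::
    "nat \<Rightarrow> (nat \<Rightarrow> 'a cstar) \<Rightarrow> (nat \<Rightarrow> 'a \<Rightarrow> 'a) \<Rightarrow> ('a \<times> (nat \<Rightarrow> real \<Rightarrow> 'a)) cstar" where
  "conical_telescope n A \<alpha> =
     subalgebra (direct_sum2 (A 1) (direct_sum {2..n+1} (\<lambda>j. cone (A j))))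
       (\<lambda>(a, f). \<forall>k\<in>{1..n}. f (k + 1) 1 = iter_comp \<alpha> k a)"


section \<open>NCCW complexes\<close>

type_synonym point = "nat \<Rightarrow> real"

definition cube :: "nat \<Rightarrow> point topology" where
  "cube k = product_topology (\<lambda>_. top_of_set {0..1}) {..<k}"

definition open_cube :: "nat \<Rightarrow> point set" where
  "open_cube k = (\<Pi>\<^sub>E i\<in>{..<k}. {0<..<1})"

text \<open>\<open>cube_boundary k\<close> is the sphere \<open>S\<^bsup>k-1\<^esup>\<close>.\<close>

definition cube_boundary :: "nat \<Rightarrow> point topology" where
  "cube_boundary k = subtopology (cube k) (topspace (cube k) - open_cube k)"

definition boundary_restrict :: "nat \<Rightarrow> (point \<Rightarrow> 'f) \<Rightarrow> (point \<Rightarrow> 'f)" where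
  "boundary_restrict k f = restrict f (topspace (cube_boundary k))"

text \<open>The iterated pullback \<open>D\<^sub>k \<subseteq> C(I\<^sup>k \<rightarrow> F\<^sub>k) \<oplus> D\<^bsub>k-1\<^esub>\<close> is
  flattened into tuples \<open>x\<close> with components \<open>x j \<in> C(I\<^sup>j \<rightarrow> F\<^sub>j)\<close>, \<open>j \<le> k\<close>, so that all
  \<open>D\<^sub>k\<close> live in one type. The finite-dimensional algebra \<open>D\<^sub>0 = F\<^sub>0\<close> appears as
  \<open>C(I\<^sup>0 \<rightarrow> F\<^sub>0)\<close>, with \<open>I\<^sup>0\<close> a point. The projection of \<open>x\<close> to \<open>D\<^sub>j\<close> is
  \<open>restrict x {..j}\<close>. The type \<open>'f\<close> carries the elements of all the \<open>F\<^sub>k\<close>.\<close>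

type_synonym 'f tuple = "nat \<Rightarrow> point \<Rightarrow> 'f"

text \<open>The fibre \<open>nc_fibre N k\<close> is \<open>F\<^sub>k\<close> and is only meaningful for \<open>k \<le> nc_dim N\<close>;
  \<open>nc_attach N k\<close> is \<open>\<sigma>\<^sub>k\<close> and is only meaningful for \<open>1 \<le> k \<le> nc_dim N\<close>.\<close>

record 'f nccw =
  nc_dim :: nat
  nc_fibre :: "nat \<Rightarrow> 'f cstar"
  nc_attach :: "nat \<Rightarrow> 'f tuple \<Rightarrow> (point \<Rightarrow> 'f)"

definition cell_alg :: "'f nccw \<Rightarrow> nat \<Rightarrow> (point \<Rightarrow> 'f) cstar" where
  "cell_alg N k = cont_alg (cube k) (nc_fibre N k)"

primrec skeleton :: "'f nccw \<Rightarrow> nat \<Rightarrow> 'f tuple cstar" where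
  "skeleton N 0 = direct_sum {..0} (cell_alg N)"
| "skeleton N (Suc k) =
     subalgebra (direct_sum {..Suc k} (cell_alg N))
       (\<lambda>x. restrict x {..k} \<in> cs_carrier (skeleton N k) \<and>
            boundary_restrict (Suc k) (x (Suc k)) = nc_attach N (Suc k) (restrict x {..k}))"

definition nccw_alg :: "'f nccw \<Rightarrow> 'f tuple cstar" where
  "nccw_alg N = skeleton N (nc_dim N)"

text \<open>The kernel of the projection of \<open>D\<close> to \<open>D\<^bsub>k-1\<^esub>\<close>. It is all of \<open>D\<close> for \<open>k = 0\<close>
  and zero for \<open>k > nc_dim N\<close>.\<close>

definition canonical_ideal :: "'f nccw \<Rightarrow> nat \<Rightarrow> 'f tuple set" where
  "canonical_ideal N k =
     {x \<in> cs_carrier (nccw_alg N). restrict x {..<k} = restrict (cs_zero (nccw_alg N)) {..<k}}"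

text \<open>The condition on the last canonical ideal says that the complex really has dimension
  \<open>nc_dim N\<close>; without it, dimensions could be raised at will by adding zero fibres.\<close>

definition nccw_complex :: "'f nccw \<Rightarrow> bool" where
  "nccw_complex N \<longleftrightarrow>
     (\<forall>k\<le>nc_dim N. finite_dim_cstar (nc_fibre N k)) \<and>
     (\<forall>k\<in>{1..nc_dim N}. nc_attach N k \<in>
        cstar_hom (skeleton N (k - 1)) (cont_alg (cube_boundary k) (nc_fibre N k))) \<and>
     canonical_ideal N (nc_dim N) \<noteq> {cs_zero (nccw_alg N)}"


section \<open>Simplicial morphisms\<close>

text \<open>On the \<open>k\<close>-th canonical ideal \<open>I\<^sub>k\<close> this map is onto \<open>C\<^sub>0((0,1)\<^sup>k \<rightarrow> F\<^sub>k)\<close>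
  with kernel \<open>I\<^bsub>k+1\<^esub>\<close>; it is the identification of \<open>I\<^sub>k / I\<^bsub>k+1\<^esub>\<close> with
  \<open>C\<^sub>0((0,1)\<^sup>k \<rightarrow> F\<^sub>k)\<close>.\<close>

definition ideal_quotient :: "nat \<Rightarrow> 'f tuple \<Rightarrow> (point \<Rightarrow> 'f)" where
  "ideal_quotient k x = restrict (x k) (open_cube k)"

text \<open>The map \<open>i\<^sup>* \<otimes> \<phi>\<close> from \<open>C\<^sub>0((0,1)\<^sup>k) \<otimes> F = C\<^sub>0((0,1)\<^sup>k \<rightarrow> F)\<close> to
  \<open>C\<^sub>0((0,1)\<^sup>k \<rightarrow> G)\<close>; note that a homeomorphism of the cube preserves its interior.\<close>

definition pullback_tensor ::
    "nat \<Rightarrow> (point \<Rightarrow> point) \<Rightarrow> ('f \<Rightarrow> 'g) \<Rightarrow> (point \<Rightarrow> 'f) \<Rightarrow> (point \<Rightarrow> 'g)" where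
  "pullback_tensor k i \<phi> f = (\<lambda>p\<in>open_cube k. \<phi> (f (i p)))"

text \<open>Since \<open>ideal_quotient k\<close> is a quotient map, the last condition says precisely that the
  homomorphism induced by \<open>\<alpha>\<close> on \<open>I\<^sub>k / I\<^bsub>k+1\<^esub>\<close> is \<open>i\<^sup>* \<otimes> \<phi>\<close>. For
  \<open>k > nc_dim E\<close> the target \<open>J\<^sub>k / J\<^bsub>k+1\<^esub>\<close> is zero, so the condition is void there.\<close>

definition simplicial :: "'f nccw \<Rightarrow> 'g nccw \<Rightarrow> ('f tuple \<Rightarrow> 'g tuple) \<Rightarrow> bool" where
  "simplicial D E \<alpha> \<longleftrightarrow>
     \<alpha> \<in> cstar_hom (nccw_alg D) (nccw_alg E) \<and>
     (\<forall>k. \<alpha> ` canonical_ideal D k \<subseteq> canonical_ideal E k) \<and>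
     (\<forall>k. k \<le> nc_dim D \<and> k \<le> nc_dim E \<longrightarrow>
        (\<exists>\<phi> \<in> cstar_hom (nc_fibre D k) (nc_fibre E k).
         \<exists>i. homeomorphic_map (cube k) (cube k) i \<and>
           (\<forall>x\<in>canonical_ideal D k.
              ideal_quotient k (\<alpha> x) = pullback_tensor k i \<phi> (ideal_quotient k x))))"

end

theory Submission
  imports Defs "HOL-Computational_Algebra.Fundamental_Theorem_Algebra"
begin



text \<open>The telescope is a complex because a path in an NCCW complex adds one dimension to each cell.
Let \<open>(a, f\<^sub>2, \<dots>, f\<^bsub>n+1\<^esub>)\<close> be a point of the telescope. The component of \<open>a\<close> on the
\<open>k\<close>-cell of \<open>A\<^sub>1\<close> is a function on \<open>[0,1]\<^sup>k\<close>. The component of \<open>f\<^sub>j(t)\<close> on the \<open>k\<close>-cell of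
\<open>A\<^sub>j\<close>, read as a function of \<open>t\<close> and of the point of the cell, is a function on
\<open>[0,1]\<^bsup>k+1\<^esup>\<close>. So the \<open>k\<close>-cell of the telescope has as fibre the direct sum of the fibre of \<open>A\<^sub>1\<close>
in dimension \<open>k\<close> and the fibres of \<open>A\<^sub>2, \<dots>, A\<^bsub>n+1\<^esub>\<close> in dimension \<open>k - 1\<close>, as far as they exist,
and the dimension is the stated maximum.

The attaching map in dimension \<open>k + 1\<close> prescribes the boundary values. The summand of \<open>A\<^sub>1\<close> keeps
its attaching map. For the summand of \<open>A\<^sub>j\<close> the boundary of \<open>[0,1] \<times> [0,1]\<^sup>k\<close> has three parts: the
value is \<open>0\<close> on the end \<open>t = 0\<close>, it is the \<open>k\<close>-th component of \<open>\<beta>\<^sub>j(a)\<close> on the end \<open>t = 1\<close>,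
where \<open>\<beta>\<^sub>j\<close> is the composite \<open>A\<^sub>1 \<rightarrow> A\<^sub>j\<close>, and on the side it is the attaching map of \<open>A\<^sub>j\<close> applied
to \<open>f\<^sub>j(t)\<close>. Three points make this a homomorphism from the \<open>k\<close>-skeleton to the continuous
functions on the sphere.

\<^item> The end \<open>t = 1\<close> may only use the \<open>k\<close>-skeleton of \<open>a\<close>. This is where the morphisms are required
to respect the canonical ideals: elements of \<open>A\<^sub>1\<close> with equal components up to dimension \<open>k\<close> have
images with equal components up to dimension \<open>k\<close> (\<open>hom_determined\<close>). Moreover \<open>\<beta>\<^sub>j\<close> is defined on
all of \<open>A\<^sub>1\<close> only, so an element of the \<open>k\<close>-skeleton has to be lifted first; lifts exist because a
function on the boundary of a cube extends radially (\<open>extend_from_cube_boundary\<close>,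
\<open>skeleton_lift\<close>).

\<^item> The three parts agree where they meet (\<open>attach_map_side\<close>), so that the values can be pasted to a
continuous function (\<open>attach_map_component_continuous\<close>).

\<^item> On the side, continuity in \<open>t\<close> needs the attaching maps of \<open>A\<^sub>j\<close> to be continuous, although
morphisms are only assumed to be algebraic. A *-homomorphism into a finite-dimensional C*-algebra is
contractive (\<open>hom_contractive\<close>), and the values of the attaching maps lie in finite-dimensional
fibres. The same fact shows that the skeleta are complete (\<open>skeleton_closed_and_cstar\<close>).

The exponential law for compact spaces (\<open>continuous_map_curry\<close>, \<open>continuous_map_eval\<close>) then
identifies the telescope with the algebra of the complex (\<open>glue_hom\<close>, \<open>glue_bij\<close>). The top canonical
ideal is not zero: it contains the image of an element of the top ideal of \<open>A\<^sub>1\<close>, or of a loop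
\<open>t \<mapsto> t (1 - t) b\<close> with \<open>b\<close> in the top ideal of some \<open>A\<^sub>j\<close>, depending on where the maximum is attained
(\<open>nccw_complex_tele\<close>).\<close>

section \<open>Operations and homomorphisms of C*-algebras\<close>

text \<open>The four operations form one family, so that closure, continuity and compatibility with
homomorphisms are each a single statement; the unary operations get a dummy second argument.\<close>

datatype cs_op = Add | Scale complex | Mult | Star

primrec cs_apply :: "cs_op \<Rightarrow> 'a cstar \<Rightarrow> 'a \<Rightarrow> 'a \<Rightarrow> 'a" where
  "cs_apply Add A x y = cs_add A x y"
| "cs_apply (Scale c) A x y = cs_scale A c x"
| "cs_apply Mult A x y = cs_mult A x y"
| "cs_apply Star A x y = cs_star A x"

lemma all_cs_op: "(\<forall>u. P u) \<longleftrightarrow> P Add \<and> (\<forall>c. P (Scale c)) \<and> P Mult \<and> P Star"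
  by (metis cs_op.exhaust)

lemma cstar_hom_iff:
  "h \<in> cstar_hom A B \<longleftrightarrow> h \<in> cs_carrier A \<rightarrow> cs_carrier B \<and>
     (\<forall>u. \<forall>x\<in>cs_carrier A. \<forall>y\<in>cs_carrier A. h (cs_apply u A x y) = cs_apply u B (h x) (h y))"
  unfolding cstar_hom_def all_cs_op by auto

lemma cstar_homI:
  assumes "\<And>x. x \<in> cs_carrier A \<Longrightarrow> h x \<in> cs_carrier B"
    and "\<And>u x y. x \<in> cs_carrier A \<Longrightarrow> y \<in> cs_carrier A \<Longrightarrow>
           h (cs_apply u A x y) = cs_apply u B (h x) (h y)"
  shows "h \<in> cstar_hom A B"
  using assms by (auto simp: cstar_hom_iff)

lemma cstar_homD:
  assumes "h \<in> cstar_hom A B" "x \<in> cs_carrier A"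
  shows "h x \<in> cs_carrier B"
    and "y \<in> cs_carrier A \<Longrightarrow> h (cs_apply u A x y) = cs_apply u B (h x) (h y)"
  using assms by (auto simp: cstar_hom_iff)

definition cs_diff :: "'a cstar \<Rightarrow> 'a \<Rightarrow> 'a \<Rightarrow> 'a" where
  "cs_diff A x y = cs_add A x (cs_scale A (-1) y)"

context cstar_algebra
begin

lemmas closed_simps [simp] = zero_closed add_closed scale_closed mult_closed star_closed

lemma apply_closed [simp]:
  "\<lbrakk>x \<in> cs_carrier A; y \<in> cs_carrier A\<rbrakk> \<Longrightarrow> cs_apply u A x y \<in> cs_carrier A"
  by (cases u) auto

lemma diff_closed [simp]:
  "\<lbrakk>x \<in> cs_carrier A; y \<in> cs_carrier A\<rbrakk> \<Longrightarrow> cs_diff A x y \<in> cs_carrier A"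
  by (simp add: cs_diff_def)

lemma zero_add: "x \<in> cs_carrier A \<Longrightarrow> cs_add A (cs_zero A) x = x"
  using add_zero[of x] add_commute[of x "cs_zero A"] by simp

lemma add_left_commute:
  "\<lbrakk>x \<in> cs_carrier A; y \<in> cs_carrier A; z \<in> cs_carrier A\<rbrakk> \<Longrightarrow>
    cs_add A x (cs_add A y z) = cs_add A y (cs_add A x z)"
  by (metis add_assoc add_commute)

lemmas add_ac = add_assoc add_commute add_left_commute

lemma norm_zero [simp]: "cs_norm A (cs_zero A) = 0"
  using norm_eq_zero by auto

lemma scale_zero [simp]:
  "x \<in> cs_carrier A \<Longrightarrow> cs_scale A 0 x = cs_zero A"
  "cs_scale A c (cs_zero A) = cs_zero A"
proof -
  show *: "cs_scale A 0 x = cs_zero A" if "x \<in> cs_carrier A" for x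
    using norm_scale[OF that, of 0] norm_eq_zero[of "cs_scale A 0 x"] that by simp
  show "cs_scale A c (cs_zero A) = cs_zero A"
    using *[of "cs_zero A"] scale_scale[of "cs_zero A" c 0] by simp
qed

lemma mult_zero [simp]:
  assumes "x \<in> cs_carrier A"
  shows "cs_mult A (cs_zero A) x = cs_zero A" "cs_mult A x (cs_zero A) = cs_zero A"
  using mult_scale_left[of "cs_zero A" x 0] mult_scale_right[of x "cs_zero A" 0] assms by auto

lemma star_zero [simp]: "cs_star A (cs_zero A) = cs_zero A"
  using star_scale[of "cs_zero A" 0] by simp

lemma apply_zero [simp]: "cs_apply u A (cs_zero A) (cs_zero A) = cs_zero A"
  by (cases u) (auto simp: add_zero)

lemma diff_self [simp]: "x \<in> cs_carrier A \<Longrightarrow> cs_diff A x x = cs_zero A"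
  by (simp add: cs_diff_def add_uminus)

lemma diff_zero [simp]: "x \<in> cs_carrier A \<Longrightarrow> cs_diff A x (cs_zero A) = x"
  by (simp add: cs_diff_def add_zero)

lemma diff_add_cancel:
  assumes "x \<in> cs_carrier A" "y \<in> cs_carrier A"
  shows "cs_add A (cs_diff A x y) y = x"
proof -
  have "cs_add A (cs_scale A (-1) y) y = cs_zero A"
    using add_uminus[of y] add_commute[of y "cs_scale A (-1) y"] assms by simp
  then show ?thesis using assms by (simp add: cs_diff_def add_assoc add_zero)
qed

lemma diff_eq_zero:
  "\<lbrakk>x \<in> cs_carrier A; y \<in> cs_carrier A\<rbrakk> \<Longrightarrow> cs_diff A x y = cs_zero A \<longleftrightarrow> x = y"
  using diff_add_cancel[of x y] zero_add[of y] by auto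

lemma diff_split:
  assumes "x \<in> cs_carrier A" "y \<in> cs_carrier A" "z \<in> cs_carrier A"
  shows "cs_diff A x z = cs_add A (cs_diff A x y) (cs_diff A y z)"
proof -
  have "cs_add A (cs_diff A x y) (cs_diff A y z)
      = cs_add A (cs_add A (cs_diff A x y) y) (cs_scale A (-1) z)"
    using assms by (simp add: cs_diff_def add_assoc)
  then show ?thesis using assms by (simp add: diff_add_cancel) (simp add: cs_diff_def)
qed

lemma norm_diff_triangle:
  assumes "x \<in> cs_carrier A" "y \<in> cs_carrier A" "z \<in> cs_carrier A"
  shows "cs_norm A (cs_diff A x z) \<le> cs_norm A (cs_diff A x y) + cs_norm A (cs_diff A y z)"
  using norm_triangle[of "cs_diff A x y" "cs_diff A y z"] diff_split[OF assms] assms by simp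

lemma diff_uminus:
  assumes "x \<in> cs_carrier A" "y \<in> cs_carrier A"
  shows "cs_scale A (-1) (cs_diff A x y) = cs_diff A y x"
  using assms by (simp add: cs_diff_def scale_add_right scale_scale scale_one add_commute)

lemma norm_diff_commute:
  assumes "x \<in> cs_carrier A" "y \<in> cs_carrier A"
  shows "cs_norm A (cs_diff A x y) = cs_norm A (cs_diff A y x)"
  using norm_scale[of "cs_diff A y x" "-1"] diff_uminus[of y x] assms by simp

lemma norm_diff_eq_zero:
  "\<lbrakk>x \<in> cs_carrier A; y \<in> cs_carrier A\<rbrakk> \<Longrightarrow> cs_norm A (cs_diff A x y) = 0 \<longleftrightarrow> x = y"
  by (simp add: norm_eq_zero diff_eq_zero)

lemma norm_reverse_triangle:
  assumes "x \<in> cs_carrier A" "y \<in> cs_carrier A"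
  shows "\<bar>cs_norm A x - cs_norm A y\<bar> \<le> cs_norm A (cs_diff A x y)"
  using norm_diff_triangle[of x y "cs_zero A"] norm_diff_triangle[of y x "cs_zero A"]
    norm_diff_commute[of x y] assms by simp

lemma scale_diff:
  "\<lbrakk>x \<in> cs_carrier A; y \<in> cs_carrier A\<rbrakk> \<Longrightarrow>
    cs_scale A c (cs_diff A x y) = cs_diff A (cs_scale A c x) (cs_scale A c y)"
  by (simp add: cs_diff_def scale_add_right scale_scale)

lemma scale_diff_left:
  "x \<in> cs_carrier A \<Longrightarrow> cs_scale A (b - c) x = cs_diff A (cs_scale A b x) (cs_scale A c x)"
  using scale_add_left[of x b "-c"] by (simp add: cs_diff_def scale_scale)

lemma mult_diff:
  assumes "x \<in> cs_carrier A" "y \<in> cs_carrier A" "z \<in> cs_carrier A"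
  shows "cs_mult A (cs_diff A x y) z = cs_diff A (cs_mult A x z) (cs_mult A y z)"
    "cs_mult A z (cs_diff A x y) = cs_diff A (cs_mult A z x) (cs_mult A z y)"
  using assms by (auto simp: cs_diff_def mult_add_left mult_add_right mult_scale_left mult_scale_right)

lemma add_diff_add:
  assumes "x \<in> cs_carrier A" "y \<in> cs_carrier A" "x' \<in> cs_carrier A" "y' \<in> cs_carrier A"
  shows "cs_diff A (cs_add A x y) (cs_add A x' y') = cs_add A (cs_diff A x x') (cs_diff A y y')"
  using assms by (simp add: cs_diff_def scale_add_right add_ac)

lemma star_diff:
  "\<lbrakk>x \<in> cs_carrier A; y \<in> cs_carrier A\<rbrakk> \<Longrightarrow>
    cs_star A (cs_diff A x y) = cs_diff A (cs_star A x) (cs_star A y)"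
  by (simp add: cs_diff_def star_add star_scale)

lemma norm_star [simp]:
  assumes "x \<in> cs_carrier A"
  shows "cs_norm A (cs_star A x) = cs_norm A x"
proof -
  have *: "cs_norm A x \<le> cs_norm A (cs_star A x)" if "x \<in> cs_carrier A" for x
  proof (cases "cs_norm A x = 0")
    case False
    have "cs_norm A x * cs_norm A x \<le> cs_norm A (cs_star A x) * cs_norm A x"
      using norm_mult[of "cs_star A x" x] cstar_identity[OF that] that by (simp add: power2_eq_square)
    then show ?thesis using False norm_nonneg[OF that] by simp
  qed (use that norm_nonneg in auto)
  show ?thesis using *[of x] *[of "cs_star A x"] assms star_star by force
qed

text \<open>The modulus for the product has to absorb the norms of both factors.\<close>

lemma apply_continuous:
  assumes x: "x \<in> cs_carrier A" "y \<in> cs_carrier A" and e: "0 < (e::real)"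
  obtains d where "0 < d"
    "\<And>x' y'. \<lbrakk>x' \<in> cs_carrier A; y' \<in> cs_carrier A; cs_norm A (cs_diff A x' x) \<le> d;
        cs_norm A (cs_diff A y' y) \<le> d\<rbrakk> \<Longrightarrow>
        cs_norm A (cs_diff A (cs_apply u A x' y') (cs_apply u A x y)) \<le> e"
proof (cases u)
  case Add
  show ?thesis
  proof (rule that[of "e/2"])
    fix x' y' assume "x' \<in> cs_carrier A" "y' \<in> cs_carrier A" "cs_norm A (cs_diff A x' x) \<le> e/2"
        "cs_norm A (cs_diff A y' y) \<le> e/2"
    then show "cs_norm A (cs_diff A (cs_apply u A x' y') (cs_apply u A x y)) \<le> e"
      using x norm_triangle[of "cs_diff A x' x" "cs_diff A y' y"] by (simp add: Add add_diff_add)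
  qed (use e in auto)
next
  case (Scale c)
  show ?thesis
  proof (rule that[of "e/(cmod c + 1)"])
    show "0 < e/(cmod c + 1)" using e by (simp add: add_nonneg_pos)
    fix x' y' assume h: "x' \<in> cs_carrier A" "y' \<in> cs_carrier A" "cs_norm A (cs_diff A x' x) \<le> e/(cmod c + 1)"
    have "cmod c * cs_norm A (cs_diff A x' x) \<le> (cmod c + 1) * (e/(cmod c + 1))"
      using h x norm_nonneg by (intro mult_mono) auto
    also have "\<dots> = e" by (simp add: add_nonneg_eq_0_iff)
    finally show "cs_norm A (cs_diff A (cs_apply u A x' y') (cs_apply u A x y)) \<le> e"
      using h x by (simp add: Scale scale_diff[symmetric] norm_scale)
  qed
next
  case Mult
  define C where "C = cs_norm A x + cs_norm A y + 1"
  have C: "0 < C" "1 \<le> C" using norm_nonneg x by (auto simp: C_def add_nonneg_pos)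
  show ?thesis
  proof (rule that[of "min 1 (e/(2*C))"])
    show "0 < min 1 (e/(2*C))" using e C by simp
    fix x' y' assume h: "x' \<in> cs_carrier A" "y' \<in> cs_carrier A" "cs_norm A (cs_diff A x' x) \<le> min 1 (e/(2*C))"
      "cs_norm A (cs_diff A y' y) \<le> min 1 (e/(2*C))"
    have y': "cs_norm A y' \<le> C"
      using norm_reverse_triangle[of y' y] h x norm_nonneg[of x] by (simp add: C_def abs_le_iff)
    have eq: "cs_diff A (cs_mult A x' y') (cs_mult A x y)
        = cs_add A (cs_mult A (cs_diff A x' x) y') (cs_mult A x (cs_diff A y' y))"
      using diff_split[of "cs_mult A x' y'" "cs_mult A x y'" "cs_mult A x y"] h x by (simp add: mult_diff)
    have "cs_norm A (cs_mult A (cs_diff A x' x) y') \<le> (e/(2*C)) * C"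
      using norm_mult[of "cs_diff A x' x" y'] h x y' norm_nonneg[of y'] C e
      by (smt (verit, best) divide_pos_pos diff_closed min_less_iff_conj mult_mono)
    moreover have "cs_norm A (cs_mult A x (cs_diff A y' y)) \<le> C * (e/(2*C))"
      using norm_mult[of x "cs_diff A y' y"] h x y' norm_nonneg[of y] norm_nonneg[of x] C e
        norm_nonneg[of "cs_diff A y' y"]
      by (smt (verit, best) C_def divide_pos_pos diff_closed min_less_iff_conj mult_mono)
    ultimately show "cs_norm A (cs_diff A (cs_apply u A x' y') (cs_apply u A x y)) \<le> e"
      using norm_triangle[of "cs_mult A (cs_diff A x' x) y'" "cs_mult A x (cs_diff A y' y)"] C h x
      by (simp add: Mult eq)
  qed
next
  case Star
  show ?thesis
    by (rule that[of e]) (use e x in \<open>auto simp: Star star_diff[symmetric]\<close>)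
qed

sublocale M: Metric_space "cs_carrier A" "cs_dist A"
proof
  show "0 \<le> cs_dist A x y" for x y
    by (auto simp: cs_dist_def norm_nonneg)
  show "cs_dist A x y = cs_dist A y x" for x y
    using norm_diff_commute by (auto simp: cs_dist_def cs_diff_def)
  show "cs_dist A x y = 0 \<longleftrightarrow> x = y" if "x \<in> cs_carrier A" "y \<in> cs_carrier A" for x y
    using norm_diff_eq_zero[OF that] that by (auto simp: cs_dist_def cs_diff_def)
  show "cs_dist A x z \<le> cs_dist A x y + cs_dist A y z"
    if "x \<in> cs_carrier A" "y \<in> cs_carrier A" "z \<in> cs_carrier A" for x y z
    using norm_diff_triangle[OF that] that by (auto simp: cs_dist_def cs_diff_def)
qed

lemma dist_eq: "\<lbrakk>x \<in> cs_carrier A; y \<in> cs_carrier A\<rbrakk> \<Longrightarrow> cs_dist A x y = cs_norm A (cs_diff A x y)"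
  by (simp add: cs_dist_def cs_diff_def)

lemma Cauchy_limit:
  assumes "\<And>n::nat. s n \<in> cs_carrier A"
    and "\<And>e. 0 < e \<Longrightarrow> \<exists>N. \<forall>n\<ge>N. \<forall>k\<ge>N. cs_norm A (cs_diff A (s n) (s k)) < e"
  obtains x where "x \<in> cs_carrier A"
    "\<And>e. 0 < e \<Longrightarrow> \<exists>N. \<forall>n\<ge>N. cs_norm A (cs_diff A (s n) x) < e"
proof -
  have "M.MCauchy s"
    unfolding M.MCauchy_def using assms by (auto simp: dist_eq)
  then obtain x where "limitin M.mtopology s x sequentially"
    using complete by (auto simp: M.mcomplete_def)
  then show ?thesis
    using that[of x] assms(1) by (auto simp: M.limit_metric_sequentially dist_eq)
qed

lemma topspace_cs_topology [simp]: "topspace (cs_topology A) = cs_carrier A"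
  by (simp add: cs_topology_def)

text \<open>The bound is not strict because it will be checked in supremum norms, where strict bounds on all
components give only \<open>\<le>\<close>.\<close>

lemma continuous_map_iff:
  "continuous_map X (cs_topology A) f \<longleftrightarrow> f \<in> topspace X \<rightarrow> cs_carrier A \<and>
     (\<forall>x\<in>topspace X. \<forall>e>0. \<exists>U. openin X U \<and> x \<in> U \<and>
        (\<forall>y\<in>U. cs_norm A (cs_diff A (f y) (f x)) \<le> e))"
  (is "?L \<longleftrightarrow> ?c \<and> ?R")
proof
  assume L: ?L
  then have c: ?c
    using continuous_map_funspace by fastforce
  have "\<exists>U. openin X U \<and> x \<in> U \<and> (\<forall>y\<in>U. cs_norm A (cs_diff A (f y) (f x)) \<le> e)"
    if x: "x \<in> topspace X" "0 < e" for x e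
  proof -
    obtain U where U: "openin X U" "x \<in> U" "\<And>y. y \<in> U \<Longrightarrow> f y \<in> M.mball (f x) e"
      using L x unfolding cs_topology_def M.continuous_map_to_metric by meson
    have "cs_norm A (cs_diff A (f y) (f x)) \<le> e" if "y \<in> U" for y
      using U(3)[OF that] M.commute by (auto simp: M.in_mball dist_eq norm_diff_commute)
    with U show ?thesis by blast
  qed
  with c show "?c \<and> ?R" by blast
next
  assume R: "?c \<and> ?R"
  show ?L
    unfolding cs_topology_def M.continuous_map_to_metric
  proof (intro ballI allI impI)
    fix x e assume x: "x \<in> topspace X" and e: "0 < (e::real)"
    then have "0 < e/2" by simp
    with R x obtain U where U: "openin X U" "x \<in> U" "\<And>y. y \<in> U \<Longrightarrow> cs_norm A (cs_diff A (f y) (f x)) \<le> e/2"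
      by meson
    have "f y \<in> M.mball (f x) e" if "y \<in> U" for y
    proof -
      have "y \<in> topspace X" using U(1) that openin_subset by blast
      then show ?thesis
        using R x U(3)[OF that] e by (auto simp: M.in_mball dist_eq norm_diff_commute Pi_iff)
    qed
    with U show "\<exists>U. openin X U \<and> x \<in> U \<and> (\<forall>y\<in>U. f y \<in> M.mball (f x) e)" by blast
  qed
qed

lemma continuous_mapD:
  assumes "continuous_map X (cs_topology A) f"
  shows "x \<in> topspace X \<Longrightarrow> f x \<in> cs_carrier A"
    and "\<lbrakk>x \<in> topspace X; 0 < e\<rbrakk> \<Longrightarrow> \<exists>U. openin X U \<and> x \<in> U \<and>
        (\<forall>y\<in>U. cs_norm A (cs_diff A (f y) (f x)) \<le> e)"
  using assms unfolding continuous_map_iff by auto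

lemma continuous_map_apply:
  assumes f: "continuous_map X (cs_topology A) f" and g: "continuous_map X (cs_topology A) g"
  shows "continuous_map X (cs_topology A) (\<lambda>x. cs_apply u A (f x) (g x))"
  unfolding continuous_map_iff
proof (intro conjI ballI allI impI)
  show "(\<lambda>x. cs_apply u A (f x) (g x)) \<in> topspace X \<rightarrow> cs_carrier A"
    using continuous_mapD(1)[OF f] continuous_mapD(1)[OF g] by auto
  fix x e assume x: "x \<in> topspace X" "0 < (e::real)"
  obtain d where d: "0 < d"
    "\<And>x' y'. \<lbrakk>x' \<in> cs_carrier A; y' \<in> cs_carrier A; cs_norm A (cs_diff A x' (f x)) \<le> d;
        cs_norm A (cs_diff A y' (g x)) \<le> d\<rbrakk> \<Longrightarrow>
        cs_norm A (cs_diff A (cs_apply u A x' y') (cs_apply u A (f x) (g x))) \<le> e"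
    using apply_continuous[of "f x" "g x" e u] continuous_mapD(1)[OF f] continuous_mapD(1)[OF g] x by metis
  obtain U V where U: "openin X U" "x \<in> U" "\<forall>y\<in>U. cs_norm A (cs_diff A (f y) (f x)) \<le> d"
    and V: "openin X V" "x \<in> V" "\<forall>y\<in>V. cs_norm A (cs_diff A (g y) (g x)) \<le> d"
    using continuous_mapD(2)[OF f x(1) d(1)] continuous_mapD(2)[OF g x(1) d(1)] by blast
  have "U \<subseteq> topspace X" using U openin_subset by blast
  then show "\<exists>U. openin X U \<and> x \<in> U \<and>
      (\<forall>y\<in>U. cs_norm A (cs_diff A (cs_apply u A (f y) (g y)) (cs_apply u A (f x) (g x))) \<le> e)"
    using U V continuous_mapD(1)[OF f] continuous_mapD(1)[OF g]
    by (intro exI[of _ "U \<inter> V"]) (auto intro!: d(2))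
qed

lemma continuous_map_norm:
  assumes f: "continuous_map X (cs_topology A) f"
  shows "continuous_map X euclideanreal (\<lambda>x. cs_norm A (f x))"
proof -
  have *: "\<exists>U. openin X U \<and> x \<in> U \<and> (\<forall>y\<in>U. dist (cs_norm A (f x)) (cs_norm A (f y)) < e)"
    if x: "x \<in> topspace X" "0 < e" for x e
  proof -
    have "0 < e/2" using x by simp
    then obtain U where U: "openin X U" "x \<in> U" "\<forall>y\<in>U. cs_norm A (cs_diff A (f y) (f x)) \<le> e/2"
      using continuous_mapD(2)[OF f x(1)] by meson
    have "dist (cs_norm A (f x)) (cs_norm A (f y)) < e" if "y \<in> U" for y
    proof -
      have "y \<in> topspace X" using U(1) that openin_subset by blast
      then show ?thesis using norm_reverse_triangle[of "f y" "f x"] U(3) that x continuous_mapD(1)[OF f]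
        by (fastforce simp: dist_real_def)
    qed
    with U show ?thesis by blast
  qed
  show ?thesis
    using Met_TC.continuous_map_to_metric[of X "\<lambda>x. cs_norm A (f x)"] *
    by simp
qed

end


section \<open>Closed subalgebras and bounded sums\<close>

text \<open>Completeness is the only axiom that is not inherited as it stands; a Cauchy sequence in \<open>C\<close> has a
limit in \<open>A\<close>, which can be approximated by elements of \<open>C\<close>.\<close>

lemma cstar_subalgebra:
  assumes A: "cstar_algebra A" and sub: "C \<subseteq> cs_carrier A" and zero: "cs_zero A \<in> C"
    and op: "\<And>u x y. x \<in> C \<Longrightarrow> y \<in> C \<Longrightarrow> cs_apply u A x y \<in> C"
    and closed: "\<And>x. x \<in> cs_carrier A \<Longrightarrow>
      (\<And>e. 0 < e \<Longrightarrow> \<exists>y\<in>C. cs_norm A (cs_diff A y x) \<le> e) \<Longrightarrow> x \<in> C"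
  shows "cstar_algebra (A\<lparr>cs_carrier := C\<rparr>)"
proof -
  interpret A: cstar_algebra A by (rule A)
  have C: "x \<in> C \<Longrightarrow> x \<in> cs_carrier A" for x using sub by auto
  have d: "cs_dist (A\<lparr>cs_carrier := C\<rparr>) x y = cs_dist A x y" if "x \<in> C" "y \<in> C" for x y
    using that C by (simp add: cs_dist_def)
  have closed_ops: "\<And>x y. x \<in> C \<Longrightarrow> y \<in> C \<Longrightarrow> cs_add A x y \<in> C"
    "\<And>x c. x \<in> C \<Longrightarrow> cs_scale A c x \<in> C"
    "\<And>x y. x \<in> C \<Longrightarrow> y \<in> C \<Longrightarrow> cs_mult A x y \<in> C" "\<And>x. x \<in> C \<Longrightarrow> cs_star A x \<in> C"
    using op[where u=Add] op[where u="Scale _"] op[where u=Mult] op[where u=Star] by simp_all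
  interpret S: Metric_space C "cs_dist (A\<lparr>cs_carrier := C\<rparr>)"
  proof
    show "0 \<le> cs_dist (A\<lparr>cs_carrier := C\<rparr>) x y" for x y
      using C A.norm_nonneg[OF A.diff_closed, of x y] by (auto simp: cs_dist_def cs_diff_def)
    show "cs_dist (A\<lparr>cs_carrier := C\<rparr>) x y = cs_dist (A\<lparr>cs_carrier := C\<rparr>) y x" for x y
      using C A.norm_diff_commute[of x y] by (auto simp: cs_dist_def cs_diff_def)
  qed (use C A.M.triangle in \<open>auto simp: d\<close>)
  have "S.mcomplete"
    unfolding S.mcomplete_def
  proof (intro allI impI)
    fix s assume s: "S.MCauchy s"
    then have sC: "s n \<in> C" for n by (auto simp: S.MCauchy_def)
    have "\<exists>N. \<forall>n\<ge>N. \<forall>k\<ge>N. cs_norm A (cs_diff A (s n) (s k)) < e" if "0 < e" for e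
    proof -
      have "\<exists>N. \<forall>n n'. N \<le> n \<longrightarrow> N \<le> n' \<longrightarrow> cs_dist (A\<lparr>cs_carrier := C\<rparr>) (s n) (s n') < e"
        using s that by (auto simp: S.MCauchy_def)
      then show ?thesis using sC C by (simp add: d A.dist_eq)
    qed
    then obtain x where x: "x \<in> cs_carrier A"
      "\<And>e. 0 < e \<Longrightarrow> \<exists>N. \<forall>n\<ge>N. cs_norm A (cs_diff A (s n) x) < e"
      using A.Cauchy_limit[of s] sC C by metis
    have "x \<in> C"
    proof (rule closed[OF x(1)])
      fix e :: real assume "0 < e"
      then show "\<exists>y\<in>C. cs_norm A (cs_diff A y x) \<le> e"
        using x(2)[of e] sC by (meson less_imp_le order_refl)
    qed
    then have "limitin S.mtopology s x sequentially"
      using x sC C by (simp add: S.limit_metric_sequentially d A.dist_eq)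
    then show "\<exists>x. limitin S.mtopology s x sequentially" by blast
  qed
  then show ?thesis
    apply unfold_locales
                        apply (simp_all add: zero closed_ops)
    by (((rule A.add_assoc A.add_commute A.add_zero A.add_uminus A.scale_add_right A.scale_add_left
        A.scale_scale A.scale_one A.mult_assoc A.mult_add_left A.mult_add_right A.mult_scale_left
        A.mult_scale_right A.star_star A.star_add A.star_scale A.star_mult A.norm_nonneg A.norm_eq_zero
        A.norm_scale A.norm_triangle A.norm_mult A.cstar_identity); simp add: C)+)
qed

lemma direct_sum_simps [simp]:
  "cs_carrier (direct_sum I A) = (\<Pi>\<^sub>E i\<in>I. cs_carrier (A i))"
  "cs_zero (direct_sum I A) = (\<lambda>i\<in>I. cs_zero (A i))"
  "cs_apply u (direct_sum I A) x y = (\<lambda>i\<in>I. cs_apply u (A i) (x i) (y i))"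
  "cs_diff (direct_sum I A) x y = (\<lambda>i\<in>I. cs_diff (A i) (x i) (y i))"
  by (cases u; auto simp: direct_sum_def cs_diff_def fun_eq_iff)+

lemma cs_update_simps [simp]:
  "cs_apply u (A\<lparr>cs_carrier := C\<rparr>) = cs_apply u A"
  "cs_diff (A\<lparr>cs_carrier := C\<rparr>) = cs_diff A"
  by (cases u; auto simp: cs_diff_def fun_eq_iff)+

lemma direct_sum_norm_le_iff:
  assumes "bdd_above ((\<lambda>i. cs_norm (A i) (x i)) ` I)"
  shows "cs_norm (direct_sum I A) x \<le> e \<longleftrightarrow> 0 \<le> e \<and> (\<forall>i\<in>I. cs_norm (A i) (x i) \<le> e)"
  using assms by (auto simp: direct_sum_def cSup_le_iff)

lemma direct_sum_norm_upper:
  assumes "bdd_above ((\<lambda>i. cs_norm (A i) (x i)) ` I)"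
  shows "0 \<le> cs_norm (direct_sum I A) x" "i \<in> I \<Longrightarrow> cs_norm (A i) (x i) \<le> cs_norm (direct_sum I A) x"
  using direct_sum_norm_le_iff[OF assms, of "cs_norm (direct_sum I A) x"] by auto

text \<open>The \<open>\<ell>\<^sup>\<infinity>\<close>-sum is the common ambient algebra: finite direct sums, algebras of continuous
  functions on compact spaces and skeleta are closed subalgebras of such sums, so the axioms have to
  be verified componentwise only once.\<close>

definition bounded_sum :: "'i set \<Rightarrow> ('i \<Rightarrow> 'a cstar) \<Rightarrow> ('i \<Rightarrow> 'a) cstar" where
  "bounded_sum I A = (direct_sum I A)\<lparr>cs_carrier :=
     {x \<in> \<Pi>\<^sub>E i\<in>I. cs_carrier (A i). bdd_above ((\<lambda>i. cs_norm (A i) (x i)) ` I)}\<rparr>"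

lemma bdd_above_le:
  assumes "\<And>i. i \<in> I \<Longrightarrow> f i \<le> (b::real)"
  shows "bdd_above (f ` I)"
  using assms by (auto intro!: bdd_aboveI)

text \<open>A Cauchy sequence converges in each component, and its Cauchy estimates, which are uniform in the
component, pass to the limit. The identities of norms hold for suprema because squaring and scaling
are monotone.\<close>

lemma cstar_bounded_sum:
  assumes A: "\<And>i. i \<in> I \<Longrightarrow> cstar_algebra (A i)"
  shows "cstar_algebra (bounded_sum I A)"
proof -
  define B where "B = bounded_sum I A"
  define S where "S = cs_carrier B"
  have SD: "x \<in> (\<Pi>\<^sub>E i\<in>I. cs_carrier (A i))" "bdd_above ((\<lambda>i. cs_norm (A i) (x i)) ` I)" if "x \<in> S" for x
    using that by (auto simp: S_def B_def bounded_sum_def)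
  have SI: "x \<in> S" if "x \<in> (\<Pi>\<^sub>E i\<in>I. cs_carrier (A i))" "\<And>i. i \<in> I \<Longrightarrow> cs_norm (A i) (x i) \<le> b" for x b
    using that bdd_above_le[of I "\<lambda>i. cs_norm (A i) (x i)" b] by (auto simp: S_def B_def bounded_sum_def)
  have Sc: "x i \<in> cs_carrier (A i)" if "x \<in> S" "i \<in> I" for x i
    using SD[OF that(1)] that(2) by auto
  have eqI: "x = y" if "x \<in> S" "y \<in> S" "\<And>i. i \<in> I \<Longrightarrow> x i = y i" for x y
    using SD(1)[OF that(1)] SD(1)[OF that(2)] that(3) by (rule PiE_ext)
  have ops: "cs_zero B = (\<lambda>i\<in>I. cs_zero (A i))" "cs_add B = (\<lambda>x y. \<lambda>i\<in>I. cs_add (A i) (x i) (y i))"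
    "cs_scale B = (\<lambda>c x. \<lambda>i\<in>I. cs_scale (A i) c (x i))" "cs_mult B = (\<lambda>x y. \<lambda>i\<in>I. cs_mult (A i) (x i) (y i))"
    "cs_star B = (\<lambda>x. \<lambda>i\<in>I. cs_star (A i) (x i))" "cs_norm B = cs_norm (direct_sum I A)"
    by (auto simp: B_def bounded_sum_def direct_sum_def)
  have le: "cs_norm B x \<le> e \<longleftrightarrow> 0 \<le> e \<and> (\<forall>i\<in>I. cs_norm (A i) (x i) \<le> e)" if "x \<in> S" for x e
    unfolding ops by (rule direct_sum_norm_le_iff[OF SD(2)[OF that]])
  have up: "0 \<le> cs_norm B x" "i \<in> I \<Longrightarrow> cs_norm (A i) (x i) \<le> cs_norm B x" if "x \<in> S" for x i
    unfolding ops using direct_sum_norm_upper[OF SD(2)[OF that]] by auto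
  have zero: "cs_zero B \<in> S"
    by (rule SI[of _ 0]) (auto simp: ops cstar_algebra.zero_closed[OF A] cstar_algebra.norm_zero[OF A])
  have add: "cs_add B x y \<in> S" "cs_norm B (cs_add B x y) \<le> cs_norm B x + cs_norm B y"
    if xy: "x \<in> S" "y \<in> S" for x y
  proof -
    have b: "cs_norm (A i) (cs_add (A i) (x i) (y i)) \<le> cs_norm B x + cs_norm B y" if "i \<in> I" for i
      using cstar_algebra.norm_triangle[OF A[OF that] Sc[OF xy(1) that] Sc[OF xy(2) that]]
        up(2)[OF xy(1) that] up(2)[OF xy(2) that] by linarith
    then show *: "cs_add B x y \<in> S"
      using xy by (intro SI[of _ "cs_norm B x + cs_norm B y"])
        (auto simp: ops Sc cstar_algebra.add_closed[OF A])
    show "cs_norm B (cs_add B x y) \<le> cs_norm B x + cs_norm B y"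
      unfolding le[OF *] using b up(1)[OF xy(1)] up(1)[OF xy(2)] by (simp add: ops)
  qed
  have mult: "cs_mult B x y \<in> S" "cs_norm B (cs_mult B x y) \<le> cs_norm B x * cs_norm B y"
    if xy: "x \<in> S" "y \<in> S" for x y
  proof -
    have b: "cs_norm (A i) (cs_mult (A i) (x i) (y i)) \<le> cs_norm B x * cs_norm B y" if "i \<in> I" for i
      using cstar_algebra.norm_mult[OF A[OF that] Sc[OF xy(1) that] Sc[OF xy(2) that]]
        mult_mono[OF up(2)[OF xy(1) that] up(2)[OF xy(2) that]]
        cstar_algebra.norm_nonneg[OF A[OF that] Sc[OF xy(2) that]] up(1)[OF xy(1)] by linarith
    then show *: "cs_mult B x y \<in> S"
      using xy by (intro SI[of _ "cs_norm B x * cs_norm B y"])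
        (auto simp: ops Sc cstar_algebra.mult_closed[OF A])
    show "cs_norm B (cs_mult B x y) \<le> cs_norm B x * cs_norm B y"
      unfolding le[OF *] using b up(1)[OF xy(1)] up(1)[OF xy(2)] by (simp add: ops)
  qed
  have star: "cs_star B x \<in> S" if x: "x \<in> S" for x
    using up(2)[OF x] x by (intro SI[of _ "cs_norm B x"])
      (auto simp: ops Sc cstar_algebra.star_closed[OF A] cstar_algebra.norm_star[OF A])
  have scale: "cs_scale B c x \<in> S" if x: "x \<in> S" for x c
    using up(2)[OF x] x by (intro SI[of _ "cmod c * cs_norm B x"])
      (auto simp: ops Sc cstar_algebra.scale_closed[OF A] cstar_algebra.norm_scale[OF A] mult_left_mono)
  have nscale: "cs_norm B (cs_scale B c x) = cmod c * cs_norm B x" if x: "x \<in> S" for x c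
  proof (rule antisym)
    show "cs_norm B (cs_scale B c x) \<le> cmod c * cs_norm B x"
      unfolding le[OF scale[OF x]] using up[OF x] x
      by (auto simp: ops Sc cstar_algebra.norm_scale[OF A] mult_left_mono)
    show "cmod c * cs_norm B x \<le> cs_norm B (cs_scale B c x)"
    proof (cases "c = 0")
      case False
      have "cs_norm B x \<le> cs_norm B (cs_scale B c x) / cmod c"
        unfolding le[OF x] using up(1)[OF scale[OF x, of c]] False up(2)[OF scale[OF x, of c]] x
        by (auto simp: ops Sc cstar_algebra.norm_scale[OF A] field_simps)
      with False show ?thesis by (simp add: field_simps)
    qed (use up(1)[OF scale[OF x]] in auto)
  qed
  have cident: "cs_norm B (cs_mult B (cs_star B x) x) = (cs_norm B x)\<^sup>2" if x: "x \<in> S" for x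
  proof (rule antisym)
    have n: "cs_norm (A i) (cs_mult B (cs_star B x) x i) = (cs_norm (A i) (x i))\<^sup>2" if "i \<in> I" for i
      using cstar_algebra.cstar_identity[OF A[OF that] Sc[OF x that]] that by (simp add: ops)
    show "cs_norm B (cs_mult B (cs_star B x) x) \<le> (cs_norm B x)\<^sup>2"
      unfolding le[OF mult(1)[OF star[OF x] x]] using up(2)[OF x] x
      by (auto simp: n Sc cstar_algebra.norm_nonneg[OF A] power_mono)
    have "cs_norm B x \<le> sqrt (cs_norm B (cs_mult B (cs_star B x) x))"
      unfolding le[OF x] using up[OF mult(1)[OF star[OF x] x]] n
      by (metis real_le_rsqrt real_sqrt_ge_0_iff)
    then show "(cs_norm B x)\<^sup>2 \<le> cs_norm B (cs_mult B (cs_star B x) x)"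
      using up(1)[OF x] up(1)[OF mult(1)[OF star[OF x] x]]
      by (metis power_mono real_sqrt_pow2)
  qed
  have nz: "cs_norm B x = 0 \<longleftrightarrow> x = cs_zero B" if x: "x \<in> S" for x
  proof
    assume "cs_norm B x = 0"
    then have "cs_norm (A i) (x i) = 0" if "i \<in> I" for i
      using le[OF x, of 0] cstar_algebra.norm_nonneg[OF A[OF that] Sc[OF x that]] that by force
    then show "x = cs_zero B"
      by (intro eqI[OF x zero]) (simp add: ops cstar_algebra.norm_eq_zero[OF A Sc[OF x]])
  next
    assume "x = cs_zero B"
    then have "cs_norm B x \<le> 0"
      unfolding le[OF x] by (auto simp: ops cstar_algebra.norm_zero[OF A])
    then show "cs_norm B x = 0" using up(1)[OF x] by simp
  qed
  note cl = zero add(1) mult(1) star scale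
  define d where "d = (\<lambda>x y. cs_add B x (cs_scale B (-1) y))"
  have dS: "d x y \<in> S" if "x \<in> S" "y \<in> S" for x y using that by (simp add: d_def cl)
  have di: "d x y i = cs_diff (A i) (x i) (y i)" if "i \<in> I" for x y i
    using that by (simp add: d_def ops cs_diff_def)
  have de: "cs_dist B x y = cs_norm B (d x y)" if "x \<in> S" "y \<in> S" for x y
    using that by (simp add: cs_dist_def d_def S_def)
  interpret M: Metric_space S "cs_dist B"
  proof
    show "0 \<le> cs_dist B x y" for x y
      using up(1)[OF dS, of x y] by (auto simp: cs_dist_def d_def S_def)
    have *: "cs_norm B (d x y) \<le> cs_norm B (d y x)" if "x \<in> S" "y \<in> S" for x y
    proof -
      have "cs_norm (A i) (d x y i) = cs_norm (A i) (d y x i)" if i: "i \<in> I" for i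
        using cstar_algebra.norm_diff_commute[OF A[OF i] Sc[OF \<open>x \<in> S\<close> i] Sc[OF \<open>y \<in> S\<close> i]] i
        by (simp add: di)
      then show ?thesis
        unfolding le[OF dS[OF that]] using up[OF dS[OF that(2) that(1)]] by simp
    qed
    show "cs_dist B x y = cs_dist B y x" for x y
      using *[of x y] *[of y x] by (auto simp: cs_dist_def d_def S_def)
    show "cs_dist B x y = 0 \<longleftrightarrow> x = y" if xy: "x \<in> S" "y \<in> S" for x y
    proof -
      have "d x y = cs_zero B \<longleftrightarrow> x = y"
      proof
        assume *: "d x y = cs_zero B"
        show "x = y"
        proof (rule eqI[OF xy])
          fix i assume i: "i \<in> I"
          have "cs_diff (A i) (x i) (y i) = cs_zero (A i)"
            using fun_cong[OF *, of i] i by (simp add: di ops)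
          then show "x i = y i" using cstar_algebra.diff_eq_zero[OF A[OF i] Sc[OF xy(1) i] Sc[OF xy(2) i]] by simp
        qed
      next
        assume "x = y"
        then show "d x y = cs_zero B"
          using cstar_algebra.diff_self[OF A Sc[OF xy(2)]] by (intro eqI[OF dS[OF xy] zero]) (simp add: di ops)
      qed
      then show ?thesis using nz[OF dS[OF xy]] xy by (simp add: de)
    qed
    show "cs_dist B x z \<le> cs_dist B x y + cs_dist B y z" if xyz: "x \<in> S" "y \<in> S" "z \<in> S" for x y z
    proof -
      have "d x z = cs_add B (d x y) (d y z)"
      proof (rule eqI)
        fix i assume i: "i \<in> I"
        show "d x z i = cs_add B (d x y) (d y z) i"
          using cstar_algebra.diff_split[OF A[OF i] Sc[OF xyz(1) i] Sc[OF xyz(2) i] Sc[OF xyz(3) i]] i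
          by (simp add: di) (simp add: di ops)
      qed (use xyz in \<open>simp_all add: dS cl\<close>)
      then show ?thesis using add(2)[OF dS dS, of x y y z] xyz by (simp add: de)
    qed
  qed
  have "M.mcomplete"
    unfolding M.mcomplete_def
  proof (intro allI impI)
    fix s assume s: "M.MCauchy s"
    then have sS: "s n \<in> S" for n by (auto simp: M.MCauchy_def)
    have ca: "\<exists>N. \<forall>n\<ge>N. \<forall>k\<ge>N. \<forall>i\<in>I. cs_norm (A i) (cs_diff (A i) (s n i) (s k i)) < e" if e: "0 < e" for e
    proof -
      obtain N where N: "\<forall>n n'. N \<le> n \<longrightarrow> N \<le> n' \<longrightarrow> cs_dist B (s n) (s n') < e"
        using s e unfolding M.MCauchy_def by meson
      have "cs_norm (A i) (cs_diff (A i) (s n i) (s k i)) < e" if "n \<ge> N" "k \<ge> N" "i \<in> I" for n k i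
        using up(2)[OF dS[OF sS sS] that(3), of n k] N that by (force simp: de sS di)
      then show ?thesis by blast
    qed
    have "\<exists>l\<in>cs_carrier (A i). \<forall>e>0. \<exists>N. \<forall>n\<ge>N. cs_norm (A i) (cs_diff (A i) (s n i) l) < e" if i: "i \<in> I" for i
      by (rule cstar_algebra.Cauchy_limit[OF A[OF i], of "\<lambda>n. s n i"]) (use Sc[OF sS i] ca i in \<open>blast+\<close>)
    then obtain l where l: "\<And>i. i \<in> I \<Longrightarrow> l i \<in> cs_carrier (A i)"
      "\<And>i e. \<lbrakk>i \<in> I; 0 < e\<rbrakk> \<Longrightarrow> \<exists>N. \<forall>n\<ge>N. cs_norm (A i) (cs_diff (A i) (s n i) (l i)) < e"
      by metis
    have un: "\<exists>N. \<forall>n\<ge>N. \<forall>i\<in>I. cs_norm (A i) (cs_diff (A i) (s n i) (l i)) \<le> e" if e: "0 < e" for e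
    proof -
      obtain N where N: "\<forall>n\<ge>N. \<forall>k\<ge>N. \<forall>i\<in>I. cs_norm (A i) (cs_diff (A i) (s n i) (s k i)) < e/2"
        using ca[of "e/2"] e by auto
      have "cs_norm (A i) (cs_diff (A i) (s n i) (l i)) \<le> e" if n: "n \<ge> N" and i: "i \<in> I" for n i
      proof -
        obtain N' where "\<forall>n\<ge>N'. cs_norm (A i) (cs_diff (A i) (s n i) (l i)) < e/2"
          using l(2)[OF i, of "e/2"] e by auto
        then have "cs_norm (A i) (cs_diff (A i) (s (max N N') i) (l i)) < e/2" by simp
        moreover have "cs_norm (A i) (cs_diff (A i) (s n i) (s (max N N') i)) < e/2" using N n i by simp
        ultimately show ?thesis
          using cstar_algebra.norm_diff_triangle[OF A[OF i] Sc[OF sS i] Sc[OF sS i] l(1)[OF i], of n "max N N'"]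
          by linarith
      qed
      then show ?thesis by blast
    qed
    define x where "x = restrict l I"
    obtain N where N: "\<forall>n\<ge>N. \<forall>i\<in>I. cs_norm (A i) (cs_diff (A i) (s n i) (l i)) \<le> 1"
      using un[of 1] by auto
    have "cs_norm (A i) (l i) \<le> cs_norm B (s N) + 1" if i: "i \<in> I" for i
      using cstar_algebra.norm_reverse_triangle[OF A[OF i] Sc[OF sS i] l(1)[OF i], of N] N i up(2)[OF sS i, of N]
      by force
    then have xS: "x \<in> S" using l(1) by (intro SI[of _ "cs_norm B (s N) + 1"]) (auto simp: x_def)
    have "\<exists>N. \<forall>n\<ge>N. cs_norm B (d (s n) x) < e" if e: "0 < e" for e
    proof -
      obtain N where "\<forall>n\<ge>N. \<forall>i\<in>I. cs_norm (A i) (cs_diff (A i) (s n i) (l i)) \<le> e/2"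
        using un[of "e/2"] e by auto
      then have "cs_norm B (d (s n) x) \<le> e/2" if "n \<ge> N" for n
        unfolding le[OF dS[OF sS xS]] using e that by (auto simp: di x_def)
      then show ?thesis using e by (intro exI[of _ N]) force
    qed
    then have "limitin M.mtopology s x sequentially"
      using xS sS by (simp add: M.limit_metric_sequentially de)
    then show "\<exists>x. limitin M.mtopology s x sequentially" by blast
  qed
  then have "cstar_algebra B"
    apply (unfold_locales; fold S_def)
                        apply (simp_all only: cl up nz nscale add(2) mult(2) cident)
    \<comment> \<open>What remains are equations, and these hold in every component.\<close>
    by ((rule eqI, (simp add: cl; fail), (simp add: cl; fail), simp only: ops restrict_apply if_True,
        (rule A[THEN cstar_algebra.add_assoc] A[THEN cstar_algebra.add_commute] A[THEN cstar_algebra.add_zero]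
        A[THEN cstar_algebra.add_uminus] A[THEN cstar_algebra.scale_add_right] A[THEN cstar_algebra.scale_add_left]
        A[THEN cstar_algebra.scale_scale] A[THEN cstar_algebra.scale_one] A[THEN cstar_algebra.mult_assoc]
        A[THEN cstar_algebra.mult_add_left] A[THEN cstar_algebra.mult_add_right]
        A[THEN cstar_algebra.mult_scale_left] A[THEN cstar_algebra.mult_scale_right]
        A[THEN cstar_algebra.star_star] A[THEN cstar_algebra.star_add] A[THEN cstar_algebra.star_scale]
        A[THEN cstar_algebra.star_mult]; simp add: Sc))+)
  then show ?thesis by (simp add: B_def)
qed




section \<open>Homomorphisms into finite-dimensional algebras\<close>

lemma (in cstar_algebra) subspace_hull:
  assumes "B \<subseteq> cs_carrier A"
  shows "cs_subspace A (cs_subspace A hull B)"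
proof -
  have "cs_subspace A (cs_carrier A)" by (auto simp: cs_subspace_def)
  with assms show ?thesis
    unfolding hull_def cs_subspace_def[of A "\<Inter> _"] by (auto simp: cs_subspace_def)
qed

text \<open>Modulo the line through \<open>e\<close>, the span of \<open>insert e B\<close> is the span of \<open>B\<close>; this is the step in
inductions over a spanning set.\<close>

lemma (in cstar_algebra) hull_insert_split:
  assumes e: "e \<in> cs_carrier A" and B: "B \<subseteq> cs_carrier A" and v: "v \<in> cs_subspace A hull (insert e B)"
  shows "\<exists>c. cs_diff A v (cs_scale A c e) \<in> cs_subspace A hull B"
proof -
  let ?H = "cs_subspace A hull B"
  let ?V = "{v \<in> cs_carrier A. \<exists>c. cs_diff A v (cs_scale A c e) \<in> ?H}"
  have H: "cs_subspace A ?H" by (rule subspace_hull[OF B])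
  have h: "cs_diff A e (cs_scale A 1 e) \<in> ?H" "\<And>x. x \<in> B \<Longrightarrow> cs_diff A x (cs_scale A 0 e) \<in> ?H"
    using H e B by (auto simp: scale_one cs_subspace_def subset_iff intro: hull_inc)
  then have *: "insert e B \<subseteq> ?V"
    using e B by blast
  moreover have "cs_zero A \<in> ?V"
    using H e by (auto simp: cs_subspace_def intro!: exI[of _ 0])
  moreover have "cs_add A x y \<in> ?V" if "x \<in> ?V" "y \<in> ?V" for x y
  proof -
    obtain c d where "cs_diff A x (cs_scale A c e) \<in> ?H" "cs_diff A y (cs_scale A d e) \<in> ?H"
      using \<open>x \<in> ?V\<close> \<open>y \<in> ?V\<close> by blast
    then have "cs_diff A (cs_add A x y) (cs_scale A (c + d) e) \<in> ?H"
      using that H e by (simp add: scale_add_left add_diff_add cs_subspace_def)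
    then show ?thesis using that by auto
  qed
  moreover have "cs_scale A c x \<in> ?V" if "x \<in> ?V" for x c
  proof -
    obtain d where "cs_diff A x (cs_scale A d e) \<in> ?H"
      using \<open>x \<in> ?V\<close> by blast
    then have "cs_scale A c (cs_diff A x (cs_scale A d e)) \<in> ?H"
      using H by (simp add: cs_subspace_def)
    then have "cs_diff A (cs_scale A c x) (cs_scale A (c * d) e) \<in> ?H"
      using that e by (simp add: scale_diff scale_scale)
    then show ?thesis using that by auto
  qed
  ultimately have "cs_subspace A ?V"
    unfolding cs_subspace_def by blast
  from hull_minimal[of "insert e B" ?V "cs_subspace A", OF * this] v show ?thesis
    by auto
qed

text \<open>\<open>poly_comb A p u\<close> is \<open>\<Sum>\<^sub>i p\<^sub>i u\<^sub>i\<close>. The coefficients are those of a polynomial since, for the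
  powers \<open>u\<^sub>i = b\<^sup>i v\<close>, this is \<open>p(b) v\<close>, and roots of \<open>p\<close> can be split off.\<close>

primrec list_comb :: "'a cstar \<Rightarrow> complex list \<Rightarrow> (nat \<Rightarrow> 'a) \<Rightarrow> 'a" where
  "list_comb A [] u = cs_zero A"
| "list_comb A (c # cs) u = cs_add A (cs_scale A c (u 0)) (list_comb A cs (\<lambda>i. u (Suc i)))"

definition poly_comb :: "'a cstar \<Rightarrow> complex poly \<Rightarrow> (nat \<Rightarrow> 'a) \<Rightarrow> 'a" where
  "poly_comb A p u = list_comb A (coeffs p) u"

text \<open>\<open>power_mult A b n y\<close> is \<open>y b\<^sup>n\<close>. It is an iteration because \<open>A\<close> need not have a unit, so
  that \<open>b\<^sup>0\<close> makes no sense on its own; \<open>b\<^bsup>n+1\<^esup>\<close> appears as \<open>power_mult A b n b\<close>.\<close>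

definition power_mult :: "'a cstar \<Rightarrow> 'a \<Rightarrow> nat \<Rightarrow> 'a \<Rightarrow> 'a" where
  "power_mult A b n y = ((\<lambda>z. cs_mult A z b) ^^ n) y"

lemma power_mult_0 [simp]: "power_mult A b 0 y = y"
  and power_mult_Suc: "power_mult A b (Suc n) y = cs_mult A (power_mult A b n y) b"
  by (auto simp: power_mult_def)

context cstar_algebra
begin

lemma diff_diff_cancel:
  "\<lbrakk>x \<in> cs_carrier A; y \<in> cs_carrier A; z \<in> cs_carrier A\<rbrakk> \<Longrightarrow>
    cs_diff A (cs_diff A x z) (cs_diff A y z) = cs_diff A x y"
  using diff_split[of x z y] diff_uminus[of y z] by (simp add: cs_diff_def[of A "cs_diff A x z"])

lemma poly_comb_0 [simp]: "poly_comb A 0 u = cs_zero A"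
  by (simp add: poly_comb_def)

lemma poly_comb_pCons:
  assumes "\<And>i. u i \<in> cs_carrier A"
  shows "poly_comb A (pCons c p) u = cs_add A (cs_scale A c (u 0)) (poly_comb A p (\<lambda>i. u (Suc i)))"
  using assms by (auto simp: poly_comb_def cCons_def zero_add)

lemma poly_comb_closed [simp]:
  assumes "\<And>i. u i \<in> cs_carrier A"
  shows "poly_comb A p u \<in> cs_carrier A"
  using assms by (induction p arbitrary: u) (auto simp: poly_comb_pCons)

lemma poly_comb_add:
  assumes "\<And>i. u i \<in> cs_carrier A"
  shows "poly_comb A (p + q) u = cs_add A (poly_comb A p u) (poly_comb A q u)"
  using assms
proof (induction p arbitrary: q u)
  case (pCons c p)
  obtain d q' where q: "q = pCons d q'" by (rule pCons_cases)
  show ?case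
    using pCons.prems by (simp add: q poly_comb_pCons pCons.IH scale_add_left add_ac)
qed (simp add: zero_add)

lemma poly_comb_smult:
  assumes "\<And>i. u i \<in> cs_carrier A"
  shows "poly_comb A (smult c p) u = cs_scale A c (poly_comb A p u)"
  using assms
  by (induction p arbitrary: u) (simp_all add: poly_comb_pCons scale_add_right scale_scale)

lemma poly_comb_mult:
  assumes "\<And>i. u i \<in> cs_carrier A" "b \<in> cs_carrier A"
  shows "poly_comb A p (\<lambda>i. cs_mult A b (u i)) = cs_mult A b (poly_comb A p u)"
    and "poly_comb A p (\<lambda>i. cs_mult A (u i) b) = cs_mult A (poly_comb A p u) b"
  using assms
  by (induction p arbitrary: u)
    (simp_all add: poly_comb_pCons mult_add_right mult_add_left mult_scale_right mult_scale_left)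

text \<open>When the terms are changed by multiples of \<open>w\<close>, so is the combination.\<close>

lemma poly_comb_perturb:
  assumes "\<And>i. u i \<in> cs_carrier A" "w \<in> cs_carrier A"
  shows "\<exists>g. poly_comb A p (\<lambda>i. cs_diff A (cs_scale A c (u i)) (cs_scale A (d i) w))
    = cs_add A (cs_scale A g w) (cs_scale A c (poly_comb A p u))"
  using assms
proof (induction p arbitrary: u d)
  case 0
  then show ?case by (auto simp: add_zero intro!: exI[of _ 0])
next
  case (pCons k p)
  from pCons.IH[of "\<lambda>i. u (Suc i)" "\<lambda>i. d (Suc i)"] pCons.prems
  obtain g where g: "poly_comb A p (\<lambda>i. cs_diff A (cs_scale A c (u (Suc i))) (cs_scale A (d (Suc i)) w))
    = cs_add A (cs_scale A g w) (cs_scale A c (poly_comb A p (\<lambda>i. u (Suc i))))" by auto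
  have "cs_scale A k (cs_diff A (cs_scale A c (u 0)) (cs_scale A (d 0) w))
    = cs_add A (cs_scale A (- k * d 0) w) (cs_scale A (c * k) (u 0))"
    using pCons.prems by (simp add: cs_diff_def scale_add_right scale_scale mult.commute add_commute)
  then show ?case
    using pCons.prems
    by (intro exI[of _ "g - k * d 0"])
      (simp add: poly_comb_pCons g scale_add_right scale_scale add_ac scale_add_left[of w g "- (k * d 0)", simplified])
qed

text \<open>A relation between the terms from index \<open>k\<close> on becomes a relation between all terms by padding the
coefficients with zeros.\<close>

lemma poly_comb_shift:
  assumes "\<And>i. u i \<in> cs_carrier A" "q \<noteq> 0" "poly_comb A q (\<lambda>i. u (k + i)) = cs_zero A"
  shows "\<exists>p. p \<noteq> 0 \<and> poly_comb A p u = cs_zero A"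
  using assms
proof (induction k arbitrary: q)
  case (Suc k)
  then have "poly_comb A (pCons 0 q) (\<lambda>i. u (k + i)) = cs_zero A"
    by (simp add: poly_comb_pCons add_zero)
  then show ?case using Suc.IH[of "pCons 0 q"] Suc.prems by simp
qed auto

text \<open>An infinite sequence in a finite-dimensional space satisfies a nontrivial linear relation. The proof
is Gaussian elimination on the spanning set: if some \<open>u\<^sub>k\<close> involves \<open>e\<close>, it is used to eliminate \<open>e\<close>
from all later terms.\<close>

lemma linear_dependence:
  assumes "finite B" "B \<subseteq> cs_carrier A" "\<And>i. u i \<in> cs_subspace A hull B"
  shows "\<exists>p. p \<noteq> 0 \<and> poly_comb A p u = cs_zero A"
  using assms
proof (induction B arbitrary: u rule: finite_induct)
  case empty
  have "cs_subspace A {cs_zero A}" by (auto simp: cs_subspace_def add_zero)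
  then have "cs_subspace A hull {} \<subseteq> {cs_zero A}" by (intro hull_minimal) auto
  then have "u 0 = cs_zero A" using empty by blast
  moreover have "poly_comb A 1 u = cs_add A (cs_scale A 1 (u 0)) (cs_zero A)"
    by (simp add: poly_comb_def)
  ultimately show ?case by (intro exI[of _ 1]) (simp add: scale_one add_zero)
next
  case (insert e B)
  have H: "cs_subspace A (cs_subspace A hull B)" "cs_subspace A (cs_subspace A hull (insert e B))"
    using insert.prems by (auto intro!: subspace_hull)
  have u: "u i \<in> cs_carrier A" for i
    using H(2) insert.prems(2)[of i] unfolding cs_subspace_def[of A "cs_subspace A hull _"] by blast
  have e: "e \<in> cs_carrier A" and B: "B \<subseteq> cs_carrier A" using insert.prems by auto
  obtain c where c: "\<And>i. cs_diff A (u i) (cs_scale A (c i) e) \<in> cs_subspace A hull B"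
    using hull_insert_split[OF e B insert.prems(2)] by metis
  show ?case
  proof (cases "\<forall>i. c i = 0")
    case True
    then have "u i \<in> cs_subspace A hull B" for i using c[of i] u[of i] e by simp
    then show ?thesis using insert.IH B by blast
  next
    case False
    then obtain k where k: "c k \<noteq> 0" by blast
    \<comment> \<open>The multiples of \<open>u\<^sub>k\<close> cancel the parts of the later terms along \<open>e\<close>.\<close>
    define v where "v = (\<lambda>i. cs_diff A (cs_scale A (c k) (u (Suc k + i))) (cs_scale A (c (Suc k + i)) (u k)))"
    have "v i \<in> cs_subspace A hull B" for i
    proof -
      let ?w = "\<lambda>i. cs_diff A (u i) (cs_scale A (c i) e)"
      have "v i = cs_diff A (cs_scale A (c k) (?w (Suc k + i))) (cs_scale A (c (Suc k + i)) (?w k))"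
        using u e by (simp add: v_def scale_diff scale_scale mult.commute diff_diff_cancel)
      then show ?thesis using H(1) c by (simp add: cs_diff_def cs_subspace_def)
    qed
    then obtain p where p: "p \<noteq> 0" "poly_comb A p v = cs_zero A"
      using insert.IH B by blast
    obtain g where g: "poly_comb A p v
        = cs_add A (cs_scale A g (u k)) (cs_scale A (c k) (poly_comb A p (\<lambda>i. u (Suc k + i))))"
      using poly_comb_perturb[of "\<lambda>i. u (Suc k + i)" "u k" p "c k" "\<lambda>i. c (Suc k + i)"] u
      unfolding v_def by auto
    have "poly_comb A (pCons g (smult (c k) p)) (\<lambda>i. u (k + i)) = cs_zero A"
      using u g p(2) by (simp add: poly_comb_pCons poly_comb_smult)
    then show ?thesis using poly_comb_shift[of u "pCons g (smult (c k) p)" k] u p(1) k by simp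
  qed
qed


context
  fixes b assumes b [simp]: "b \<in> cs_carrier A"
begin

lemma power_mult_closed [simp]: "y \<in> cs_carrier A \<Longrightarrow> power_mult A b n y \<in> cs_carrier A"
  by (induction n) (auto simp: power_mult_Suc)

lemma power_mult_Suc2: "power_mult A b (Suc n) y = power_mult A b n (cs_mult A y b)"
  by (induction n) (simp_all add: power_mult_Suc)

lemma power_mult_linear:
  assumes "x \<in> cs_carrier A" "y \<in> cs_carrier A"
  shows "power_mult A b n (cs_add A x y) = cs_add A (power_mult A b n x) (power_mult A b n y)"
    and "power_mult A b n (cs_mult A x y) = cs_mult A x (power_mult A b n y)"
  using assms by (induction n) (auto simp: power_mult_Suc mult_add_left mult_assoc)

lemma power_mult_scale:
  "x \<in> cs_carrier A \<Longrightarrow> power_mult A b n (cs_scale A c x) = cs_scale A c (power_mult A b n x)"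
  by (induction n) (auto simp: power_mult_Suc mult_scale_left)

lemma power_mult_commute: "cs_mult A b (power_mult A b n b) = cs_mult A (power_mult A b n b) b"
  using power_mult_linear(2)[of b b n] power_mult_Suc2[of n b] by (simp add: power_mult_Suc)

lemma power_mult_power:
  "cs_mult A (power_mult A b n b) (power_mult A b k b) = power_mult A b (Suc (n + k)) b"
proof (induction k)
  case (Suc k)
  have "cs_mult A (power_mult A b n b) (power_mult A b (Suc k) b)
    = cs_mult A (cs_mult A (power_mult A b n b) (power_mult A b k b)) b"
    by (simp add: power_mult_Suc mult_assoc)
  then show ?case by (simp add: Suc power_mult_Suc)
qed (simp add: power_mult_Suc)

lemma power_mult_star:
  assumes "cs_star A b = b"
  shows "cs_star A (power_mult A b n b) = power_mult A b n b"
  by (induction n) (simp_all add: assms power_mult_Suc star_mult power_mult_commute)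

end

end

text \<open>If \<open>\<bar>e\<^sub>n\<bar> < (1 - r) d/2\<close> for all \<open>n \<ge> N\<close>, then \<open>d/2\<close> is an upper solution of the recursion, so
\<open>a\<^bsub>N+k\<^esub> \<le> r\<^sup>k a\<^sub>N + d/2\<close>.\<close>

lemma recursion_tendsto_zero:
  fixes a e :: "nat \<Rightarrow> real"
  assumes nonneg: "\<And>n. 0 \<le> a n" and rec: "\<And>n. a (Suc n) \<le> r * a n + e n"
    and r: "0 \<le> r" "r < 1" and e: "e \<longlonglongrightarrow> 0"
  shows "a \<longlonglongrightarrow> 0"
proof (rule LIMSEQ_I)
  fix d :: real assume d: "0 < d"
  then obtain N where N: "\<And>n. n \<ge> N \<Longrightarrow> \<bar>e n\<bar> < d/2 * (1 - r)"
    using LIMSEQ_D[OF e, of "d/2 * (1 - r)"] r by auto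
  have "a (N + k) \<le> r ^ k * a N + d/2" for k
  proof (induction k)
    case (Suc k)
    have "a (N + Suc k) \<le> r * a (N + k) + d/2 * (1 - r)"
      using rec[of "N + k"] N[of "N + k"] by simp
    also have "\<dots> \<le> r * (r ^ k * a N + d/2) + d/2 * (1 - r)"
      using Suc r by (simp add: mult_left_mono)
    finally show ?case by (simp add: field_simps)
  qed (use d in simp)
  moreover have "(\<lambda>k. r ^ k * a N) \<longlonglongrightarrow> 0"
    using tendsto_mult_left_zero[OF LIMSEQ_power_zero[of r]] r by simp
  then obtain K where "\<And>k. k \<ge> K \<Longrightarrow> \<bar>r ^ k * a N\<bar> < d/2"
    using LIMSEQ_D[of _ 0 "d/2"] d by (metis diff_zero half_gt_zero real_norm_def)
  ultimately have "a (N + k) < d" if "k \<ge> K" for k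
    using that by (fastforce simp: abs_less_iff intro: le_less_trans)
  then have "norm (a n - 0) < d" if "n \<ge> N + K" for n
    using that nonneg[of n] spec[of "\<lambda>k. k \<ge> K \<longrightarrow> a (N + k) < d" "n - N"] by auto
  then show "\<exists>no. \<forall>n\<ge>no. norm (a n - 0) < d" by blast
qed

context cstar_algebra
begin

text \<open>In the unitization, \<open>1 + x\<close> is the Neumann series, the inverse of \<open>1 - a\<close>; here \<open>x\<close> is the fixed
point of a contraction. The point of the equation is that homomorphisms preserve it without being
known to be continuous: this is how the norm of the source influences the image.\<close>

lemma quasi_inverse:
  assumes a: "a \<in> cs_carrier A" "cs_norm A a < 1"
  obtains x where "x \<in> cs_carrier A" "x = cs_add A a (cs_mult A x a)"
proof -
  have "cs_dist A (cs_add A a (cs_mult A x a)) (cs_add A a (cs_mult A y a)) \<le> cs_norm A a * cs_dist A x y"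
    if "x \<in> cs_carrier A" "y \<in> cs_carrier A" for x y
    using norm_mult[of "cs_diff A x y" a] a that
    by (simp add: dist_eq add_diff_add mult_diff(1)[symmetric] zero_add mult.commute)
  then obtain x where "x \<in> cs_carrier A" "cs_add A a (cs_mult A x a) = x"
    by (rule M.Banach_fixedpoint_thm[OF complete, of "\<lambda>x. cs_add A a (cs_mult A x a)" "cs_norm A a", rotated 3])
      (use a zero_closed in auto)
  then show ?thesis using that by auto
qed

text \<open>This is \<open>y = (1 + u) (1 - c) y\<close>, written without a unit.\<close>

lemma cancel_quasi_inverse:
  assumes "c \<in> cs_carrier A" "u \<in> cs_carrier A" "y \<in> cs_carrier A"
    and u: "u = cs_add A c (cs_mult A u c)"
  shows "y = cs_add A (cs_diff A y (cs_mult A c y)) (cs_mult A u (cs_diff A y (cs_mult A c y)))"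
proof -
  have cancel: "cs_diff A (cs_add A p q) q = p" if "p \<in> cs_carrier A" "q \<in> cs_carrier A" for p q
    using that by (simp add: cs_diff_def add_assoc add_uminus add_zero)
  have "cs_diff A u (cs_mult A u c) = c"
    using cancel[of c "cs_mult A u c"] u assms by simp
  then have "cs_mult A u (cs_diff A y (cs_mult A c y)) = cs_mult A c y"
    using mult_diff(1)[of u "cs_mult A u c" y] assms by (simp add: mult_diff(2) mult_assoc)
  then show ?thesis using assms by (simp add: diff_add_cancel)
qed

text \<open>A spectral radius argument for an element \<open>b\<close> that satisfies a polynomial equation and for which
\<open>1 - b/z\<close> is invertible whenever \<open>\<bar>z\<bar> \<ge> 1\<close>. The linear factors \<open>b - z\<close> of \<open>p(b)\<close> are removed one
after the other, and each time it is shown that the powers still tend to zero: for \<open>\<bar>z\<bar> < 1\<close> since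
\<open>y b\<^bsup>n+1\<^esup> = z y b\<^sup>n + (b - z) y b\<^sup>n\<close>, where \<open>y\<close> is a polynomial in \<open>b\<close> and hence commutes with
\<open>b\<close>, is a contracting recursion with a vanishing perturbation, for
\<open>\<bar>z\<bar> \<ge> 1\<close> since the factor has a left inverse. The powers of \<open>b\<close> stand on the right so that this
left inverse need not commute with them.\<close>

lemma tendsto_zero_of_annihilating_poly:
  assumes b [simp]: "b \<in> cs_carrier A"
    and inv: "\<And>z. 1 \<le> cmod z \<Longrightarrow> \<exists>u\<in>cs_carrier A. u =
      cs_add A (cs_scale A (1/z) b) (cs_mult A u (cs_scale A (1/z) b))"
    and p: "p \<noteq> 0" "poly_comb A p (\<lambda>n. power_mult A b n b) = cs_zero A"
  shows "(\<lambda>n. cs_norm A (power_mult A b n b)) \<longlonglongrightarrow> 0"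
proof -
  let ?t = "\<lambda>y. (\<lambda>n. cs_norm A (power_mult A b n y)) \<longlonglongrightarrow> 0"
  let ?u = "\<lambda>n. power_mult A b n b"
  have factor: "?t y" if y [simp]: "y \<in> cs_carrier A" and comm: "cs_mult A b y = cs_mult A y b"
    and t: "?t (cs_diff A (cs_mult A b y) (cs_scale A z y))" for y z
  proof (cases "cmod z < 1")
    case True
    define w where "w = cs_diff A (cs_mult A b y) (cs_scale A z y)"
    have w [simp]: "w \<in> cs_carrier A" by (simp add: w_def)
    have y': "cs_mult A y b = cs_add A w (cs_scale A z y)"
      by (simp add: w_def comm diff_add_cancel)
    have "cs_norm A (power_mult A b (Suc n) y)
        \<le> cmod z * cs_norm A (power_mult A b n y) + cs_norm A (power_mult A b n w)" for n
      unfolding power_mult_Suc2[OF b] y'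
      using norm_triangle[of "power_mult A b n w" "cs_scale A z (power_mult A b n y)"]
      by (simp add: power_mult_linear power_mult_scale norm_scale)
    moreover have "0 \<le> cs_norm A (power_mult A b n y)" for n
      by (simp add: norm_nonneg)
    ultimately show ?thesis
      using recursion_tendsto_zero[of "\<lambda>n. cs_norm A (power_mult A b n y)" "cmod z"
          "\<lambda>n. cs_norm A (power_mult A b n w)"] True t by (simp add: w_def)
  next
    case False
    define c where "c = cs_scale A (1/z) b"
    obtain u where u [simp]: "u \<in> cs_carrier A" and u_eq: "u = cs_add A c (cs_mult A u c)"
      using inv[of z] False by (auto simp: c_def)
    have c [simp]: "c \<in> cs_carrier A" by (simp add: c_def)
    define w where "w = cs_diff A y (cs_mult A c y)"
    have w [simp]: "w \<in> cs_carrier A" by (simp add: w_def)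
    have "w = cs_scale A (- (1/z)) (cs_diff A (cs_mult A b y) (cs_scale A z y))"
      using False by (auto simp: w_def c_def mult_scale_left cs_diff_def scale_add_right scale_scale
          scale_one add_commute)
    then have "cs_norm A (power_mult A b n w)
        = cmod (1/z) * cs_norm A (power_mult A b n (cs_diff A (cs_mult A b y) (cs_scale A z y)))" for n
      by (simp add: power_mult_scale norm_scale)
    then have tw: "?t w"
      using tendsto_mult_right_zero[OF t, of "cmod (1/z)"] by simp
    have "cs_norm A (power_mult A b n y) \<le> (1 + cs_norm A u) * cs_norm A (power_mult A b n w)" for n
    proof -
      have "power_mult A b n y = cs_add A (power_mult A b n w) (cs_mult A u (power_mult A b n w))"
        using cancel_quasi_inverse[OF c u y u_eq]
        by (metis power_mult_linear(1,2) b u w w_def mult_closed)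
      then show ?thesis
        using norm_triangle[of "power_mult A b n w" "cs_mult A u (power_mult A b n w)"]
          norm_mult[of u "power_mult A b n w"] by (simp add: algebra_simps)
    qed
    then show ?thesis
      using norm_nonneg
      by (intro real_tendsto_sandwich[OF always_eventually always_eventually tendsto_const
            tendsto_mult_right_zero[OF tw, of "1 + cs_norm A u"]]) auto
  qed
  have "p \<noteq> 0 \<Longrightarrow> ?t (poly_comb A p ?u) \<Longrightarrow> ?t b" for p
  proof (induction "degree p" arbitrary: p rule: less_induct)
    case less
    show ?case
    proof (cases "degree p = 0")
      case True
      then obtain c where c: "p = [:c:]" by (auto elim: degree_eq_zeroE)
      then have "poly_comb A p ?u = cs_scale A c b"
        by (simp add: poly_comb_pCons add_zero)
      then have "(\<lambda>n. cmod c * cs_norm A (power_mult A b n b)) \<longlonglongrightarrow> 0"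
        using less.prems by (simp add: power_mult_scale norm_scale)
      from tendsto_mult_right_zero[OF this, of "inverse (cmod c)"] show ?thesis
        using less.prems c by (simp add: mult.assoc[symmetric])
    next
      case False
      then obtain z where "poly p z = 0"
        using fundamental_theorem_of_algebra[of p] by (auto simp: constant_degree)
      then obtain q where q: "p = [:-z, 1:] * q"
        by (auto simp: poly_eq_0_iff_dvd)
      with less.prems have "q \<noteq> 0" by auto
      then have deg: "degree q < degree p" by (simp add: q degree_mult_eq del: mult_pCons_left)
      let ?y = "poly_comb A q ?u"
      have y [simp]: "?y \<in> cs_carrier A" by simp
      have shift: "poly_comb A q (\<lambda>i. power_mult A b (Suc i) b) = cs_mult A b ?y"
        using poly_comb_mult(1)[of ?u b q] by (simp add: power_mult_commute power_mult_Suc)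
      have "poly_comb A p ?u = cs_add A (cs_scale A (-z) ?y) (cs_mult A b ?y)"
        by (simp add: q poly_comb_add poly_comb_smult poly_comb_pCons shift zero_add del: smult_minus_left)
      also have "\<dots> = cs_diff A (cs_mult A b ?y) (cs_scale A z ?y)"
        by (simp add: cs_diff_def scale_scale add_commute)
      finally have "?t (cs_diff A (cs_mult A b ?y) (cs_scale A z ?y))"
        using less.prems by simp
      moreover have "cs_mult A b ?y = cs_mult A ?y b"
        using poly_comb_mult[of ?u b q] by (simp add: power_mult_commute)
      ultimately have "?t ?y" by (intro factor) auto
      then show ?thesis using less.hyps[OF deg \<open>q \<noteq> 0\<close>] by simp
    qed
  qed
  moreover have "power_mult A b n (cs_zero A) = cs_zero A" for n
    by (induction n) (simp_all add: power_mult_Suc)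
  ultimately show ?thesis using p by simp
qed

end

lemma hom_zero:
  assumes A: "cstar_algebra A" and B: "cstar_algebra B" and h: "h \<in> cstar_hom A B"
  shows "h (cs_zero A) = cs_zero B"
proof -
  interpret A: cstar_algebra A by (rule A)
  interpret B: cstar_algebra B by (rule B)
  show ?thesis
    using cstar_homD(2)[OF h A.zero_closed A.zero_closed, of "Scale 0"] cstar_homD(1)[OF h A.zero_closed] by simp
qed

lemma hom_diff:
  assumes A: "cstar_algebra A" and h: "h \<in> cstar_hom A B" and xy: "x \<in> cs_carrier A" "y \<in> cs_carrier A"
  shows "h (cs_diff A x y) = cs_diff B (h x) (h y)"
proof -
  interpret A: cstar_algebra A by (rule A)
  show ?thesis
    using cstar_homD(2)[OF h xy(1) A.scale_closed[OF xy(2)], of Add] cstar_homD(2)[OF h xy(2) xy(2), of "Scale _"]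
    by (simp add: cs_diff_def)
qed

text \<open>Suppose \<open>\<parallel>h(a)\<parallel> > \<parallel>a\<parallel>\<close> and scale \<open>a\<^sup>* a\<close> to an element \<open>s\<close> whose image \<open>b\<close> has norm \<open>1\<close>; then
\<open>\<parallel>s\<parallel> < 1\<close>. The quasi-inverses of the elements \<open>s/z\<close> with \<open>\<bar>z\<bar> \<ge> 1\<close> are mapped to quasi-inverses
of \<open>b/z\<close>, and \<open>b\<close> satisfies a polynomial equation because the target is finite-dimensional. So the
powers of \<open>b\<close> tend to zero, which contradicts \<open>\<parallel>b\<^bsup>2m\<^esup>\<parallel> = \<parallel>b\<^sup>m\<parallel>\<^sup>2\<close>, the C*-identity for the
self-adjoint element \<open>b\<^sup>m\<close>.\<close>

theorem hom_contractive:
  assumes A: "cstar_algebra A" and F: "finite_dim_cstar F" and h: "h \<in> cstar_hom A F"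
    and a: "a \<in> cs_carrier A"
  shows "cs_norm F (h a) \<le> cs_norm A a"
proof (rule ccontr)
  interpret A: cstar_algebra A by (rule A)
  interpret F: cstar_algebra F using F by (simp add: finite_dim_cstar_def)
  note hc [simp] = cstar_homD(1)[OF h]
  have hop: "h (cs_scale A c x) = cs_scale F c (h x)" "h (cs_star A x) = cs_star F (h x)"
    "y \<in> cs_carrier A \<Longrightarrow> h (cs_mult A x y) = cs_mult F (h x) (h y)"
    "y \<in> cs_carrier A \<Longrightarrow> h (cs_add A x y) = cs_add F (h x) (h y)"
    if "x \<in> cs_carrier A" for c x y
    using cstar_homD(2)[OF h that that, of "Scale c"] cstar_homD(2)[OF h that that, of Star]
      cstar_homD(2)[OF h that, of _ Mult] cstar_homD(2)[OF h that, of _ Add] by auto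
  assume "\<not> ?thesis"
  then have less: "cs_norm A a < cs_norm F (h a)" by simp
  define r where "r = (cs_norm F (h a))\<^sup>2"
  have r: "0 < r" "(cs_norm A a)\<^sup>2 < r"
    using less A.norm_nonneg[OF a] by (auto simp: r_def intro: power_strict_mono)
  define s where "s = cs_scale A (of_real (1/r)) (cs_mult A (cs_star A a) a)"
  have s [simp]: "s \<in> cs_carrier A" using a by (simp add: s_def)
  have ns: "cs_norm A s < 1"
    using r a by (simp add: s_def A.norm_scale A.cstar_identity norm_divide field_simps)
  define b where "b = h s"
  have b [simp]: "b \<in> cs_carrier F" by (simp add: b_def)
  have b_eq: "b = cs_scale F (of_real (1/r)) (cs_mult F (cs_star F (h a)) (h a))"
    using a by (simp add: b_def s_def hop)
  have nb: "cs_norm F b = 1"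
    using r(1) a by (simp add: b_eq F.norm_scale F.cstar_identity norm_divide r_def[symmetric])
  have sb: "cs_star F b = b"
    using a by (simp add: b_eq F.star_scale F.star_mult F.star_star)
  obtain B where B: "finite B" "B \<subseteq> cs_carrier F" "cs_subspace F hull B = cs_carrier F"
    using F by (auto simp: finite_dim_cstar_def)
  obtain p where p: "p \<noteq> 0" "poly_comb F p (\<lambda>n. power_mult F b n b) = cs_zero F"
    using F.linear_dependence[OF B(1,2), of "\<lambda>n. power_mult F b n b"] B(3) by auto
  have "\<exists>u\<in>cs_carrier F. u = cs_add F (cs_scale F (1/z) b) (cs_mult F u (cs_scale F (1/z) b))"
    if z: "1 \<le> cmod z" for z
  proof -
    have "cs_norm A (cs_scale A (1/z) s) \<le> 1 * cs_norm A s"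
      unfolding A.norm_scale[OF s] using z by (intro mult_right_mono) (auto simp: A.norm_nonneg norm_divide divide_le_eq_1)
    then have "cs_norm A (cs_scale A (1/z) s) < 1" using ns by simp
    then obtain x where x: "x \<in> cs_carrier A"
      "x = cs_add A (cs_scale A (1/z) s) (cs_mult A x (cs_scale A (1/z) s))"
      by (rule A.quasi_inverse[OF A.scale_closed[OF s]])
    have "h x = cs_add F (cs_scale F (1/z) b) (cs_mult F (h x) (cs_scale F (1/z) b))"
    proof -
      have "h x = h (cs_add A (cs_scale A (1/z) s) (cs_mult A x (cs_scale A (1/z) s)))"
        using x(2) by simp
      then show ?thesis using x(1) by (simp add: hop b_def)
    qed
    then show ?thesis using x(1) by (intro bexI[of _ "h x"]) auto
  qed
  from F.tendsto_zero_of_annihilating_poly[OF b this p] obtain N where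
    N: "\<And>n. n \<ge> N \<Longrightarrow> cs_norm F (power_mult F b n b) < 1"
    using LIMSEQ_D[of "\<lambda>n. cs_norm F (power_mult F b n b)" 0 1] by (auto simp: abs_less_iff)
  have "\<exists>n\<ge>k. cs_norm F (power_mult F b n b) = 1" for k
  proof (induction k)
    case 0 then show ?case using nb by (intro exI[of _ 0]) simp
  next
    case (Suc k)
    then obtain n where n: "n \<ge> k" "cs_norm F (power_mult F b n b) = 1" by blast
    have "cs_norm F (power_mult F b (Suc (n + n)) b) = 1"
      using F.cstar_identity[of "power_mult F b n b"] n(2)
      by (simp add: F.power_mult_star[OF b sb] F.power_mult_power)
    then show ?case using n(1) by (intro exI[of _ "Suc (n + n)"]) auto
  qed
  then obtain n where "n \<ge> N" "cs_norm F (power_mult F b n b) = 1" by blast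
  with N show False by force
qed




section \<open>Direct sums and algebras of continuous functions\<close>

lemma cstar_direct_sum:
  assumes I: "finite I" and A: "\<And>i. i \<in> I \<Longrightarrow> cstar_algebra (A i)"
  shows "cstar_algebra (direct_sum I A)"
proof -
  have "direct_sum I A = bounded_sum I A"
    using I by (simp add: bounded_sum_def direct_sum_def)
  then show ?thesis using cstar_bounded_sum[OF A] by simp
qed

definition unit_family :: "'i set \<Rightarrow> ('i \<Rightarrow> 'a cstar) \<Rightarrow> 'i \<Rightarrow> 'a \<Rightarrow> ('i \<Rightarrow> 'a)" where
  "unit_family I A j v = (\<lambda>i\<in>I. if i = j then v else cs_zero (A i))"

text \<open>The embedded spanning sets of the summands span the sum: an element is the sum of its components,
added here one index at a time.\<close>

lemma finite_dim_direct_sum: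
  assumes I: "finite I" and fin: "\<And>i. i \<in> I \<Longrightarrow> finite_dim_cstar (A i)"
  shows "finite_dim_cstar (direct_sum I A)"
proof -
  have A: "cstar_algebra (A i)" if "i \<in> I" for i using fin[OF that] by (simp add: finite_dim_cstar_def)
  let ?D = "direct_sum I A"
  interpret D: cstar_algebra ?D by (rule cstar_direct_sum[OF I A])
  obtain B where B: "\<And>i. i \<in> I \<Longrightarrow> finite (B i) \<and> B i \<subseteq> cs_carrier (A i) \<and> cs_subspace (A i) hull (B i) = cs_carrier (A i)"
    using fin unfolding finite_dim_cstar_def by metis
  let ?B = "\<Union>j\<in>I. unit_family I A j ` B j"
  have uc: "unit_family I A j v \<in> cs_carrier ?D" if "j \<in> I" "v \<in> cs_carrier (A j)" for j v
    using that cstar_algebra.zero_closed[OF A] by (auto simp: unit_family_def)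
  have B_sub: "?B \<subseteq> cs_carrier ?D" using B uc by blast
  have "x \<in> V" if x: "x \<in> cs_carrier ?D" and V: "cs_subspace ?D V" "?B \<subseteq> V" for x V
  proof -
    have unit: "unit_family I A j v \<in> V" if j: "j \<in> I" and v: "v \<in> cs_carrier (A j)" for j v
    proof -
      interpret Aj: cstar_algebra "A j" by (rule A[OF j])
      let ?W = "{v \<in> cs_carrier (A j). unit_family I A j v \<in> V}"
      have z: "unit_family I A j (cs_zero (A j)) = cs_zero ?D" by (auto simp: unit_family_def)
      have a: "unit_family I A j (cs_add (A j) v w) = cs_add ?D (unit_family I A j v) (unit_family I A j w)" for v w
        using cstar_algebra.add_zero[OF A] cstar_algebra.zero_closed[OF A]
        by (auto simp: unit_family_def direct_sum_def)
      have s: "unit_family I A j (cs_scale (A j) c v) = cs_scale ?D c (unit_family I A j v)" for c v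
        using cstar_algebra.scale_zero(2)[OF A] by (auto simp: unit_family_def direct_sum_def)
      have "cs_subspace (A j) ?W"
        using V(1) by (auto simp: cs_subspace_def z a s)
      moreover have "B j \<subseteq> ?W" using B[OF j] V(2) j by blast
      ultimately have "cs_carrier (A j) \<subseteq> ?W" using B[OF j] hull_minimal[of "B j" ?W "cs_subspace (A j)"] by simp
      then show ?thesis using v by blast
    qed
    have "(\<lambda>i\<in>I. if i \<in> J then x i else cs_zero (A i)) \<in> V" if "finite J" "J \<subseteq> I" for J
      using that
    proof (induction J rule: finite_induct)
      case empty
      have "(\<lambda>i\<in>I. if i \<in> {} then x i else cs_zero (A i)) = cs_zero ?D" by simp
      then show ?case using V(1) unfolding cs_subspace_def by metis
    next
      case (insert j J)
      have eq: "(\<lambda>i\<in>I. if i \<in> insert j J then x i else cs_zero (A i))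
        = cs_add ?D (\<lambda>i\<in>I. if i \<in> J then x i else cs_zero (A i)) (unit_family I A j (x j))"
      proof (rule ext)
        fix i
        have "i \<in> I \<Longrightarrow> x i \<in> cs_carrier (A i)" using x by auto
        then show "(\<lambda>i\<in>I. if i \<in> insert j J then x i else cs_zero (A i)) i
          = cs_add ?D (\<lambda>i\<in>I. if i \<in> J then x i else cs_zero (A i)) (unit_family I A j (x j)) i"
          using insert.hyps cstar_algebra.add_zero[OF A] cstar_algebra.zero_add[OF A] cstar_algebra.zero_closed[OF A]
          by (auto simp: unit_family_def direct_sum_def)
      qed
      have "x j \<in> cs_carrier (A j)" using x insert.prems by auto
      then have "unit_family I A j (x j) \<in> V" using unit insert.prems by blast
      moreover have "(\<lambda>i\<in>I. if i \<in> J then x i else cs_zero (A i)) \<in> V" using insert by blast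
      ultimately show ?case
        unfolding eq using V(1) unfolding cs_subspace_def by blast
    qed
    from this[OF I order_refl] have "(\<lambda>i\<in>I. x i) \<in> V" by (simp cong: restrict_cong)
    moreover have "restrict x I = x" using x by (auto intro: extensional_restrict simp: PiE_def)
    ultimately show ?thesis by simp
  qed
  then have "cs_carrier ?D \<subseteq> cs_subspace ?D hull ?B"
    by (auto simp: hull_def)
  moreover have "cs_subspace ?D hull ?B \<subseteq> cs_carrier ?D"
    using D.subspace_hull[OF B_sub] unfolding cs_subspace_def[of ?D "_ hull _"] by blast
  moreover have "finite ?B" using I B by auto
  ultimately show ?thesis
    unfolding finite_dim_cstar_def using D.cstar_algebra_axioms B_sub by blast
qed

lemma cont_alg_eq:
  "cont_alg X A = (direct_sum (topspace X) (\<lambda>_. A))\<lparr>cs_carrier :=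
     {f \<in> extensional (topspace X). continuous_map X (cs_topology A) f}\<rparr>"
  by (simp add: cont_alg_def direct_sum_def)

lemma cont_alg_simps [simp]:
  "cs_carrier (cont_alg X A) = {f \<in> extensional (topspace X). continuous_map X (cs_topology A) f}"
  "cs_zero (cont_alg X A) = (\<lambda>x\<in>topspace X. cs_zero A)"
  "cs_apply u (cont_alg X A) f g = (\<lambda>x\<in>topspace X. cs_apply u A (f x) (g x))"
  "cs_diff (cont_alg X A) f g = (\<lambda>x\<in>topspace X. cs_diff A (f x) (g x))"
  by (simp_all add: cont_alg_eq)

context cstar_algebra
begin

lemma bounded_continuous:
  assumes X: "compact_space X" and f: "continuous_map X (cs_topology A) f"
  shows "bdd_above ((\<lambda>x. cs_norm A (f x)) ` topspace X)"
proof -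
  have "compactin euclideanreal ((\<lambda>x. cs_norm A (f x)) ` topspace X)"
    using X continuous_map_norm[OF f] by (intro image_compactin) (auto simp: compact_space_def)
  then show ?thesis
    by (simp add: compact_imp_bounded bounded_imp_bdd_above)
qed

lemma uniform_limit_continuous:
  assumes f: "f \<in> topspace X \<rightarrow> cs_carrier A"
    and lim: "\<And>e. 0 < e \<Longrightarrow> \<exists>g. continuous_map X (cs_topology A) g \<and>
      (\<forall>x\<in>topspace X. cs_norm A (cs_diff A (g x) (f x)) \<le> e)"
  shows "continuous_map X (cs_topology A) f"
  unfolding continuous_map_iff
proof (intro conjI f ballI allI impI)
  fix x e assume x: "x \<in> topspace X" and e: "0 < (e::real)"
  have "0 < e/3" using e by simp
  from lim[OF this] obtain g where g: "continuous_map X (cs_topology A) g"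
    "\<And>x. x\<in>topspace X \<Longrightarrow> cs_norm A (cs_diff A (g x) (f x)) \<le> e/3" by blast
  obtain U where U: "openin X U" "x \<in> U" "\<forall>y\<in>U. cs_norm A (cs_diff A (g y) (g x)) \<le> e/3"
    using continuous_mapD(2)[OF g(1) x \<open>0 < e/3\<close>] by blast
  have "cs_norm A (cs_diff A (f y) (f x)) \<le> e" if y: "y \<in> U" for y
  proof -
    have yX: "y \<in> topspace X" using U(1) y openin_subset by blast
    note c = continuous_mapD(1)[OF g(1) x] continuous_mapD(1)[OF g(1) yX] f[THEN funcset_mem, OF x] f[THEN funcset_mem, OF yX]
    show ?thesis
      using norm_diff_triangle[OF c(4) c(2) c(3)] norm_diff_triangle[OF c(2) c(1) c(3)]
        g(2)[OF x] g(2)[OF yX] norm_diff_commute[OF c(4) c(2)] U(3) y by fastforce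
  qed
  with U show "\<exists>U. openin X U \<and> x \<in> U \<and> (\<forall>y\<in>U. cs_norm A (cs_diff A (f y) (f x)) \<le> e)" by blast
qed

lemma cstar_cont_alg:
  assumes X: "compact_space X"
  shows "cstar_algebra (cont_alg X A)"
proof -
  let ?B = "bounded_sum (topspace X) (\<lambda>_. A)"
  let ?C = "{f \<in> extensional (topspace X). continuous_map X (cs_topology A) f}"
  interpret B: cstar_algebra ?B by (rule cstar_bounded_sum) (rule cstar_algebra_axioms)
  have "cstar_algebra (?B\<lparr>cs_carrier := ?C\<rparr>)"
  proof (rule cstar_subalgebra[OF B.cstar_algebra_axioms])
    show "?C \<subseteq> cs_carrier ?B"
      using bounded_continuous[OF X] continuous_mapD(1) by (auto simp: bounded_sum_def PiE_def)
    show "cs_zero ?B \<in> ?C"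
      by (auto simp: bounded_sum_def continuous_map_const intro: continuous_map_eq[where f="\<lambda>_. cs_zero A"])
    show "cs_apply u ?B f g \<in> ?C" if "f \<in> ?C" "g \<in> ?C" for u f g
      using that continuous_map_apply[of X f g u]
      by (auto simp: bounded_sum_def intro: continuous_map_eq)
    fix f assume f: "f \<in> cs_carrier ?B" and lim: "\<And>e. 0 < e \<Longrightarrow> \<exists>g\<in>?C. cs_norm ?B (cs_diff ?B g f) \<le> e"
    have "continuous_map X (cs_topology A) f"
    proof (rule uniform_limit_continuous)
      show "f \<in> topspace X \<rightarrow> cs_carrier A" using f by (auto simp: bounded_sum_def)
      fix e :: real assume "0 < e"
      then obtain g where g: "g \<in> ?C" "cs_norm ?B (cs_diff ?B g f) \<le> e" using lim by blast
      have "cs_diff ?B g f \<in> cs_carrier ?B"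
        using \<open>?C \<subseteq> cs_carrier ?B\<close> g(1) f by (intro B.diff_closed) auto
      then have "\<forall>x\<in>topspace X. cs_norm A (cs_diff ?B g f x) \<le> e"
        using g(2) direct_sum_norm_le_iff[of "\<lambda>_. A" "cs_diff ?B g f" "topspace X" e] by (auto simp: bounded_sum_def)
      then show "\<exists>g. continuous_map X (cs_topology A) g \<and> (\<forall>x\<in>topspace X. cs_norm A (cs_diff A (g x) (f x)) \<le> e)"
        using g(1) by (intro exI[of _ g]) (auto simp: bounded_sum_def)
    qed
    then show "f \<in> ?C" using f by (auto simp: bounded_sum_def PiE_def)
  qed
  then show ?thesis by (simp add: bounded_sum_def cont_alg_eq)
qed

lemma cont_alg_norm_le_iff:
  assumes "compact_space X" "f \<in> cs_carrier (cont_alg X A)"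
  shows "cs_norm (cont_alg X A) f \<le> e \<longleftrightarrow> 0 \<le> e \<and> (\<forall>x\<in>topspace X. cs_norm A (f x) \<le> e)"
  using direct_sum_norm_le_iff[of "\<lambda>_. A" f "topspace X" e] bounded_continuous[OF assms(1)] assms(2)
  by (simp add: cont_alg_eq)

lemma cont_alg_norm_upper:
  assumes "compact_space X" "f \<in> cs_carrier (cont_alg X A)" "x \<in> topspace X"
  shows "cs_norm A (f x) \<le> cs_norm (cont_alg X A) f"
  using cont_alg_norm_le_iff[OF assms(1,2), of "cs_norm (cont_alg X A) f"] assms(3) by simp

text \<open>With the variable in \<open>Y\<close> moving over a compact space, the tube lemma makes closeness near
\<open>{x} \<times> Y\<close> uniform, which is what the supremum norm asks for.\<close>

lemma continuous_map_curry:
  assumes Y: "compact_space Y"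
    and g: "continuous_map (prod_topology X Y) (cs_topology A) (\<lambda>(x, y). g x y)"
  shows "continuous_map X (cs_topology (cont_alg Y A)) (\<lambda>x. \<lambda>y\<in>topspace Y. g x y)"
proof -
  interpret C: cstar_algebra "cont_alg Y A" by (rule cstar_cont_alg[OF Y])
  have gc: "g x y \<in> cs_carrier A" if "x \<in> topspace X" "y \<in> topspace Y" for x y
    using continuous_mapD(1)[OF g, of "(x, y)"] that by simp
  have mem: "(\<lambda>y\<in>topspace Y. g x y) \<in> cs_carrier (cont_alg Y A)" if x: "x \<in> topspace X" for x
  proof -
    have "continuous_map Y (prod_topology X Y) (\<lambda>y. (x, y))"
      using x by (simp add: continuous_map_pairwise o_def continuous_map_const)
    from continuous_map_compose[OF this g] show ?thesis
      by (auto simp: o_def intro: continuous_map_eq)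
  qed
  show ?thesis
    unfolding C.continuous_map_iff
  proof (intro conjI ballI allI impI)
    show "(\<lambda>x. \<lambda>y\<in>topspace Y. g x y) \<in> topspace X \<rightarrow> cs_carrier (cont_alg Y A)"
      using mem by blast
    fix x e assume x: "x \<in> topspace X" and e: "0 < (e::real)"
    let ?h = "\<lambda>(x', y). cs_diff A (g x' y) (g x y)"
    have "continuous_map (prod_topology X Y) (prod_topology X Y) (\<lambda>p. (x, snd p))"
      using x by (simp add: continuous_map_pairwise o_def continuous_map_const continuous_map_snd)
    from continuous_map_compose[OF this g]
    have "continuous_map (prod_topology X Y) (cs_topology A) (\<lambda>p. g x (snd p))"
      by (simp add: o_def)
    from continuous_map_apply[OF g continuous_map_apply[OF this this, of "Scale (-1)"], of Add]
    have "continuous_map (prod_topology X Y) (cs_topology A) ?h"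
      by (simp add: cs_diff_def case_prod_unfold)
    then have h: "continuous_map (prod_topology X Y) euclideanreal (\<lambda>p. cs_norm A (?h p))"
      by (rule continuous_map_norm)
    let ?W = "{p \<in> topspace (prod_topology X Y). cs_norm A (?h p) \<in> {..<e}}"
    have "openin (prod_topology X Y) ?W"
      using h by (rule openin_continuous_map_preimage) auto
    moreover have "{x} \<times> topspace Y \<subseteq> ?W"
      using x e gc by (auto simp: norm_zero)
    ultimately obtain U V where UV: "openin X U" "x \<in> U" "topspace Y \<subseteq> V" "U \<times> V \<subseteq> ?W"
      using tube_lemma_right[of X Y ?W "topspace Y" x] Y x unfolding compact_space_def by blast
    have "cs_norm (cont_alg Y A) (cs_diff (cont_alg Y A) (\<lambda>y\<in>topspace Y. g x' y) (\<lambda>y\<in>topspace Y. g x y)) \<le> e"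
      if x': "x' \<in> U" for x'
    proof -
      have "x' \<in> topspace X" using UV(1) x' openin_subset by blast
      then show ?thesis
        using cont_alg_norm_le_iff[OF Y C.diff_closed[OF mem mem], of x' x e] x e UV(3,4) x' by force
    qed
    with UV show "\<exists>U. openin X U \<and> x \<in> U \<and> (\<forall>y\<in>U. cs_norm (cont_alg Y A)
        (cs_diff (cont_alg Y A) (\<lambda>y'\<in>topspace Y. g y y') (\<lambda>y\<in>topspace Y. g x y)) \<le> e)" by blast
  qed
qed

text \<open>The abstract evaluation \<open>ev\<close> covers two uses: reading off one cell of a path of tuples, and
applying an attaching map along a path. In both cases it is contractive in \<open>b\<close>, uniformly in \<open>y\<close>.\<close>

lemma continuous_map_eval:
  assumes B: "cstar_algebra B" and f: "continuous_map X (cs_topology B) f"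
    and ev: "\<And>b. b \<in> cs_carrier B \<Longrightarrow> continuous_map Y (cs_topology A) (ev b)"
    and contr: "\<And>b c y. \<lbrakk>b \<in> cs_carrier B; c \<in> cs_carrier B; y \<in> topspace Y\<rbrakk> \<Longrightarrow>
      cs_norm A (cs_diff A (ev b y) (ev c y)) \<le> cs_norm B (cs_diff B b c)"
  shows "continuous_map (prod_topology X Y) (cs_topology A) (\<lambda>(x, y). ev (f x) y)"
  unfolding continuous_map_iff
proof (intro conjI ballI allI impI)
  interpret B: cstar_algebra B by (rule B)
  note fc = B.continuous_mapD(1)[OF f]
  note evc = continuous_mapD(1)[OF ev]
  show "(\<lambda>(x, y). ev (f x) y) \<in> topspace (prod_topology X Y) \<rightarrow> cs_carrier A"
    using fc evc by auto
  fix p e assume p: "p \<in> topspace (prod_topology X Y)" and e: "0 < (e::real)"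
  obtain x y where xy: "p = (x, y)" "x \<in> topspace X" "y \<in> topspace Y" using p by auto
  have e2: "0 < e/2" using e by simp
  obtain U where U: "openin X U" "x \<in> U" "\<forall>x'\<in>U. cs_norm B (cs_diff B (f x') (f x)) \<le> e/2"
    using B.continuous_mapD(2)[OF f xy(2) e2] by blast
  obtain V where V: "openin Y V" "y \<in> V" "\<forall>y'\<in>V. cs_norm A (cs_diff A (ev (f x) y') (ev (f x) y)) \<le> e/2"
    using continuous_mapD(2)[OF ev[OF fc[OF xy(2)]] xy(3) e2] by blast
  have "cs_norm A (cs_diff A (ev (f x') y') (ev (f x) y)) \<le> e" if "x' \<in> U" "y' \<in> V" for x' y'
  proof -
    have X: "x' \<in> topspace X" "y' \<in> topspace Y" using U(1) V(1) that openin_subset by blast+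
    show ?thesis
      using norm_diff_triangle[OF evc[OF fc[OF X(1)] X(2)] evc[OF fc[OF xy(2)] X(2)] evc[OF fc[OF xy(2)] xy(3)]]
        contr[OF fc[OF X(1)] fc[OF xy(2)] X(2)] U(3) V(3) that by fastforce
  qed
  then show "\<exists>U. openin (prod_topology X Y) U \<and> p \<in> U \<and>
    (\<forall>q\<in>U. cs_norm A (cs_diff A (case q of (x, y) \<Rightarrow> ev (f x) y) (case p of (x, y) \<Rightarrow> ev (f x) y)) \<le> e)"
    using U V xy by (intro exI[of _ "U \<times> V"]) (auto simp: openin_prod_Times_iff)
qed

end

text \<open>Stated for subalgebras as well, since the skeleta are subalgebras of finite direct sums with the
same norm.\<close>

lemma continuous_map_direct_sum:
  assumes I: "finite I" and A: "\<And>i. i \<in> I \<Longrightarrow> cstar_algebra (A i)"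
    and C: "C \<subseteq> cs_carrier (direct_sum I A)" and B: "cstar_algebra ((direct_sum I A)\<lparr>cs_carrier := C\<rparr>)"
  shows "continuous_map X (cs_topology ((direct_sum I A)\<lparr>cs_carrier := C\<rparr>)) f \<longleftrightarrow>
    f \<in> topspace X \<rightarrow> C \<and> (\<forall>i\<in>I. continuous_map X (cs_topology (A i)) (\<lambda>x. f x i))" (is "?L \<longleftrightarrow> ?R")
proof -
  interpret B: cstar_algebra "(direct_sum I A)\<lparr>cs_carrier := C\<rparr>" by (rule B)
  have le: "cs_norm (direct_sum I A) x \<le> e \<longleftrightarrow> 0 \<le> e \<and> (\<forall>i\<in>I. cs_norm (A i) (x i) \<le> e)" for x e
    by (rule direct_sum_norm_le_iff) (use I in auto)
  show ?thesis
  proof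
    assume L: ?L
    have fC: "f \<in> topspace X \<rightarrow> C" using B.continuous_mapD(1)[OF L] by auto
    have "continuous_map X (cs_topology (A i)) (\<lambda>x. f x i)" if i: "i \<in> I" for i
      unfolding cstar_algebra.continuous_map_iff[OF A[OF i]]
    proof (intro conjI ballI allI impI)
      show "(\<lambda>x. f x i) \<in> topspace X \<rightarrow> cs_carrier (A i)" using fC C i by fastforce
      fix x e assume x: "x \<in> topspace X" "0 < (e::real)"
      then obtain U where "openin X U" "x \<in> U"
        "\<forall>y\<in>U. cs_norm (direct_sum I A) (cs_diff (direct_sum I A) (f y) (f x)) \<le> e"
        using B.continuous_mapD(2)[OF L x] by auto
      then show "\<exists>U. openin X U \<and> x \<in> U \<and> (\<forall>y\<in>U. cs_norm (A i) (cs_diff (A i) (f y i) (f x i)) \<le> e)"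
        using i by (auto simp: le)
    qed
    with fC show ?R by blast
  next
    assume R: ?R
    show ?L
      unfolding B.continuous_map_iff
    proof (intro conjI ballI allI impI)
      show "f \<in> topspace X \<rightarrow> cs_carrier ((direct_sum I A)\<lparr>cs_carrier := C\<rparr>)" using R by simp
      fix x e assume x: "x \<in> topspace X" "0 < (e::real)"
      have "\<exists>U. openin X U \<and> x \<in> U \<and> (\<forall>y\<in>U. cs_norm (A i) (cs_diff (A i) (f y i) (f x i)) \<le> e)" if "i \<in> I" for i
        using R that cstar_algebra.continuous_mapD(2)[OF A[OF that] _ x] by blast
      then obtain U where U: "\<And>i. i \<in> I \<Longrightarrow> openin X (U i)" "\<And>i. i \<in> I \<Longrightarrow> x \<in> U i"
        "\<And>i y. i \<in> I \<Longrightarrow> y \<in> U i \<Longrightarrow> cs_norm (A i) (cs_diff (A i) (f y i) (f x i)) \<le> e"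
        by metis
      have "openin X (topspace X \<inter> (\<Inter>i\<in>I. U i))"
      proof (cases "I = {}")
        case False
        then show ?thesis using I U(1) by (intro openin_Int openin_Inter) auto
      qed auto
      then show "\<exists>U. openin X U \<and> x \<in> U \<and> (\<forall>y\<in>U. cs_norm ((direct_sum I A)\<lparr>cs_carrier := C\<rparr>)
          (cs_diff ((direct_sum I A)\<lparr>cs_carrier := C\<rparr>) (f y) (f x)) \<le> e)"
        using U x by (intro exI[of _ "topspace X \<inter> (\<Inter>i\<in>I. U i)"]) (auto simp: le)
    qed
  qed
qed




section \<open>Cubes\<close>

lemma topspace_cube: "topspace (cube k) = (\<Pi>\<^sub>E i\<in>{..<k}. {0..1})"
  by (simp add: cube_def o_def)

lemma compact_cube [simp]: "compact_space (cube k)"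
  by (simp add: cube_def compact_space_product_topology compact_space_subtopology)

lemma continuous_cube_coordinate:
  "i < k \<Longrightarrow> continuous_map (cube k) euclideanreal (\<lambda>p. p i)"
  using continuous_map_product_projection[of i "{..<k}" "\<lambda>_. top_of_set {0..1::real}"]
  by (simp add: cube_def continuous_map_in_subtopology)

lemma continuous_map_cube_iff:
  "continuous_map X (cube k) f \<longleftrightarrow> f \<in> topspace X \<rightarrow> topspace (cube k) \<and>
     (\<forall>i<k. continuous_map X euclideanreal (\<lambda>x. f x i))"
  by (auto simp: cube_def continuous_map_componentwise continuous_map_in_subtopology PiE_def Pi_iff o_def)

lemma topspace_cube_boundary:
  "topspace (cube_boundary k) = {p \<in> topspace (cube k). \<exists>i<k. p i = 0 \<or> p i = 1}"
proof -
  have "topspace (cube_boundary k) = {p \<in> topspace (cube k). p \<notin> open_cube k}"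
    by (auto simp: cube_boundary_def)
  also have "\<dots> = {p \<in> topspace (cube k). \<exists>i<k. p i = 0 \<or> p i = 1}"
    by (auto simp: topspace_cube open_cube_def PiE_iff less_le)
  finally show ?thesis .
qed

lemma cube_boundary_eq: "cube_boundary k = subtopology (cube k) (topspace (cube_boundary k))"
proof -
  have "topspace (cube_boundary k) = topspace (cube k) - open_cube k"
    by (auto simp: cube_boundary_def)
  then show ?thesis by (simp add: cube_boundary_def)
qed

lemma boundary_subset: "p \<in> topspace (cube_boundary k) \<Longrightarrow> p \<in> topspace (cube k)"
  by (simp add: topspace_cube_boundary)

lemma closedin_cube_boundary: "closedin (cube k) (topspace (cube_boundary k))"
proof -
  have "topspace (cube_boundary k) = (\<Union>i<k. {p \<in> topspace (cube k). p i \<in> {0, 1}})"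
    by (auto simp: topspace_cube_boundary)
  also have "closedin (cube k) \<dots>"
    by (intro closedin_Union) (use closedin_continuous_map_preimage[OF continuous_cube_coordinate, of _ k "{0, 1}"] in auto)
  finally show ?thesis .
qed

lemma compact_cube_boundary [simp]: "compact_space (cube_boundary k)"
  by (metis cube_boundary_eq closedin_cube_boundary closedin_compact_space compact_cube
      compact_space_subtopology)

text \<open>The path parameter \<open>t\<close> will be the last coordinate, so that the identification
  \<open>[0,1]\<^bsup>k+1\<^esup> = [0,1] \<times> [0,1]\<^sup>k\<close> is \<open>q(k := t)\<close> in one direction and a restriction in the other.\<close>

lemma cube_join: "\<lbrakk>q \<in> topspace (cube k); t \<in> {0..1}\<rbrakk> \<Longrightarrow> q(k := t) \<in> topspace (cube (Suc k))"
  by (auto simp: topspace_cube PiE_iff extensional_def)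

lemma cube_split:
  assumes "p \<in> topspace (cube (Suc k))"
  shows "restrict p {..<k} \<in> topspace (cube k)" "p k \<in> {0..1}" "(restrict p {..<k})(k := p k) = p"
  using assms by (auto simp: topspace_cube PiE_iff extensional_def fun_eq_iff)

lemma cube_join_split [simp]:
  "q \<in> topspace (cube k) \<Longrightarrow> restrict (q(k := t)) {..<k} = q"
  by (auto simp: topspace_cube PiE_iff extensional_def fun_eq_iff)

lemma continuous_map_cube_join:
  "continuous_map (prod_topology (top_of_set {0..1}) (cube k)) (cube (Suc k)) (\<lambda>(t, q). q(k := t))"
  unfolding continuous_map_cube_iff
proof (intro conjI allI impI)
  show "(\<lambda>(t, q). q(k := t)) \<in> topspace (prod_topology (top_of_set {0..1}) (cube k)) \<rightarrow> topspace (cube (Suc k))"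
    using cube_join by auto
  fix i assume "i < Suc k"
  then consider "i = k" | "i < k" by linarith
  then show "continuous_map (prod_topology (top_of_set {0..1}) (cube k)) euclideanreal
      (\<lambda>x. (case x of (t, q) \<Rightarrow> q(k := t)) i)"
  proof cases
    case 1
    have "continuous_map (prod_topology (top_of_set {0..1}) (cube k)) (top_of_set {0..1::real}) fst"
      by (rule continuous_map_fst)
    with 1 show ?thesis by (simp add: case_prod_unfold continuous_map_in_subtopology)
  next
    case 2
    have "continuous_map (prod_topology (top_of_set {0..1::real}) (cube k)) (cube k) snd"
      by (rule continuous_map_snd)
    from continuous_map_compose[OF this continuous_cube_coordinate[OF 2]] 2 show ?thesis
      by (simp add: case_prod_unfold o_def)
  qed
qed

lemma continuous_map_cube_split:
  "continuous_map (cube (Suc k)) (prod_topology (top_of_set {0..1}) (cube k)) (\<lambda>p. (p k, restrict p {..<k}))"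
  by (auto simp: continuous_map_pairwise o_def continuous_map_in_subtopology continuous_map_cube_iff
      continuous_cube_coordinate cube_split less_SucI dest: cube_split)

text \<open>The two ends and the side of the cylinder \<open>[0,1] \<times> [0,1]\<^sup>k\<close>.\<close>

lemma cube_boundary_Suc:
  "p \<in> topspace (cube_boundary (Suc k)) \<longleftrightarrow> p \<in> topspace (cube (Suc k)) \<and>
     (p k = 0 \<or> p k = 1 \<or> restrict p {..<k} \<in> topspace (cube_boundary k))"
  using cube_split(1)[of p k] by (auto simp: topspace_cube_boundary less_Suc_eq)

section \<open>Extending functions from the boundary of a cube\<close>

context cstar_algebra
begin

lemma cont_alg_apply: "\<lbrakk>f \<in> cs_carrier (cont_alg X A); x \<in> topspace X\<rbrakk> \<Longrightarrow> f x \<in> cs_carrier A"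
  using continuous_mapD(1) by auto

lemma continuous_map_scale:
  assumes c: "continuous_map X euclideanreal c" and f: "continuous_map X (cs_topology A) f"
  shows "continuous_map X (cs_topology A) (\<lambda>x. cs_scale A (complex_of_real (c x)) (f x))"
  unfolding continuous_map_iff
proof (intro conjI ballI allI impI)
  note fc = continuous_mapD(1)[OF f]
  show "(\<lambda>x. cs_scale A (complex_of_real (c x)) (f x)) \<in> topspace X \<rightarrow> cs_carrier A"
    using fc by auto
  fix x e assume x: "x \<in> topspace X" and e: "0 < (e::real)"
  let ?C = "\<bar>c x\<bar> + 1" and ?F = "cs_norm A (f x) + 1"
  have F: "0 < ?F" using norm_nonneg[OF fc[OF x]] by linarith
  have "0 < e / (2 * ?C)" using e by simp
  then obtain U where U: "openin X U" "x \<in> U" "\<forall>y\<in>U. cs_norm A (cs_diff A (f y) (f x)) \<le> e / (2 * ?C)"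
    using continuous_mapD(2)[OF f x] by blast
  define V where "V = {y \<in> topspace X. c y \<in> ball (c x) (min 1 (e / (2 * ?F)))}"
  have V: "openin X V" "x \<in> V"
    using openin_continuous_map_preimage[OF c, of "ball (c x) (min 1 (e / (2 * ?F)))"] x e F
    by (auto simp: V_def)
  have "cs_norm A (cs_diff A (cs_scale A (complex_of_real (c y)) (f y)) (cs_scale A (complex_of_real (c x)) (f x))) \<le> e"
    if y: "y \<in> U" "y \<in> V" for y
  proof -
    have yX: "y \<in> topspace X" using U(1) y openin_subset by blast
    note cl = fc[OF x] fc[OF yX]
    have d: "\<bar>c y - c x\<bar> \<le> 1" "\<bar>c y - c x\<bar> \<le> e / (2 * ?F)"
      using y(2) by (auto simp: V_def dist_real_def abs_minus_commute)
    have "cs_diff A (cs_scale A (complex_of_real (c y)) (f y)) (cs_scale A (complex_of_real (c x)) (f x))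
      = cs_add A (cs_scale A (complex_of_real (c y)) (cs_diff A (f y) (f x)))
         (cs_scale A (complex_of_real (c y - c x)) (f x))"
      using cl diff_split[of "cs_scale A (complex_of_real (c y)) (f y)" "cs_scale A (complex_of_real (c y)) (f x)"
          "cs_scale A (complex_of_real (c x)) (f x)"]
      by (simp add: scale_diff scale_diff_left)
    then have "cs_norm A (cs_diff A (cs_scale A (complex_of_real (c y)) (f y)) (cs_scale A (complex_of_real (c x)) (f x)))
        \<le> cmod (complex_of_real (c y)) * cs_norm A (cs_diff A (f y) (f x))
          + cmod (complex_of_real (c y - c x)) * cs_norm A (f x)"
      using norm_triangle[of "cs_scale A (complex_of_real (c y)) (cs_diff A (f y) (f x))"
          "cs_scale A (complex_of_real (c y - c x)) (f x)"] cl
      by (simp only: norm_scale diff_closed scale_closed)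
    also have "\<dots> = \<bar>c y\<bar> * cs_norm A (cs_diff A (f y) (f x)) + \<bar>c y - c x\<bar> * cs_norm A (f x)"
      by (simp only: norm_of_real)
    also have "\<dots> \<le> ?C * (e / (2 * ?C)) + (e / (2 * ?F)) * ?F"
      using U(3) y(1) d F norm_nonneg[OF cl(1)] norm_nonneg[of "cs_diff A (f y) (f x)"] cl e
      by (intro add_mono mult_mono) auto
    also have "\<dots> = e"
    proof -
      have half: "b * (e / (2 * b)) = e/2" if "0 < b" for b :: real using that by simp
      show ?thesis using half[of ?C] half[OF F] by (simp only: mult.commute[of _ ?F])
    qed
    finally show ?thesis .
  qed
  then show "\<exists>U. openin X U \<and> x \<in> U \<and> (\<forall>y\<in>U. cs_norm A (cs_diff A
      (cs_scale A (complex_of_real (c y)) (f y)) (cs_scale A (complex_of_real (c x)) (f x))) \<le> e)"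
    using U V by (intro exI[of _ "U \<inter> V"]) auto
qed

text \<open>The radial extension: \<open>r\<close> is the distance from the centre of the cube in the maximum norm, scaled to
be \<open>1\<close> on the boundary, and \<open>proj\<close> is the projection from the centre onto the boundary. The function
\<open>r(p) f(proj p)\<close> tends to \<open>0\<close> at the centre because \<open>f\<close> is bounded.\<close>

lemma extend_from_cube_boundary:
  assumes k: "0 < k" and f: "f \<in> cs_carrier (cont_alg (cube_boundary k) A)"
  obtains g where "g \<in> cs_carrier (cont_alg (cube k) A)" "boundary_restrict k g = f"
proof -
  define r where "r = (\<lambda>p::point. Max ((\<lambda>i. \<bar>2 * p i - 1\<bar>) ` {..<k}))"
  define proj where "proj = (\<lambda>p::point. \<lambda>i\<in>{..<k}. 1/2 + (p i - 1/2) / r p)"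
  have ne: "(\<lambda>i. \<bar>2 * p i - 1\<bar>) ` {..<k} \<noteq> {}" for p :: point using k by auto
  have r_ge: "\<bar>2 * p i - 1\<bar> \<le> r p" if "i < k" for p i
    unfolding r_def using that by (intro Max_ge) auto
  have r_ex: "\<exists>i<k. r p = \<bar>2 * p i - 1\<bar>" for p
    using Max_in[OF _ ne, of p] by (auto simp: r_def)
  have r0: "0 \<le> r p" for p using r_ex[of p] by auto
  have rb: "r p = 1" if p: "p \<in> topspace (cube_boundary k)" for p
  proof -
    obtain i where i: "i < k" "p i = 0 \<or> p i = 1" "p \<in> topspace (cube k)"
      using p by (auto simp: topspace_cube_boundary)
    obtain j where j: "j < k" "r p = \<bar>2 * p j - 1\<bar>" using r_ex by blast
    have "p j \<in> {0..1}" using PiE_mem[OF i(3)[unfolded topspace_cube], of j] j(1) by simp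
    then have "r p \<le> 1" unfolding j(2) by (simp add: abs_le_iff)
    then show ?thesis using r_ge[OF i(1), of p] i(2) by auto
  qed
  have proj_id: "proj p = p" if "p \<in> topspace (cube_boundary k)" for p
    using rb[OF that] that by (auto simp: proj_def topspace_cube_boundary topspace_cube PiE_iff extensional_def fun_eq_iff)
  have proj_b: "proj p \<in> topspace (cube_boundary k)" if "p \<in> topspace (cube k)" "0 < r p" for p
  proof -
    have "\<bar>(2 * p i - 1) / r p\<bar> \<le> 1" if "i < k" for i
      using r_ge[OF that, of p] \<open>0 < r p\<close> by (simp add: divide_le_eq_1)
    then have "1/2 + (p i - 1/2) / r p \<in> {0..1}" if "i < k" for i
      using that \<open>0 < r p\<close> by (force simp: abs_le_iff field_simps)
    moreover obtain j where j: "j < k" "r p = \<bar>2 * p j - 1\<bar>" using r_ex by blast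
    then have "1/2 + (p j - 1/2) / r p = 0 \<or> 1/2 + (p j - 1/2) / r p = 1"
      using \<open>0 < r p\<close> by (cases "2 * p j - 1 \<ge> 0") (auto simp: field_simps)
    ultimately show ?thesis
      using j(1) by (auto simp: topspace_cube_boundary topspace_cube proj_def)
  qed
  have r_cont: "continuous_map (cube k) euclideanreal r"
  proof -
    have "continuous_map (cube k) euclideanreal (\<lambda>p. Max ((\<lambda>i. \<bar>2 * p i - 1\<bar>) ` J))"
      if "finite J" "J \<noteq> {}" "J \<subseteq> {..<k}" for J
      using that
    proof (induction J rule: finite_ne_induct)
      case (singleton i)
      then show ?case by (auto intro!: continuous_intros continuous_cube_coordinate)
    next
      case (insert i J)
      then show ?case
        by (simp add: continuous_map_real_max continuous_cube_coordinate continuous_map_real_abs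
            continuous_map_diff continuous_map_real_mult)
    qed
    from this[of "{..<k}"] k show ?thesis by (auto simp: r_def)
  qed
  define B where "B = cs_norm (cont_alg (cube_boundary k) A) f"
  have fB: "cs_norm A (f q) \<le> B" if "q \<in> topspace (cube_boundary k)" for q
    unfolding B_def using cont_alg_norm_upper[OF compact_cube_boundary f that] .
  have fc: "f q \<in> cs_carrier A" if "q \<in> topspace (cube_boundary k)" for q
    by (rule continuous_mapD(1)[OF _ that]) (use f in simp)
  have B0: "0 \<le> B"
    using cont_alg_norm_le_iff[OF compact_cube_boundary f, of B] by (simp add: B_def)
  define g where "g = (\<lambda>p\<in>topspace (cube k). if r p = 0 then cs_zero A else cs_scale A (complex_of_real (r p)) (f (proj p)))"
  have gc: "g p \<in> cs_carrier A" if "p \<in> topspace (cube k)" for p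
    using that fc[OF proj_b[OF that]] r0[of p] by (auto simp: g_def less_le)
  have "continuous_map (cube k) (cs_topology A) g"
    unfolding continuous_map_iff
  proof (intro conjI ballI allI impI)
    show "g \<in> topspace (cube k) \<rightarrow> cs_carrier A" using gc by auto
    fix p e assume p: "p \<in> topspace (cube k)" and e: "0 < (e::real)"
    show "\<exists>U. openin (cube k) U \<and> p \<in> U \<and> (\<forall>y\<in>U. cs_norm A (cs_diff A (g y) (g p)) \<le> e)"
    proof (cases "r p = 0")
      case True
      let ?U = "{y \<in> topspace (cube k). r y \<in> {..<e / (B + 1)}}"
      have "openin (cube k) ?U"
        using r_cont by (rule openin_continuous_map_preimage) auto
      moreover have "cs_norm A (cs_diff A (g y) (g p)) \<le> e" if y: "y \<in> ?U" for y
      proof -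
        have gp: "g p = cs_zero A" using True p by (simp add: g_def)
        show ?thesis
        proof (cases "r y = 0")
          case False
          then have ry: "0 < r y" using r0[of y] by simp
          note b = proj_b[OF _ ry]
          have "cs_norm A (g y) = r y * cs_norm A (f (proj y))"
            using y ry fc[OF b] by (simp add: g_def norm_scale)
          also have "\<dots> \<le> (e / (B + 1)) * (B + 1)"
            using fB[OF b] y ry norm_nonneg[OF fc[OF b]] B0 by (intro mult_mono) auto
          also have "\<dots> = e" using B0 by simp
          finally show ?thesis using gc y gp by simp
        qed (use y gp e in \<open>simp add: g_def\<close>)
      qed
      moreover have "p \<in> ?U" using True p e B0 by auto
      ultimately show ?thesis by (intro exI[of _ ?U]) blast
    next
      case False
      let ?U0 = "{y \<in> topspace (cube k). r y \<in> {0<..}}"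
      have U0: "openin (cube k) ?U0"
        using r_cont by (rule openin_continuous_map_preimage) auto
      let ?X = "subtopology (cube k) ?U0"
      have tX: "topspace ?X = ?U0" by auto
      have rX: "continuous_map (subtopology (cube k) S) euclideanreal r" for S by (rule continuous_map_from_subtopology[OF r_cont])
      have "continuous_map ?X euclideanreal (\<lambda>x. proj x i)" if "i < k" for i
        unfolding proj_def using that
        by (auto intro!: continuous_intros rX continuous_map_from_subtopology[OF continuous_cube_coordinate])
      then have "continuous_map ?X (cube_boundary k) proj"
        by (subst cube_boundary_eq) (use proj_b boundary_subset in
          \<open>auto simp: continuous_map_in_subtopology continuous_map_cube_iff tX\<close>)
      then have "continuous_map ?X (cs_topology A) (f \<circ> proj)"
        using f by (auto intro: continuous_map_compose)
      from continuous_map_scale[OF rX this]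
      have "continuous_map ?X (cs_topology A) g"
        by (rule continuous_map_eq) (auto simp: g_def)
      moreover have "p \<in> topspace ?X" using p False r0[of p] by (simp add: less_le)
      ultimately obtain U where "openin ?X U" "p \<in> U" "\<forall>y\<in>U. cs_norm A (cs_diff A (g y) (g p)) \<le> e"
        using continuous_mapD(2)[of ?X g p e] e by blast
      then show ?thesis using openin_open_subtopology[OF U0] by blast
    qed
  qed
  then have "g \<in> cs_carrier (cont_alg (cube k) A)" by (simp add: g_def)
  moreover have "boundary_restrict k g = f"
  proof
    fix q show "boundary_restrict k g q = f q"
    proof (cases "q \<in> topspace (cube_boundary k)")
      case True
      then show ?thesis
        using rb[OF True] proj_id[OF True] boundary_subset[OF True] fc[OF True]
        by (simp add: boundary_restrict_def g_def scale_one)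
    next
      case False
      then show ?thesis using f by (simp add: boundary_restrict_def extensional_def)
    qed
  qed
  ultimately show ?thesis by (rule that)
qed

end

section \<open>Skeleta\<close>

lemma restrict_atMost_restrict [simp]:
  "j \<le> k \<Longrightarrow> restrict (restrict x {..k}) {..j} = restrict x {..(j::nat)}"
  by (auto simp: fun_eq_iff)

lemma skeleton_eq:
  "skeleton N K = (direct_sum {..K} (cell_alg N))\<lparr>cs_carrier := cs_carrier (skeleton N K)\<rparr>"
  by (cases K) (auto simp: subalgebra_def)

lemma skeleton_simps [simp]:
  "cs_apply u (skeleton N K) x y = (\<lambda>k\<in>{..K}. cs_apply u (cell_alg N k) (x k) (y k))"
  "cs_diff (skeleton N K) x y = (\<lambda>k\<in>{..K}. cs_diff (cell_alg N k) (x k) (y k))"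
  "cs_zero (skeleton N K) = (\<lambda>k\<in>{..K}. cs_zero (cell_alg N k))"
  "cs_norm (skeleton N K) = cs_norm (direct_sum {..K} (cell_alg N))"
  by (subst skeleton_eq; simp)+

lemma subalgebra_carrier: "cs_carrier (subalgebra A P) = {x \<in> cs_carrier A. P x}"
  by (simp add: subalgebra_def)

text \<open>The iterated pullback in one step: an element is a tuple of functions on cells in which every
component has the boundary values prescribed by the components below it.\<close>

lemma skeleton_carrier:
  "x \<in> cs_carrier (skeleton N K) \<longleftrightarrow> x \<in> (\<Pi>\<^sub>E k\<in>{..K}. cs_carrier (cell_alg N k)) \<and>
     (\<forall>k<K. boundary_restrict (Suc k) (x (Suc k)) = nc_attach N (Suc k) (restrict x {..k}))"
proof (induction K arbitrary: x)
  case (Suc K)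
  have step: "x \<in> cs_carrier (skeleton N (Suc K)) \<longleftrightarrow> x \<in> (\<Pi>\<^sub>E k\<in>{..Suc K}. cs_carrier (cell_alg N k)) \<and>
      restrict x {..K} \<in> cs_carrier (skeleton N K) \<and>
      boundary_restrict (Suc K) (x (Suc K)) = nc_attach N (Suc K) (restrict x {..K})"
    by (simp only: skeleton.simps subalgebra_carrier direct_sum_simps mem_Collect_eq)
  have dom: "restrict x {..K} \<in> (\<Pi>\<^sub>E k\<in>{..K}. cs_carrier (cell_alg N k))"
    if "x \<in> (\<Pi>\<^sub>E k\<in>{..Suc K}. cs_carrier (cell_alg N k))"
    using that by (intro restrict_PiE_iff[THEN iffD2]) (auto simp: PiE_iff)
  have all: "(\<forall>k<Suc K. P k) \<longleftrightarrow> (\<forall>k<K. P k) \<and> P K" for P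
    by (auto simp: less_Suc_eq)
  have lower: "(\<forall>k<K. boundary_restrict (Suc k) (restrict x {..K} (Suc k)) =
        nc_attach N (Suc k) (restrict (restrict x {..K}) {..k}))
      \<longleftrightarrow> (\<forall>k<K. boundary_restrict (Suc k) (x (Suc k)) = nc_attach N (Suc k) (restrict x {..k}))"
    by (intro all_cong) (simp add: less_imp_le Suc_le_eq)
  have "(a \<Longrightarrow> b) \<Longrightarrow> (a \<and> (b \<and> c) \<and> d) = (a \<and> (c \<and> d))" for a b c d
    by blast
  from this[OF dom] show ?case unfolding step Suc.IH all lower .
next
  case 0
  show ?case by (simp only: skeleton.simps direct_sum_simps) simp
qed

declare skeleton.simps(2) [simp del]

lemma skeleton_Suc_carrier:
  "x \<in> cs_carrier (skeleton N (Suc K)) \<longleftrightarrow> x \<in> cs_carrier (direct_sum {..Suc K} (cell_alg N)) \<and>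
     restrict x {..K} \<in> cs_carrier (skeleton N K) \<and>
     boundary_restrict (Suc K) (x (Suc K)) = nc_attach N (Suc K) (restrict x {..K})"
  by (simp only: skeleton.simps subalgebra_carrier mem_Collect_eq)

lemma skeleton_restrict:
  assumes "x \<in> cs_carrier (skeleton N K)" "k \<le> K"
  shows "restrict x {..k} \<in> cs_carrier (skeleton N k)"
  using assms by (auto simp: skeleton_carrier PiE_iff)

text \<open>The data of a complex up to dimension \<open>K\<close>. It omits the condition that the top ideal is not zero,
which initial segments of a complex need not satisfy.\<close>

definition attached_upto :: "'f nccw \<Rightarrow> nat \<Rightarrow> bool" where
  "attached_upto N K \<longleftrightarrow> (\<forall>k\<le>K. finite_dim_cstar (nc_fibre N k)) \<and>
     (\<forall>k<K. nc_attach N (Suc k) \<in>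
        cstar_hom (skeleton N k) (cont_alg (cube_boundary (Suc k)) (nc_fibre N (Suc k))))"

lemma attached_uptoD:
  assumes "attached_upto N K"
  shows "k \<le> K \<Longrightarrow> finite_dim_cstar (nc_fibre N k)"
    and "k < K \<Longrightarrow> nc_attach N (Suc k) \<in>
        cstar_hom (skeleton N k) (cont_alg (cube_boundary (Suc k)) (nc_fibre N (Suc k)))"
  using assms unfolding attached_upto_def by blast+

lemma attached_upto_mono: "attached_upto N K \<Longrightarrow> k \<le> K \<Longrightarrow> attached_upto N k"
  unfolding attached_upto_def by (meson order_trans less_le_trans)

lemma nccw_complex_attached:
  assumes "nccw_complex N"
  shows "attached_upto N (nc_dim N)"
  using assms unfolding nccw_complex_def attached_upto_def
  by (metis Suc_leI atLeastAtMost_iff diff_Suc_1 le_add1 plus_1_eq_Suc)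

lemma fibre_cstar: "attached_upto N K \<Longrightarrow> k \<le> K \<Longrightarrow> cstar_algebra (nc_fibre N k)"
  using attached_uptoD(1) finite_dim_cstar_def by blast

lemma cell_cstar: "attached_upto N K \<Longrightarrow> k \<le> K \<Longrightarrow> cstar_algebra (cell_alg N k)"
  unfolding cell_alg_def by (intro cstar_algebra.cstar_cont_alg fibre_cstar compact_cube)

lemma finite_sum_norm_le_iff:
  "finite I \<Longrightarrow> cs_norm (direct_sum I A) x \<le> e \<longleftrightarrow> 0 \<le> e \<and> (\<forall>i\<in>I. cs_norm (A i) (x i) \<le> e)"
  by (rule direct_sum_norm_le_iff) auto

lemma eval_hom:
  assumes "h \<in> cstar_hom A (cont_alg X B)" "p \<in> topspace X" "cstar_algebra B"
  shows "(\<lambda>x. h x p) \<in> cstar_hom A B"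
proof (rule cstar_homI)
  fix x assume x: "x \<in> cs_carrier A"
  have "continuous_map X (cs_topology B) (h x)" using cstar_homD(1)[OF assms(1) x] by simp
  then show "h x p \<in> cs_carrier B" by (rule cstar_algebra.continuous_mapD(1)[OF assms(3) _ assms(2)])
  fix u y assume "y \<in> cs_carrier A"
  then show "h (cs_apply u A x y) p = cs_apply u B (h x p) (h y p)"
    using cstar_homD(2)[OF assms(1) x] assms(2) by simp
qed

text \<open>Evaluation at a point turns the attaching map into a homomorphism into a finite-dimensional
algebra.\<close>

lemma attach_contractive:
  assumes S: "cstar_algebra (skeleton N k)" and N: "attached_upto N (Suc k)"
    and x: "x \<in> cs_carrier (skeleton N k)" and p: "p \<in> topspace (cube_boundary (Suc k))"
  shows "cs_norm (nc_fibre N (Suc k)) (nc_attach N (Suc k) x p) \<le> cs_norm (skeleton N k) x"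
proof -
  have "(\<lambda>x. nc_attach N (Suc k) x p) \<in> cstar_hom (skeleton N k) (nc_fibre N (Suc k))"
    by (rule eval_hom[OF attached_uptoD(2)[OF N lessI] p fibre_cstar[OF N order_refl]])
  from hom_contractive[OF S attached_uptoD(1)[OF N order_refl] this x] show ?thesis .
qed

lemma attach_contractive_diff:
  assumes S: "cstar_algebra (skeleton N k)" and N: "attached_upto N (Suc k)"
    and x: "x \<in> cs_carrier (skeleton N k)" "y \<in> cs_carrier (skeleton N k)"
    and p: "p \<in> topspace (cube_boundary (Suc k))"
  shows "cs_norm (nc_fibre N (Suc k)) (cs_diff (nc_fibre N (Suc k)) (nc_attach N (Suc k) x p)
    (nc_attach N (Suc k) y p)) \<le> cs_norm (skeleton N k) (cs_diff (skeleton N k) x y)"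
proof -
  have h: "nc_attach N (Suc k) \<in> cstar_hom (skeleton N k) (cont_alg (cube_boundary (Suc k)) (nc_fibre N (Suc k)))"
    by (rule attached_uptoD(2)[OF N lessI])
  show ?thesis
    using attach_contractive[OF S N cstar_algebra.diff_closed[OF S x] p] hom_diff[OF S h x] p by simp
qed

text \<open>Closedness and completeness are proved together. A limit of elements of the next skeleton has the
right boundary values because the attaching map is contractive, and contractivity presupposes that
the previous skeleton is complete.\<close>

lemma skeleton_closed_and_cstar:
  assumes "attached_upto N K"
  shows "(\<forall>x\<in>cs_carrier (direct_sum {..K} (cell_alg N)).
      (\<forall>e>0. \<exists>y\<in>cs_carrier (skeleton N K). cs_norm (direct_sum {..K} (cell_alg N)) (cs_diff (direct_sum {..K} (cell_alg N)) y x) \<le> e)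
      \<longrightarrow> x \<in> cs_carrier (skeleton N K)) \<and> cstar_algebra (skeleton N K)"
  using assms
proof (induction K)
  case 0
  then show ?case by (auto intro!: cstar_direct_sum cell_cstar[of N 0])
next
  case (Suc K)
  let ?D = "direct_sum {..Suc K} (cell_alg N)" and ?S = "skeleton N (Suc K)"
  let ?F = "nc_fibre N (Suc K)" and ?h = "nc_attach N (Suc K)"
  have N: "attached_upto N K" using Suc.prems by (auto intro: attached_upto_mono)
  note IH = Suc.IH[OF N]
  interpret S: cstar_algebra "skeleton N K" using IH by blast
  have D: "cstar_algebra ?D"
    using Suc.prems by (intro cstar_direct_sum cell_cstar) auto
  interpret D: cstar_algebra ?D by (rule D)
  interpret F: cstar_algebra ?F using Suc.prems by (rule fibre_cstar) simp
  have h: "?h \<in> cstar_hom (skeleton N K) (cont_alg (cube_boundary (Suc K)) ?F)"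
    by (rule attached_uptoD(2)[OF Suc.prems lessI])
  have mem: "x \<in> cs_carrier ?S \<longleftrightarrow> x \<in> cs_carrier ?D \<and> restrict x {..K} \<in> cs_carrier (skeleton N K) \<and>
      boundary_restrict (Suc K) (x (Suc K)) = ?h (restrict x {..K})" for x
    by (rule skeleton_Suc_carrier)
  have cell: "x (Suc K) p \<in> cs_carrier ?F" if "x \<in> cs_carrier ?D" "p \<in> topspace (cube (Suc K))" for x p
    using PiE_mem[of x "{..Suc K}" "\<lambda>k. cs_carrier (cell_alg N k)" "Suc K"] that
    by (intro F.cont_alg_apply[of _ "cube (Suc K)"]) (simp_all add: cell_alg_def)
  have closed: "x \<in> cs_carrier ?S"
    if x: "x \<in> cs_carrier ?D" and lim: "\<And>e. 0 < e \<Longrightarrow> \<exists>y\<in>cs_carrier ?S. cs_norm ?D (cs_diff ?D y x) \<le> e" for x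
  proof -
    let ?x = "restrict x {..K}"
    have near: "cs_norm (direct_sum {..K} (cell_alg N)) (cs_diff (direct_sum {..K} (cell_alg N)) (restrict y {..K}) ?x) \<le> e"
      "p \<in> topspace (cube (Suc K)) \<Longrightarrow> cs_norm ?F (cs_diff ?F (y (Suc K) p) (x (Suc K) p)) \<le> e"
      if y: "y \<in> cs_carrier ?S" "cs_norm ?D (cs_diff ?D y x) \<le> e" for y e p
    proof -
      have *: "0 \<le> e" "\<And>k. k \<le> Suc K \<Longrightarrow> cs_norm (cell_alg N k) (cs_diff (cell_alg N k) (y k) (x k)) \<le> e"
        using y(2) by (auto simp: finite_sum_norm_le_iff)
      then show "cs_norm (direct_sum {..K} (cell_alg N)) (cs_diff (direct_sum {..K} (cell_alg N)) (restrict y {..K}) ?x) \<le> e"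
        by (simp add: finite_sum_norm_le_iff)
      assume p: "p \<in> topspace (cube (Suc K))"
      have "cs_diff (cell_alg N (Suc K)) (y (Suc K)) (x (Suc K)) \<in> cs_carrier (cell_alg N (Suc K))"
        using x y(1) Suc.prems by (intro cstar_algebra.diff_closed[OF cell_cstar]) (auto simp: mem)
      from F.cont_alg_norm_upper[OF compact_cube this[unfolded cell_alg_def] p] *(2)[of "Suc K"] p
      show "cs_norm ?F (cs_diff ?F (y (Suc K) p) (x (Suc K) p)) \<le> e"
        by (simp add: cell_alg_def)
    qed
    have xK: "?x \<in> cs_carrier (skeleton N K)"
    proof -
      have "?x \<in> cs_carrier (direct_sum {..K} (cell_alg N))" using x by auto
      moreover have "\<exists>y\<in>cs_carrier (skeleton N K). cs_norm (direct_sum {..K} (cell_alg N))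
          (cs_diff (direct_sum {..K} (cell_alg N)) y ?x) \<le> e" if e: "0 < e" for e
        using lim[OF e] near(1) mem by blast
      ultimately show ?thesis using IH by blast
    qed
    have "boundary_restrict (Suc K) (x (Suc K)) p = ?h ?x p" for p
    proof (cases "p \<in> topspace (cube_boundary (Suc K))")
      case True
      note p = boundary_subset[OF True]
      have hp: "?h y p \<in> cs_carrier ?F" if "y \<in> cs_carrier (skeleton N K)" for y
        by (rule F.cont_alg_apply[OF cstar_homD(1)[OF h that] True])
      have "cs_norm ?F (cs_diff ?F (x (Suc K) p) (?h ?x p)) \<le> 0 + e" if e: "0 < e" for e
      proof -
        have "0 < e/2" using e by simp
        from lim[OF this] obtain y where y: "y \<in> cs_carrier ?S" "cs_norm ?D (cs_diff ?D y x) \<le> e/2" by blast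
        have yK: "restrict y {..K} \<in> cs_carrier (skeleton N K)" and
          yb: "boundary_restrict (Suc K) (y (Suc K)) = ?h (restrict y {..K})" and yD: "y \<in> cs_carrier ?D"
          using y(1) by (simp_all only: mem)
        have yp: "y (Suc K) p = ?h (restrict y {..K}) p"
          using fun_cong[OF yb, of p] True by (simp add: boundary_restrict_def)
        have "cs_norm ?F (cs_diff ?F (?h (restrict y {..K}) p) (?h ?x p)) \<le> e/2"
          using attach_contractive_diff[OF S.cstar_algebra_axioms Suc.prems yK xK True] near(1)[OF y]
          by (simp add: finite_sum_norm_le_iff)
        then show ?thesis
          using F.norm_diff_triangle[OF cell[OF x p] cell[OF yD p] hp[OF xK]] near(2)[OF y p]
            F.norm_diff_commute[OF cell[OF x p] cell[OF yD p]] yp by simp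
      qed
      then have "cs_norm ?F (cs_diff ?F (x (Suc K) p) (?h ?x p)) \<le> 0"
        by (rule field_le_epsilon)
      then have "x (Suc K) p = ?h ?x p"
        using F.norm_diff_eq_zero[OF cell[OF x p] hp[OF xK]] F.norm_nonneg[OF F.diff_closed[OF cell[OF x p] hp[OF xK]]] by simp
      then show ?thesis using True by (simp add: boundary_restrict_def)
    next
      case False
      then show ?thesis
        using cstar_homD(1)[OF h xK] by (simp add: boundary_restrict_def extensional_def)
    qed
    then show ?thesis using x xK by (auto simp: mem)
  qed
  have "cstar_algebra (?D\<lparr>cs_carrier := cs_carrier ?S\<rparr>)"
  proof (rule cstar_subalgebra[OF D])
    show "cs_carrier ?S \<subseteq> cs_carrier ?D" by (auto simp: mem)
    have rz: "restrict (cs_zero ?D) {..K} = cs_zero (skeleton N K)" by (auto simp: fun_eq_iff)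
    have bz: "boundary_restrict (Suc K) (cs_zero ?D (Suc K)) = cs_zero (cont_alg (cube_boundary (Suc K)) ?F)"
      by (auto simp: boundary_restrict_def cell_alg_def fun_eq_iff dest: boundary_subset)
    have "?h (cs_zero (skeleton N K)) = cs_zero (cont_alg (cube_boundary (Suc K)) ?F)"
      by (rule hom_zero[OF S.cstar_algebra_axioms F.cstar_cont_alg[OF compact_cube_boundary] h])
    then show "cs_zero ?D \<in> cs_carrier ?S"
      unfolding mem rz bz using D.zero_closed S.zero_closed by simp
    fix u x y assume xy: "x \<in> cs_carrier ?S" "y \<in> cs_carrier ?S"
    have ro: "restrict (cs_apply u ?D x y) {..K} = cs_apply u (skeleton N K) (restrict x {..K}) (restrict y {..K})"
      by (auto simp: fun_eq_iff)
    have bo: "boundary_restrict (Suc K) (cs_apply u ?D x y (Suc K)) = cs_apply u (cont_alg (cube_boundary (Suc K)) ?F)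
        (boundary_restrict (Suc K) (x (Suc K))) (boundary_restrict (Suc K) (y (Suc K)))"
      by (auto simp: boundary_restrict_def cell_alg_def fun_eq_iff dest: boundary_subset)
    show "cs_apply u ?D x y \<in> cs_carrier ?S"
      unfolding mem ro bo using xy D.apply_closed[of x y u] S.apply_closed[of "restrict x {..K}" "restrict y {..K}" u]
        cstar_homD(2)[OF h, of "restrict x {..K}" "restrict y {..K}" u] unfolding mem by simp
  qed (use closed in blast)
  then have "cstar_algebra ?S" by (subst skeleton_eq)
  with closed show ?case by blast
qed

lemma cstar_skeleton: "attached_upto N K \<Longrightarrow> cstar_algebra (skeleton N K)"
  using skeleton_closed_and_cstar by blast

text \<open>The projections between skeleta are onto: the values on the boundary of the next cell are prescribed
and extend into the cell.\<close>

lemma skeleton_lift: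
  assumes N: "attached_upto N M" and K: "K \<le> M" and y: "y \<in> cs_carrier (skeleton N K)"
  obtains x where "x \<in> cs_carrier (skeleton N M)" "restrict x {..K} = y"
proof -
  have "\<exists>x \<in> cs_carrier (skeleton N L). restrict x {..K} = y" if "K \<le> L" "L \<le> M" for L
    using that
  proof (induction L rule: dec_induct)
    case base
    have "restrict y {..K} = y"
      using y by (auto simp: skeleton_carrier PiE_iff intro: extensional_restrict)
    with y show ?case by blast
  next
    case (step L)
    then obtain x where x: "x \<in> cs_carrier (skeleton N L)" "restrict x {..K} = y"
      using Suc_leD by blast
    interpret F: cstar_algebra "nc_fibre N (Suc L)" using N step.prems by (rule fibre_cstar)
    have "nc_attach N (Suc L) x \<in> cs_carrier (cont_alg (cube_boundary (Suc L)) (nc_fibre N (Suc L)))"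
      by (rule cstar_homD(1)[OF attached_uptoD(2)[OF N] x(1)]) (use step.prems in simp)
    then obtain g where g: "g \<in> cs_carrier (cell_alg N (Suc L))" "boundary_restrict (Suc L) g = nc_attach N (Suc L) x"
      using F.extend_from_cube_boundary[of "Suc L"] unfolding cell_alg_def by blast
    have xL: "x \<in> extensional {..L}" using x(1) by (simp add: skeleton_carrier PiE_iff)
    have r: "restrict (x(Suc L := g)) {..k} = restrict x {..k}" if "k \<le> L" for k
      using that by (auto simp: fun_eq_iff)
    have "x(Suc L := g) \<in> cs_carrier (skeleton N (Suc L))"
      using x(1) g xL unfolding skeleton_carrier[of _ N "Suc L"]
      by (auto simp: r less_Suc_eq extensional_restrict PiE_iff extensional_def skeleton_carrier[of x])
    moreover have "restrict (x(Suc L := g)) {..K} = y" using r[OF step.hyps(1)] x(2) by simp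
    ultimately show ?case by blast
  qed
  from this[OF K order_refl] show ?thesis using that by blast
qed




section \<open>The conical telescope as a complex\<close>

text \<open>The index \<open>1\<close> of the first algebra should not turn into \<open>Suc 0\<close>.\<close>

declare One_nat_def [simp del]

lemma restrict_cube [simp]: "q \<in> topspace (cube k) \<Longrightarrow> restrict q {..<k} = q"
  by (auto simp: topspace_cube PiE_iff extensional_restrict)

lemma cell_alg_simps [simp]:
  "f \<in> cs_carrier (cell_alg N k) \<longleftrightarrow>
     f \<in> extensional (topspace (cube k)) \<and> continuous_map (cube k) (cs_topology (nc_fibre N k)) f"
  "cs_zero (cell_alg N k) = (\<lambda>p\<in>topspace (cube k). cs_zero (nc_fibre N k))"
  "cs_apply u (cell_alg N k) f g = (\<lambda>p\<in>topspace (cube k). cs_apply u (nc_fibre N k) (f p) (g p))"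
  "cs_diff (cell_alg N k) f g = (\<lambda>p\<in>topspace (cube k). cs_diff (nc_fibre N k) (f p) (g p))"
  by (simp_all add: cell_alg_def)

lemma skeleton_cell:
  "x \<in> cs_carrier (skeleton N K) \<Longrightarrow> k \<le> K \<Longrightarrow> x k \<in> cs_carrier (cell_alg N k)"
  using PiE_mem[of x "{..K}" "\<lambda>k. cs_carrier (cell_alg N k)" k] by (simp add: skeleton_carrier)

lemma skeleton_ext: "x \<in> cs_carrier (skeleton N K) \<Longrightarrow> x \<in> extensional {..K}"
  by (simp add: skeleton_carrier PiE_iff)

lemma skeleton_boundary:
  assumes "x \<in> cs_carrier (skeleton N K)" "k < K" "p \<in> topspace (cube_boundary (Suc k))"
  shows "x (Suc k) p = nc_attach N (Suc k) (restrict x {..k}) p"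
proof -
  have "boundary_restrict (Suc k) (x (Suc k)) = nc_attach N (Suc k) (restrict x {..k})"
    using assms by (simp add: skeleton_carrier)
  from fun_cong[OF this, of p] show ?thesis using assms(3) by (simp add: boundary_restrict_def)
qed

lemma continuous_map_full_direct_sum:
  assumes I: "finite I" and A: "\<And>i. i \<in> I \<Longrightarrow> cstar_algebra (A i)"
  shows "continuous_map X (cs_topology (direct_sum I A)) f \<longleftrightarrow>
    f \<in> topspace X \<rightarrow> (\<Pi>\<^sub>E i\<in>I. cs_carrier (A i)) \<and> (\<forall>i\<in>I. continuous_map X (cs_topology (A i)) (\<lambda>x. f x i))"
proof -
  have eq: "(direct_sum I A)\<lparr>cs_carrier := cs_carrier (direct_sum I A)\<rparr> = direct_sum I A" by simp
  show ?thesis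
    using continuous_map_direct_sum[where A=A and C="cs_carrier (direct_sum I A)" and X=X and f=f, OF I A order_refl]
      cstar_direct_sum[where A=A, OF I A] unfolding eq by simp
qed

lemma continuous_map_skeleton:
  assumes N: "attached_upto N K"
  shows "continuous_map X (cs_topology (skeleton N K)) f \<longleftrightarrow> f \<in> topspace X \<rightarrow> cs_carrier (skeleton N K) \<and>
    (\<forall>k\<le>K. continuous_map X (cs_topology (cell_alg N k)) (\<lambda>x. f x k))"
proof -
  have c: "cstar_algebra ((direct_sum {..K} (cell_alg N))\<lparr>cs_carrier := cs_carrier (skeleton N K)\<rparr>)"
    using cstar_skeleton[OF N] by (simp add: skeleton_eq[symmetric])
  have "cs_carrier (skeleton N K) \<subseteq> cs_carrier (direct_sum {..K} (cell_alg N))"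
    by (auto simp: skeleton_carrier simp del: cell_alg_simps)
  from continuous_map_direct_sum[OF finite_atMost cell_cstar[OF N] this c, of X f] show ?thesis
    by (simp add: skeleton_eq[symmetric] Ball_def)
qed

text \<open>\<open>\<beta> j\<close> stands for the composite morphism from \<open>A 1\<close> to \<open>A j\<close>. Only these composites enter the
telescope, so \<open>L\<close> can be any finite index set that does not contain \<open>1\<close>.\<close>

locale telescope =
  fixes A :: "nat \<Rightarrow> 'f nccw" and L :: "nat set" and \<beta> :: "nat \<Rightarrow> 'f tuple \<Rightarrow> 'f tuple"
  assumes finite_L: "finite L" and one_notin: "1 \<notin> L"
    and complex: "j \<in> insert 1 L \<Longrightarrow> nccw_complex (A j)"
    and hom: "j \<in> L \<Longrightarrow> \<beta> j \<in> cstar_hom (nccw_alg (A 1)) (nccw_alg (A j))"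
    and ideal: "j \<in> L \<Longrightarrow> \<beta> j ` canonical_ideal (A 1) k \<subseteq> canonical_ideal (A j) k"
begin

abbreviation m :: "nat \<Rightarrow> nat" where "m j \<equiv> nc_dim (A j)"

definition top_dim :: nat where
  "top_dim = Max (insert (m 1) ((\<lambda>j. 1 + m j) ` L))"

text \<open>The indices of the algebras that contribute to the cells of dimension \<open>k\<close>; for \<open>j \<in> L\<close> these cells
are \<open>[0,1]\<close> times the \<open>(k - 1)\<close>-cells of \<open>A j\<close>.\<close>

definition cells :: "nat \<Rightarrow> nat set" where
  "cells k = {j \<in> insert 1 L. if j = 1 then k \<le> m 1 else 1 \<le> k \<and> k \<le> 1 + m j}"

definition summand :: "nat \<Rightarrow> nat \<Rightarrow> 'f cstar" where
  "summand k j = nc_fibre (A j) (if j = 1 then k else k - 1)"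

text \<open>The two ways to read off elements of the given complexes from a tuple on the cells of the telescope:
\<open>base\<close> is the component in \<open>A 1\<close>, and \<open>slice j K x t\<close> is the value at \<open>t\<close> of the path in \<open>A j\<close>,
each up to dimension \<open>K\<close>.\<close>

definition base :: "nat \<Rightarrow> (nat \<Rightarrow> 'f) tuple \<Rightarrow> 'f tuple" where
  "base K x = (\<lambda>k\<in>{..K}. \<lambda>p\<in>topspace (cube k). x k p 1)"

definition slice :: "nat \<Rightarrow> nat \<Rightarrow> (nat \<Rightarrow> 'f) tuple \<Rightarrow> real \<Rightarrow> 'f tuple" where
  "slice j K x t = (\<lambda>k\<in>{..K}. \<lambda>q\<in>topspace (cube k). x (Suc k) (q(k := t)) j)"

text \<open>The \<open>k\<close>-th component of \<open>\<beta> j\<close>, as a map on the \<open>k\<close>-skeleton of \<open>A 1\<close>. For \<open>k\<close> up to the dimension of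
\<open>A j\<close>, all lifts give the same value by \<open>hom_determined\<close>. The minimum accounts for \<open>k\<close> beyond the dimension of \<open>A 1\<close>, where
the skeleton is the whole algebra.\<close>

definition end_value :: "nat \<Rightarrow> nat \<Rightarrow> 'f tuple \<Rightarrow> point \<Rightarrow> 'f" where
  "end_value j k z = \<beta> j (SOME a. a \<in> cs_carrier (nccw_alg (A 1)) \<and> restrict a {..min k (m 1)} = z) k"

text \<open>The attaching map in dimension \<open>K + 1\<close>. In the last case \<open>p\<close> lies on the side of the cylinder, so
\<open>K\<close> is positive and \<open>K - 1\<close> is the dimension of the skeleton on which the attaching map of \<open>A j\<close>
is defined.\<close>

definition attach_map :: "nat \<Rightarrow> (nat \<Rightarrow> 'f) tuple \<Rightarrow> point \<Rightarrow> nat \<Rightarrow> 'f" where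
  "attach_map K y = (\<lambda>p\<in>topspace (cube_boundary (Suc K)). \<lambda>j\<in>cells (Suc K).
     if j = 1 then nc_attach (A 1) (Suc K) (base K y) p
     else if p K = 0 then cs_zero (nc_fibre (A j) K)
     else if p K = 1 then end_value j K (base (min K (m 1)) y) (restrict p {..<K})
     else nc_attach (A j) K (slice j (K - 1) y (p K)) (restrict p {..<K}))"

definition tele :: "(nat \<Rightarrow> 'f) nccw" where
  "tele = \<lparr>nc_dim = top_dim, nc_fibre = (\<lambda>k. direct_sum (cells k) (summand k)),
     nc_attach = (\<lambda>k. attach_map (k - 1))\<rparr>"

lemma tele_simps [simp]:
  "nc_dim tele = top_dim" "nc_fibre tele k = direct_sum (cells k) (summand k)"
  "nc_attach tele (Suc k) = attach_map k"
  by (simp_all add: tele_def)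

lemma attached: "j \<in> insert 1 L \<Longrightarrow> k \<le> m j \<Longrightarrow> attached_upto (A j) k"
  using attached_upto_mono nccw_complex_attached complex by blast

lemma finite_cells [simp]: "finite (cells k)"
  using finite_L by (simp add: cells_def)

lemma base_cells [simp]: "1 \<in> cells k \<longleftrightarrow> k \<le> m 1"
  by (simp add: cells_def)

lemma slice_cells: "j \<in> L \<Longrightarrow> j \<in> cells (Suc k) \<longleftrightarrow> k \<le> m j"
  using one_notin by (auto simp: cells_def)

lemma cells_cases:
  assumes "j \<in> cells k"
  obtains "j = 1" "k \<le> m 1" | k' where "j \<in> L" "j \<noteq> 1" "k = Suc k'" "k' \<le> m j"
  using assms by (cases k) (auto simp: cells_def split: if_splits)

lemma summand_simps [simp]:
  "summand k 1 = nc_fibre (A 1) k" "j \<in> L \<Longrightarrow> summand (Suc k) j = nc_fibre (A j) k"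
  using one_notin by (auto simp: summand_def)

lemma summand_finite_dim: "j \<in> cells k \<Longrightarrow> finite_dim_cstar (summand k j)"
  by (erule cells_cases) (auto intro: attached_uptoD(1)[OF attached[OF _ order_refl]])

lemma summand_cstar: "j \<in> cells k \<Longrightarrow> cstar_algebra (summand k j)"
  using summand_finite_dim by (simp add: finite_dim_cstar_def)

lemma summand_fibre_cstar: "j \<in> insert 1 L \<Longrightarrow> k \<le> m j \<Longrightarrow> cstar_algebra (nc_fibre (A j) k)"
  by (rule fibre_cstar[OF attached]) auto

lemma nccw_alg_cstar: "j \<in> insert 1 L \<Longrightarrow> cstar_algebra (nccw_alg (A j))"
  unfolding nccw_alg_def by (intro cstar_skeleton attached) auto

section \<open>The maps at the end of the cones on skeleta\<close>

text \<open>The difference of \<open>a\<close> and \<open>b\<close> lies in the canonical ideal \<open>I\<^bsub>k+1\<^esub>\<close>, which \<open>\<beta> j\<close> maps into the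
corresponding ideal of \<open>A j\<close>.\<close>

lemma hom_determined:
  assumes j: "j \<in> L" and k: "k \<le> m j"
    and a: "a \<in> cs_carrier (nccw_alg (A 1))" "b \<in> cs_carrier (nccw_alg (A 1))"
    and eq: "restrict a {..min k (m 1)} = restrict b {..min k (m 1)}"
  shows "\<beta> j a k = \<beta> j b k"
proof -
  let ?D = "nccw_alg (A 1)" and ?E = "nccw_alg (A j)"
  interpret D: cstar_algebra ?D by (rule nccw_alg_cstar) simp
  interpret C: cstar_algebra "cell_alg (A j) k" by (rule cell_cstar[OF attached[of j k]]) (use j k in auto)
  have ba: "\<beta> j a \<in> cs_carrier ?E" "\<beta> j b \<in> cs_carrier ?E" using cstar_homD(1)[OF hom[OF j]] a by auto
  have same: "cs_diff ?D a b i = cs_zero ?D i" if "i < Suc k" for i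
  proof (cases "i \<le> m 1")
    case True
    interpret Ci: cstar_algebra "cell_alg (A 1) i" by (rule cell_cstar[OF attached[of 1 i]]) (use True in auto)
    have "a i = b i" using fun_cong[OF eq, of i] True that by simp
    moreover have "b i \<in> cs_carrier (cell_alg (A 1) i)" using a(2) True unfolding nccw_alg_def by (rule skeleton_cell)
    ultimately show ?thesis using True Ci.diff_self[of "b i"] by (simp add: nccw_alg_def del: cell_alg_simps)
  next
    case False
    then show ?thesis by (simp add: nccw_alg_def)
  qed
  have "cs_diff ?D a b \<in> canonical_ideal (A 1) (Suc k)"
    unfolding canonical_ideal_def using D.diff_closed[OF a] same by (auto simp: fun_eq_iff)
  then have "\<beta> j (cs_diff ?D a b) \<in> canonical_ideal (A j) (Suc k)"
    using ideal[OF j] by blast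
  then have "restrict (cs_diff ?E (\<beta> j a) (\<beta> j b)) {..<Suc k} = restrict (cs_zero ?E) {..<Suc k}"
    unfolding canonical_ideal_def using hom_diff[OF D.cstar_algebra_axioms hom[OF j] a] by simp
  from fun_cong[OF this, of k] have "cs_diff (cell_alg (A j) k) (\<beta> j a k) (\<beta> j b k) = cs_zero (cell_alg (A j) k)"
    using k by (simp add: nccw_alg_def del: cell_alg_simps)
  then show ?thesis
    using C.diff_eq_zero skeleton_cell[OF ba(1)[unfolded nccw_alg_def] k] skeleton_cell[OF ba(2)[unfolded nccw_alg_def] k]
    by blast
qed

lemma end_value_eq:
  assumes j: "j \<in> L" and k: "k \<le> m j" and a: "a \<in> cs_carrier (nccw_alg (A 1))"
  shows "end_value j k (restrict a {..min k (m 1)}) = \<beta> j a k"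
proof -
  let ?P = "\<lambda>b. b \<in> cs_carrier (nccw_alg (A 1)) \<and> restrict b {..min k (m 1)} = restrict a {..min k (m 1)}"
  have "?P (SOME b. ?P b)" by (rule someI[of ?P a]) (use a in simp)
  then show ?thesis unfolding end_value_def using hom_determined[OF j k _ a] by blast
qed

lemma lift_base:
  assumes "z \<in> cs_carrier (skeleton (A 1) (min k (m 1)))"
  obtains a where "a \<in> cs_carrier (nccw_alg (A 1))" "restrict a {..min k (m 1)} = z"
  using skeleton_lift[OF attached[of 1 "m 1"] _ assms] unfolding nccw_alg_def by auto

text \<open>Lifts can be chosen compatibly with the operations, since any choice of lift will do.\<close>

lemma end_value_hom:
  assumes j: "j \<in> L" and k: "k \<le> m j"
  shows "end_value j k \<in> cstar_hom (skeleton (A 1) (min k (m 1))) (cell_alg (A j) k)"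
proof (rule cstar_homI)
  fix z assume z: "z \<in> cs_carrier (skeleton (A 1) (min k (m 1)))"
  then obtain a where a: "a \<in> cs_carrier (nccw_alg (A 1))" "restrict a {..min k (m 1)} = z" by (rule lift_base)
  have "\<beta> j a \<in> cs_carrier (skeleton (A j) (m j))"
    using cstar_homD(1)[OF hom[OF j] a(1)] by (simp add: nccw_alg_def)
  from skeleton_cell[OF this k] show "end_value j k z \<in> cs_carrier (cell_alg (A j) k)"
    using end_value_eq[OF j k a(1)] a(2) by simp
  fix u z' assume "z' \<in> cs_carrier (skeleton (A 1) (min k (m 1)))"
  then obtain a' where a': "a' \<in> cs_carrier (nccw_alg (A 1))" "restrict a' {..min k (m 1)} = z'" by (rule lift_base)
  have c: "cs_apply u (nccw_alg (A 1)) a a' \<in> cs_carrier (nccw_alg (A 1))"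
    using cstar_algebra.apply_closed[OF nccw_alg_cstar] a a' by simp
  have "restrict (cs_apply u (nccw_alg (A 1)) a a') {..min k (m 1)} = cs_apply u (skeleton (A 1) (min k (m 1))) z z'"
    unfolding a(2)[symmetric] a'(2)[symmetric] by (auto simp: nccw_alg_def fun_eq_iff)
  then have "end_value j k (cs_apply u (skeleton (A 1) (min k (m 1))) z z') = \<beta> j (cs_apply u (nccw_alg (A 1)) a a') k"
    using end_value_eq[OF j k c] by simp
  also have "\<dots> = cs_apply u (nccw_alg (A j)) (\<beta> j a) (\<beta> j a') k"
    using cstar_homD(2)[OF hom[OF j] a(1) a'(1)] by simp
  also have "\<dots> = cs_apply u (cell_alg (A j) k) (\<beta> j a k) (\<beta> j a' k)"
    using k by (simp add: nccw_alg_def)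
  finally show "end_value j k (cs_apply u (skeleton (A 1) (min k (m 1))) z z')
      = cs_apply u (cell_alg (A j) k) (end_value j k z) (end_value j k z')"
    using end_value_eq[OF j k a(1)] end_value_eq[OF j k a'(1)] a(2) a'(2) by simp
qed

section \<open>Elements of the skeleta\<close>

lemma restrict_base [simp]: "k \<le> K \<Longrightarrow> restrict (base K x) {..k} = base k x"
  by (auto simp: base_def fun_eq_iff)

lemma base_restrict [simp]: "K \<le> k \<Longrightarrow> base K (restrict x {..k}) = base K x"
  by (auto simp: base_def fun_eq_iff)

lemma restrict_slice [simp]: "k \<le> K \<Longrightarrow> restrict (slice j K x t) {..k} = slice j k x t"
  by (auto simp: slice_def fun_eq_iff)

lemma slice_restrict [simp]: "Suc K \<le> k \<Longrightarrow> slice j K (restrict x {..k}) t = slice j K x t"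
  by (auto simp: slice_def fun_eq_iff)

lemma cell_iff:
  "f \<in> cs_carrier (cell_alg tele k) \<longleftrightarrow> f \<in> extensional (topspace (cube k)) \<and>
     (\<forall>p\<in>topspace (cube k). f p \<in> (\<Pi>\<^sub>E j\<in>cells k. cs_carrier (summand k j))) \<and>
     (\<forall>j\<in>cells k. continuous_map (cube k) (cs_topology (summand k j)) (\<lambda>p. f p j))"
  using continuous_map_full_direct_sum[OF finite_cells summand_cstar, where X="cube k" and f=f and k2=k]
  by auto

lemma skeleton_component:
  assumes "x \<in> cs_carrier (skeleton tele K)" "k \<le> K" "j \<in> cells k"
  shows "continuous_map (cube k) (cs_topology (summand k j)) (\<lambda>p. x k p j)"
  using skeleton_cell[OF assms(1,2)] assms(3) unfolding cell_iff by blast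

lemma base_cell:
  assumes "x \<in> cs_carrier (skeleton tele K)" "k \<le> K" "k \<le> m 1"
  shows "(\<lambda>p\<in>topspace (cube k). x k p 1) \<in> cs_carrier (cell_alg (A 1) k)"
  using skeleton_component[OF assms(1,2), of 1] assms(3) by (auto intro: continuous_map_eq)

text \<open>The summand of \<open>A 1\<close> sees only the attaching maps of \<open>A 1\<close>.\<close>

lemma base_in_skeleton:
  assumes x: "x \<in> cs_carrier (skeleton tele K)" and "k \<le> K" "k \<le> m 1"
  shows "base k x \<in> cs_carrier (skeleton (A 1) k)"
  using assms(2,3)
proof (induction k)
  case 0
  then show ?case using base_cell[OF x, of 0] by (auto simp: base_def simp del: cell_alg_simps)
next
  case (Suc k)
  have IH: "base k x \<in> cs_carrier (skeleton (A 1) k)" using Suc by simp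
  have ext: "nc_attach (A 1) (Suc k) (base k x) \<in> extensional (topspace (cube_boundary (Suc k)))"
    using cstar_homD(1)[OF attached_uptoD(2)[OF attached[of 1 "Suc k"] lessI] IH] Suc.prems by simp
  have "boundary_restrict (Suc k) (base (Suc k) x (Suc k)) p = nc_attach (A 1) (Suc k) (base k x) p" for p
  proof (cases "p \<in> topspace (cube_boundary (Suc k))")
    case True
    have "x (Suc k) p 1 = attach_map k (restrict x {..k}) p 1"
      using skeleton_boundary[OF x _ True] Suc.prems by simp
    also have "\<dots> = nc_attach (A 1) (Suc k) (base k x) p"
      using True Suc.prems by (simp add: attach_map_def)
    finally show ?thesis using True boundary_subset[OF True] by (simp add: boundary_restrict_def base_def)
  next
    case False
    then show ?thesis using ext by (simp add: boundary_restrict_def extensional_def)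
  qed
  moreover have "base (Suc k) x \<in> cs_carrier (direct_sum {..Suc k} (cell_alg (A 1)))"
    using base_cell[OF x] Suc.prems by (auto simp: base_def simp del: cell_alg_simps)
  ultimately show ?case unfolding skeleton_Suc_carrier using IH by auto
qed

lemma attach_map_slice:
  assumes "j \<in> L" "K \<le> m j" "p \<in> topspace (cube_boundary (Suc K))"
  shows "attach_map K y p j =
     (if p K = 0 then cs_zero (nc_fibre (A j) K)
     else if p K = 1 then end_value j K (base (min K (m 1)) y) (restrict p {..<K})
     else nc_attach (A j) K (slice j (K - 1) y (p K)) (restrict p {..<K}))"
proof -
  have "j \<noteq> 1" using assms(1) one_notin by auto
  then show ?thesis using assms slice_cells[of j K] by (simp add: attach_map_def)
qed

lemma join_boundary:
  assumes "q \<in> topspace (cube k)" "t = 0 \<or> t = 1"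
  shows "q(k := t) \<in> topspace (cube_boundary (Suc k))"
  using assms cube_join[OF assms(1), of t] by (auto simp: cube_boundary_Suc)

text \<open>In this lemma and the next, every point of a cell of \<open>A j\<close> occurs as a point of the corresponding
end of a cylinder, and there the value is prescribed by the attaching map.\<close>

lemma slice_zero:
  assumes x: "x \<in> cs_carrier (skeleton tele K)" and j: "j \<in> L" and k: "Suc k \<le> K" "k \<le> m j"
  shows "slice j k x 0 = cs_zero (skeleton (A j) k)"
proof -
  have "x (Suc i) (q(i := 0)) j = cs_zero (nc_fibre (A j) i)" if i: "i \<le> k" and q: "q \<in> topspace (cube i)" for i q
  proof -
    note b = join_boundary[OF q, of 0, simplified]
    have "x (Suc i) (q(i := 0)) j = attach_map i (restrict x {..i}) (q(i := 0)) j"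
      using skeleton_boundary[OF x _ b] i k by simp
    then show ?thesis using attach_map_slice[OF j _ b] i k by simp
  qed
  then show ?thesis by (auto simp: slice_def fun_eq_iff)
qed

lemma slice_one:
  assumes x: "x \<in> cs_carrier (skeleton tele K)" and j: "j \<in> L" and k: "Suc k \<le> K" "k \<le> m j"
    and a: "a \<in> cs_carrier (nccw_alg (A 1))" "restrict a {..min k (m 1)} = base (min k (m 1)) x"
  shows "slice j k x 1 = restrict (\<beta> j a) {..k}"
proof -
  have ba: "\<beta> j a \<in> cs_carrier (skeleton (A j) (m j))"
    using cstar_homD(1)[OF hom[OF j] a(1)] by (simp add: nccw_alg_def)
  have "x (Suc i) (q(i := 1)) j = \<beta> j a i q" if i: "i \<le> k" and q: "q \<in> topspace (cube i)" for i q
  proof -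
    note b = join_boundary[OF q, of 1, simplified]
    have "x (Suc i) (q(i := 1)) j = attach_map i (restrict x {..i}) (q(i := 1)) j"
      using skeleton_boundary[OF x _ b] i k by simp
    also have "\<dots> = end_value j i (base (min i (m 1)) x) q"
      using attach_map_slice[OF j _ b] i k q by simp
    also have "base (min i (m 1)) x = restrict (restrict a {..min k (m 1)}) {..min i (m 1)}"
      unfolding a(2) using i by (subst restrict_base) auto
    also have "\<dots> = restrict a {..min i (m 1)}" using i by (intro restrict_atMost_restrict) auto
    also have "end_value j i (restrict a {..min i (m 1)}) = \<beta> j a i"
      using end_value_eq[OF j _ a(1), of i] i k by simp
    finally show ?thesis .
  qed
  moreover have "\<beta> j a i \<in> extensional (topspace (cube i))" if "i \<le> k" for i
    using skeleton_cell[OF ba, of i] that k by simp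
  ultimately show ?thesis
    by (auto simp: slice_def fun_eq_iff restrict_def extensional_def)
qed

text \<open>The side formula also holds on the edges, where the side meets the two ends. At \<open>t = 0\<close> both values
are \<open>0\<close>. At \<open>t = 1\<close> the slice is the lower part of \<open>\<beta> j a\<close> for a lift \<open>a\<close>, and \<open>\<beta> j a\<close> is an
element of \<open>A j\<close>, so its \<open>(k + 1)\<close>-th component has the boundary values given by that lower part.\<close>

lemma attach_map_side:
  assumes y: "y \<in> cs_carrier (skeleton tele (Suc k))" and j: "j \<in> L" and k: "Suc k \<le> m j"
    and p: "p \<in> topspace (cube_boundary (Suc (Suc k)))"
    and q: "restrict p {..<Suc k} \<in> topspace (cube_boundary (Suc k))"
  shows "attach_map (Suc k) y p j = nc_attach (A j) (Suc k) (slice j k y (p (Suc k))) (restrict p {..<Suc k})"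
proof -
  let ?q = "restrict p {..<Suc k}"
  have N: "attached_upto (A j) (Suc k)" using attached[of j] j k by simp
  note map = attach_map_slice[OF j k p, of y]
  consider "p (Suc k) = 0" | "p (Suc k) = 1" | "p (Suc k) \<noteq> 0" "p (Suc k) \<noteq> 1" by blast
  then show ?thesis
  proof cases
    case 1
    have F: "cstar_algebra (nc_fibre (A j) (Suc k))" using N by (rule fibre_cstar) simp
    have "nc_attach (A j) (Suc k) (cs_zero (skeleton (A j) k))
        = cs_zero (cont_alg (cube_boundary (Suc k)) (nc_fibre (A j) (Suc k)))"
      using attached_upto_mono[OF N]
      by (intro hom_zero[OF cstar_skeleton cstar_algebra.cstar_cont_alg[OF F] attached_uptoD(2)[OF N]]) auto
    moreover have "slice j k y 0 = cs_zero (skeleton (A j) k)"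
      using slice_zero[OF y j] k by simp
    ultimately show ?thesis using map 1 q by simp
  next
    case 2
    obtain a where a: "a \<in> cs_carrier (nccw_alg (A 1))" "restrict a {..min (Suc k) (m 1)} = base (min (Suc k) (m 1)) y"
      using lift_base[OF base_in_skeleton[OF y, of "min (Suc k) (m 1)"]] by auto
    have ba: "\<beta> j a \<in> cs_carrier (skeleton (A j) (m j))"
      using cstar_homD(1)[OF hom[OF j] a(1)] by (simp add: nccw_alg_def)
    have "restrict a {..min k (m 1)} = restrict (restrict a {..min (Suc k) (m 1)}) {..min k (m 1)}"
      by (intro restrict_atMost_restrict[symmetric]) auto
    also have "\<dots> = base (min k (m 1)) y" unfolding a(2) by (intro restrict_base) auto
    finally have "slice j k y 1 = restrict (\<beta> j a) {..k}"
      using slice_one[OF y j _ _ a(1), of k] k by simp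
    moreover have "end_value j (Suc k) (base (min (Suc k) (m 1)) y) = \<beta> j a (Suc k)"
      using end_value_eq[OF j k a(1)] a(2) by simp
    ultimately show ?thesis using map 2 skeleton_boundary[OF ba _ q] k by simp
  next
    case 3
    then show ?thesis using map by simp
  qed
qed

lemma continuous_slice_cell:
  assumes x: "x \<in> cs_carrier (skeleton tele K)" and j: "j \<in> L" and k: "Suc k \<le> K" "k \<le> m j"
  shows "continuous_map (top_of_set {0..1}) (cs_topology (cell_alg (A j) k))
    (\<lambda>t. \<lambda>q\<in>topspace (cube k). x (Suc k) (q(k := t)) j)"
proof -
  interpret F: cstar_algebra "nc_fibre (A j) k" using summand_fibre_cstar[of j k] j k by simp
  have "continuous_map (cube (Suc k)) (cs_topology (nc_fibre (A j) k)) (\<lambda>p. x (Suc k) p j)"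
    using skeleton_component[OF x k(1), of j] j k(2) slice_cells[OF j, of k] by simp
  from continuous_map_compose[OF continuous_map_cube_join this]
  have "continuous_map (prod_topology (top_of_set {0..1}) (cube k)) (cs_topology (nc_fibre (A j) k))
      (\<lambda>(t, q). x (Suc k) (q(k := t)) j)"
    by (simp add: o_def case_prod_unfold)
  from F.continuous_map_curry[OF compact_cube this] show ?thesis by (simp add: cell_alg_def)
qed

text \<open>By \<open>attach_map_side\<close>, the values of the slice on the boundary of a cell are the ones that the
attaching map of \<open>A j\<close> prescribes.\<close>

lemma slice_in_skeleton:
  assumes x: "x \<in> cs_carrier (skeleton tele K)" and j: "j \<in> L" and t: "t \<in> {0..1}"
    and "Suc k \<le> K" "k \<le> m j"
  shows "slice j k x t \<in> cs_carrier (skeleton (A j) k)"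
  using assms(4,5)
proof (induction k)
  have cell: "(\<lambda>q\<in>topspace (cube k). x (Suc k) (q(k := t)) j) \<in> cs_carrier (cell_alg (A j) k)"
    if "Suc k \<le> K" "k \<le> m j" for k
    by (rule cstar_algebra.continuous_mapD(1)[OF cell_cstar[OF attached[of j k] order_refl] continuous_slice_cell[OF x j that]])
      (use j that t in auto)
  {
    case 0
    then show ?case using cell[of 0] by (auto simp: slice_def simp del: cell_alg_simps)
  next
    case (Suc k)
    have IH: "slice j k x t \<in> cs_carrier (skeleton (A j) k)" using Suc by simp
    have ext: "nc_attach (A j) (Suc k) (slice j k x t) \<in> extensional (topspace (cube_boundary (Suc k)))"
      using cstar_homD(1)[OF attached_uptoD(2)[OF attached[of j "Suc k"] lessI] IH] Suc.prems j by simp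
    have "boundary_restrict (Suc k) (slice j (Suc k) x t (Suc k)) q = nc_attach (A j) (Suc k) (slice j k x t) q" for q
    proof (cases "q \<in> topspace (cube_boundary (Suc k))")
      case True
      note q = boundary_subset[OF True]
      have p: "q(Suc k := t) \<in> topspace (cube_boundary (Suc (Suc k)))"
        using cube_join[OF q t] True q by (simp add: cube_boundary_Suc[of _ "Suc k"])
      have "x (Suc (Suc k)) (q(Suc k := t)) j = attach_map (Suc k) (restrict x {..Suc k}) (q(Suc k := t)) j"
        using skeleton_boundary[OF x _ p] Suc.prems by simp
      also have "\<dots> = nc_attach (A j) (Suc k) (slice j k x t) q"
        using attach_map_side[OF skeleton_restrict[OF x] j _ p] Suc.prems q True by simp
      finally show ?thesis using True q by (simp add: boundary_restrict_def slice_def)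
    next
      case False
      then show ?thesis using ext by (simp add: boundary_restrict_def extensional_def)
    qed
    moreover have "slice j (Suc k) x t \<in> cs_carrier (direct_sum {..Suc k} (cell_alg (A j)))"
      using cell Suc.prems by (auto simp: slice_def simp del: cell_alg_simps)
    ultimately show ?case unfolding skeleton_Suc_carrier using IH by auto
  }
qed

lemma continuous_slice:
  assumes x: "x \<in> cs_carrier (skeleton tele K)" and j: "j \<in> L" and k: "Suc k \<le> K" "k \<le> m j"
  shows "continuous_map (top_of_set {0..1}) (cs_topology (skeleton (A j) k)) (slice j k x)"
proof -
  have N: "attached_upto (A j) k" using attached[of j k] j k by simp
  have "continuous_map (top_of_set {0..1}) (cs_topology (cell_alg (A j) i)) (\<lambda>t. slice j k x t i)" if "i \<le> k" for i
    using continuous_slice_cell[OF x j, of i] that k by (simp add: slice_def)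
  then show ?thesis
    unfolding continuous_map_skeleton[OF N] using slice_in_skeleton[OF x j _ k] by auto
qed

section \<open>The attaching maps\<close>

text \<open>Pasting over the two ends \<open>T 0\<close>, \<open>T 1\<close> and the side \<open>T 2\<close> of the cylinder, which are closed. On the
side, the path of slices is continuous and the attaching map is contractive.\<close>

lemma attach_map_component_continuous:
  assumes y: "y \<in> cs_carrier (skeleton tele K)" and j: "j \<in> L" and K: "K \<le> m j"
  shows "continuous_map (cube_boundary (Suc K)) (cs_topology (nc_fibre (A j) K)) (\<lambda>p. attach_map K y p j)"
proof -
  let ?X = "cube_boundary (Suc K)" and ?F = "nc_fibre (A j) K" and ?z = "base (min K (m 1)) y"
  interpret F: cstar_algebra ?F using summand_fibre_cstar[of j K] j K by simp
  have X_sub: "?X = subtopology (cube (Suc K)) (topspace ?X)" by (rule cube_boundary_eq)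
  have split: "continuous_map ?X (prod_topology (top_of_set {0..1}) (cube K)) (\<lambda>p. (p K, restrict p {..<K}))"
    by (subst X_sub) (rule continuous_map_from_subtopology[OF continuous_map_cube_split])
  have coord: "continuous_map ?X euclideanreal (\<lambda>p. p K)"
    by (subst X_sub) (rule continuous_map_from_subtopology[OF continuous_cube_coordinate[OF lessI]])
  have rest: "continuous_map ?X (cube K) (\<lambda>p. restrict p {..<K})"
    using continuous_map_compose[OF split continuous_map_snd] by (simp add: o_def)
  define T where "T = (\<lambda>i::nat. {p \<in> topspace ?X. (if i = 0 then p K = 0 else if i = 1 then p K = 1
      else restrict p {..<K} \<in> topspace (cube_boundary K))})"
  define f where "f = (\<lambda>i::nat. \<lambda>p. if i = 0 then cs_zero ?F else if i = 1 then end_value j K ?z (restrict p {..<K})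
      else nc_attach (A j) K (slice j (K - 1) y (p K)) (restrict p {..<K}))"
  have fT: "attach_map K y p j = f i p" if i: "i \<in> {0, 1, 2}" and pT: "p \<in> T i" for i p
  proof -
    have p: "p \<in> topspace ?X" using pT by (simp add: T_def)
    consider "i = 0" | "i = 1" | "i = 2" using i by blast
    then show ?thesis
    proof cases
      case 3
      then have q: "restrict p {..<K} \<in> topspace (cube_boundary K)" using pT by (simp add: T_def)
      then obtain k where k: "K = Suc k" by (cases K) (auto simp: topspace_cube_boundary)
      show ?thesis using attach_map_side[OF y[unfolded k] j _ p[unfolded k] q[unfolded k]] K by (simp add: k f_def 3)
    qed (use pT attach_map_slice[OF j K p, of y] in \<open>auto simp: T_def f_def\<close>)
  qed
  show ?thesis
  proof (rule pasting_lemma_closed[where I="{0, 1, 2}" and T=T and f=f])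
    show "closedin ?X (T i)" if "i \<in> {0, 1, 2}" for i
      using that closedin_continuous_map_preimage[OF coord, of "{0}"] closedin_continuous_map_preimage[OF coord, of "{1}"]
        closedin_continuous_map_preimage[OF rest closedin_cube_boundary] by (auto simp: T_def)
    show "continuous_map (subtopology ?X (T i)) (cs_topology ?F) (f i)" if i: "i \<in> {0, 1, 2}" for i
    proof -
      consider "i = 0" | "i = 1" | "i = 2" using i by blast
      then show ?thesis
      proof cases
        case 1
        then show ?thesis by (simp add: f_def continuous_map_const)
      next
        case 2
        have "end_value j K ?z \<in> cs_carrier (cell_alg (A j) K)"
          by (rule cstar_homD(1)[OF end_value_hom[OF j K] base_in_skeleton[OF y]]) auto
        then have "continuous_map (cube K) (cs_topology ?F) (end_value j K ?z)" by simp
        from continuous_map_from_subtopology[OF continuous_map_compose[OF rest this]] show ?thesis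
          by (simp add: 2 f_def o_def)
      next
        case 3
        show ?thesis
        proof (cases K)
          case 0
          \<comment> \<open>The boundary of the point \<open>[0,1]\<^sup>0\<close> is empty, so an interval has no side.\<close>
          have "T i = {}" by (auto simp: T_def 3 topspace_cube_boundary 0)
          then show ?thesis by simp
        next
          case (Suc k)
          have N: "attached_upto (A j) (Suc k)" using attached[of j] j K Suc by simp
          have S: "cstar_algebra (skeleton (A j) k)" using cstar_skeleton[OF attached_upto_mono[OF N, of k]] by simp
          have "continuous_map (prod_topology (top_of_set {0..1}) (cube_boundary (Suc k))) (cs_topology ?F)
              (\<lambda>(t, q). nc_attach (A j) (Suc k) (slice j k y t) q)"
          proof (rule F.continuous_map_eval[OF S, where f="slice j k y" and ev="nc_attach (A j) (Suc k)"])
            show "continuous_map (top_of_set {0..1}) (cs_topology (skeleton (A j) k)) (slice j k y)"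
              by (rule continuous_slice[OF y j]) (use Suc K in auto)
            show "continuous_map (cube_boundary (Suc k)) (cs_topology ?F) (nc_attach (A j) (Suc k) b)"
              if "b \<in> cs_carrier (skeleton (A j) k)" for b
              using cstar_homD(1)[OF attached_uptoD(2)[OF N lessI] that] Suc by simp
            show "cs_norm ?F (cs_diff ?F (nc_attach (A j) (Suc k) b q) (nc_attach (A j) (Suc k) c q))
                \<le> cs_norm (skeleton (A j) k) (cs_diff (skeleton (A j) k) b c)"
              if "b \<in> cs_carrier (skeleton (A j) k)" "c \<in> cs_carrier (skeleton (A j) k)"
                "q \<in> topspace (cube_boundary (Suc k))" for b c q
              using attach_contractive_diff[OF S N that] Suc by simp
          qed
          moreover have "continuous_map (subtopology ?X (T i)) (prod_topology (top_of_set {0..1}) (cube_boundary (Suc k)))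
              (\<lambda>p. (p K, restrict p {..<K}))"
          proof -
            have r: "continuous_map (subtopology ?X (T i)) (cube (Suc k)) (\<lambda>p. restrict p {..<K})"
              using continuous_map_from_subtopology[OF rest] Suc by simp
            have "continuous_map (subtopology ?X (T i)) (cube_boundary (Suc k)) (\<lambda>p. restrict p {..<K})"
              by (subst cube_boundary_eq) (use r in \<open>auto simp: continuous_map_in_subtopology T_def 3 Suc\<close>)
            moreover have "continuous_map (subtopology ?X (T i)) (top_of_set {0..1}) (\<lambda>p. p K)"
              using continuous_map_from_subtopology[OF continuous_map_compose[OF split continuous_map_fst]]
              by (simp add: o_def)
            ultimately show ?thesis by (simp add: continuous_map_pairwise o_def)
          qed
          ultimately have "continuous_map (subtopology ?X (T i)) (cs_topology ?F)
              ((\<lambda>(t, q). nc_attach (A j) (Suc k) (slice j k y t) q) \<circ> (\<lambda>p. (p K, restrict p {..<K})))"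
            by (rule continuous_map_compose[rotated])
          then show ?thesis by (simp add: f_def 3 Suc o_def)
        qed
      qed
    qed
    show "f i p = f i' p" if "i \<in> {0, 1, 2}" "i' \<in> {0, 1, 2}" "p \<in> topspace ?X \<inter> T i \<inter> T i'" for i i' p
      using fT[of i p] fT[of i' p] that by simp
    show "\<exists>i. i \<in> {0, 1, 2} \<and> p \<in> T i \<and> attach_map K y p j = f i p" if p: "p \<in> topspace ?X" for p
    proof -
      have "p K = 0 \<or> p K = 1 \<or> restrict p {..<K} \<in> topspace (cube_boundary K)"
        using p by (simp add: cube_boundary_Suc)
      then have "p \<in> T 0 \<or> p \<in> T 1 \<or> p \<in> T 2" using p by (simp add: T_def)
      then show ?thesis using fT by blast
    qed
  qed simp
qed

lemma attach_map_closed: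
  assumes y: "y \<in> cs_carrier (skeleton tele K)"
  shows "attach_map K y \<in> cs_carrier (cont_alg (cube_boundary (Suc K)) (nc_fibre tele (Suc K)))"
proof -
  let ?X = "cube_boundary (Suc K)"
  have comp: "continuous_map ?X (cs_topology (summand (Suc K) j)) (\<lambda>p. attach_map K y p j)" if j: "j \<in> cells (Suc K)" for j
    using j
  proof (cases rule: cells_cases)
    case 1
    have "nc_attach (A 1) (Suc K) (base K y) \<in> cs_carrier (cont_alg ?X (nc_fibre (A 1) (Suc K)))"
      using 1 by (intro cstar_homD(1)[OF attached_uptoD(2)[OF attached[of 1 "Suc K"]] base_in_skeleton[OF y]]) auto
    then have "continuous_map ?X (cs_topology (summand (Suc K) j)) (nc_attach (A 1) (Suc K) (base K y))"
      using 1 by simp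
    then show ?thesis
      by (rule continuous_map_eq) (use 1 in \<open>auto simp: attach_map_def\<close>)
  next
    case (2 k)
    then show ?thesis using attach_map_component_continuous[OF y, of j] by simp
  qed
  have "attach_map K y p \<in> (\<Pi>\<^sub>E j\<in>cells (Suc K). cs_carrier (summand (Suc K) j))" if p: "p \<in> topspace ?X" for p
  proof (rule PiE_I)
    show "attach_map K y p j \<in> cs_carrier (summand (Suc K) j)" if "j \<in> cells (Suc K)" for j
      by (rule cstar_algebra.continuous_mapD(1)[OF summand_cstar[OF that] comp[OF that] p])
    show "attach_map K y p j = undefined" if "j \<notin> cells (Suc K)" for j
      using that p by (simp add: attach_map_def)
  qed
  then have "continuous_map ?X (cs_topology (direct_sum (cells (Suc K)) (summand (Suc K)))) (attach_map K y)"
    using comp by (subst continuous_map_full_direct_sum[OF finite_cells summand_cstar]) auto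
  moreover have "attach_map K y \<in> extensional (topspace ?X)" by (simp add: attach_map_def)
  ultimately show ?thesis by simp
qed

lemma base_apply:
  assumes "k \<le> m 1" "k \<le> K"
  shows "base k (cs_apply u (skeleton tele K) x y) = cs_apply u (skeleton (A 1) k) (base k x) (base k y)"
  using assms by (auto simp: base_def fun_eq_iff)

lemma slice_apply:
  assumes "k \<le> m j" "Suc k \<le> K" "j \<in> L" "t \<in> {0..1}"
  shows "slice j k (cs_apply u (skeleton tele K) x y) t = cs_apply u (skeleton (A j) k) (slice j k x t) (slice j k y t)"
  using assms by (auto simp: slice_def fun_eq_iff cube_join slice_cells)

lemma attach_map_hom:
  "attach_map K \<in> cstar_hom (skeleton tele K) (cont_alg (cube_boundary (Suc K)) (nc_fibre tele (Suc K)))"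
proof (rule cstar_homI)
  show "attach_map K y \<in> cs_carrier (cont_alg (cube_boundary (Suc K)) (nc_fibre tele (Suc K)))"
    if "y \<in> cs_carrier (skeleton tele K)" for y by (rule attach_map_closed[OF that])
  fix u x y assume x: "x \<in> cs_carrier (skeleton tele K)" and y: "y \<in> cs_carrier (skeleton tele K)"
  let ?xy = "cs_apply u (skeleton tele K) x y"
  have pt: "attach_map K ?xy p j = cs_apply u (summand (Suc K) j) (attach_map K x p j) (attach_map K y p j)"
    if p: "p \<in> topspace (cube_boundary (Suc K))" and j: "j \<in> cells (Suc K)" for p j
    using j
  proof (cases rule: cells_cases)
    case 1
    note h = attached_uptoD(2)[OF attached[of 1 "Suc K"] lessI]
    have "nc_attach (A 1) (Suc K) (base K ?xy) p
      = cs_apply u (nc_fibre (A 1) (Suc K)) (nc_attach (A 1) (Suc K) (base K x) p) (nc_attach (A 1) (Suc K) (base K y) p)"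
      using cstar_homD(2)[OF h base_in_skeleton[OF x] base_in_skeleton[OF y], where u=u] 1 p
        base_apply[of K K u x y] by simp
    then show ?thesis using 1 p by (simp add: attach_map_def)
  next
    case (2 k)
    then have jL: "j \<in> L" and K: "K \<le> m j" by auto
    note map = attach_map_slice[OF jL K p]
    have pc: "p \<in> topspace (cube (Suc K))" using boundary_subset[OF p] .
    interpret F: cstar_algebra "nc_fibre (A j) K" using summand_fibre_cstar[of j K] jL K by simp
    consider "p K = 0" | "p K = 1" | "p K \<noteq> 0" "p K \<noteq> 1" by blast
    then show ?thesis
    proof cases
      case 1
      then show ?thesis using map jL by simp
    next
      case p1: 2
      have "end_value j K (base (min K (m 1)) ?xy)
        = cs_apply u (cell_alg (A j) K) (end_value j K (base (min K (m 1)) x)) (end_value j K (base (min K (m 1)) y))"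
        using cstar_homD(2)[OF end_value_hom[OF jL K] base_in_skeleton[OF x] base_in_skeleton[OF y], where u=u]
          base_apply[of "min K (m 1)" K u x y] by simp
      then show ?thesis using map jL p1 cube_split(1)[OF pc] by simp
    next
      case 3
      then have q: "restrict p {..<K} \<in> topspace (cube_boundary K)" using p by (simp add: cube_boundary_Suc)
      then obtain k where k: "K = Suc k" by (cases K) (auto simp: topspace_cube_boundary)
      note h = attached_uptoD(2)[OF attached[of j "Suc k"] lessI]
      have t: "p K \<in> {0..1}" using cube_split(2)[OF pc] .
      have "nc_attach (A j) (Suc k) (slice j k ?xy (p K)) (restrict p {..<K})
        = cs_apply u (nc_fibre (A j) K) (nc_attach (A j) (Suc k) (slice j k x (p K)) (restrict p {..<K}))
            (nc_attach (A j) (Suc k) (slice j k y (p K)) (restrict p {..<K}))"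
        using cstar_homD(2)[OF h slice_in_skeleton[OF x jL t] slice_in_skeleton[OF y jL t], where u=u] jL K q
          slice_apply[of k j K "p K" u x y] t by (simp add: k)
      then show ?thesis using map jL 3 by (simp add: k)
    qed
  qed
  show "attach_map K ?xy = cs_apply u (cont_alg (cube_boundary (Suc K)) (nc_fibre tele (Suc K)))
      (attach_map K x) (attach_map K y)"
  proof (rule ext)
    fix p
    show "attach_map K ?xy p = cs_apply u (cont_alg (cube_boundary (Suc K)) (nc_fibre tele (Suc K)))
      (attach_map K x) (attach_map K y) p"
    proof (cases "p \<in> topspace (cube_boundary (Suc K))")
      case True
      have "attach_map K ?xy p j = cs_apply u (direct_sum (cells (Suc K)) (summand (Suc K)))
          (attach_map K x p) (attach_map K y p) j" for j
      proof (cases "j \<in> cells (Suc K)")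
        case False
        then have "attach_map K ?xy p j = undefined" using True unfolding attach_map_def by simp
        with False show ?thesis by simp
      qed (simp add: pt[OF True] del: skeleton_simps)
      then have "attach_map K ?xy p = cs_apply u (direct_sum (cells (Suc K)) (summand (Suc K)))
          (attach_map K x p) (attach_map K y p)" by (rule ext)
      then show ?thesis using True by simp
    next
      case False
      then have "attach_map K ?xy p = undefined" unfolding attach_map_def by simp
      with False show ?thesis by simp
    qed
  qed
qed

lemma attached_tele: "attached_upto tele K"
  unfolding attached_upto_def
proof (intro conjI allI impI)
  show "finite_dim_cstar (nc_fibre tele k)" for k
    unfolding tele_simps by (rule finite_dim_direct_sum[OF finite_cells summand_finite_dim])
  show "nc_attach tele (Suc k) \<in> cstar_hom (skeleton tele k) (cont_alg (cube_boundary (Suc k)) (nc_fibre tele (Suc k)))" for k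
    using attach_map_hom[of k] by simp
qed

end




section \<open>The algebra of the complex is the telescope\<close>

lemma skeleton_eval_contractive:
  assumes N: "attached_upto N K" and k: "k \<le> K" and q: "q \<in> topspace (cube k)"
    and b: "b \<in> cs_carrier (skeleton N K)" "c \<in> cs_carrier (skeleton N K)"
  shows "cs_norm (nc_fibre N k) (cs_diff (nc_fibre N k) (b k q) (c k q)) \<le> cs_norm (skeleton N K) (cs_diff (skeleton N K) b c)"
proof -
  interpret F: cstar_algebra "nc_fibre N k" using N k by (rule fibre_cstar)
  interpret C: cstar_algebra "cell_alg N k" using N k by (rule cell_cstar)
  have "cs_diff (cell_alg N k) (b k) (c k) \<in> cs_carrier (cell_alg N k)"
    using skeleton_cell[OF b(1) k] skeleton_cell[OF b(2) k] by (rule C.diff_closed)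
  from F.cont_alg_norm_upper[OF compact_cube this[unfolded cell_alg_def] q]
  have "cs_norm (nc_fibre N k) (cs_diff (nc_fibre N k) (b k q) (c k q)) \<le> cs_norm (cell_alg N k) (cs_diff (cell_alg N k) (b k) (c k))"
    using q by (simp add: cell_alg_def)
  also have "\<dots> \<le> cs_norm (skeleton N K) (cs_diff (skeleton N K) b c)"
    using k finite_sum_norm_le_iff[of "{..K}" "cell_alg N" "cs_diff (skeleton N K) b c"
        "cs_norm (skeleton N K) (cs_diff (skeleton N K) b c)"] by (simp del: cell_alg_simps)
  finally show ?thesis .
qed

lemma direct_sum2_apply [simp]:
  "cs_apply u (direct_sum2 A B) x y = (cs_apply u A (fst x) (fst y), cs_apply u B (snd x) (snd y))"
  by (cases u) (simp_all add: direct_sum2_def case_prod_unfold)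

lemma cone_simps [simp]:
  "f \<in> cs_carrier (cone A) \<longleftrightarrow> f \<in> extensional {0..1} \<and>
     continuous_map (top_of_set {0..1}) (cs_topology A) f \<and> f 0 = cs_zero A"
  "cs_apply u (cone A) f g = (\<lambda>t\<in>{0..1}. cs_apply u A (f t) (g t))"
  by (auto simp: cone_def subalgebra_def)

lemma subalgebra_apply [simp]: "cs_apply u (subalgebra A P) = cs_apply u A"
  by (simp add: subalgebra_def)

context telescope
begin

definition tel_alg :: "('f tuple \<times> (nat \<Rightarrow> real \<Rightarrow> 'f tuple)) cstar" where
  "tel_alg = subalgebra (direct_sum2 (nccw_alg (A 1)) (direct_sum L (\<lambda>j. cone (nccw_alg (A j)))))
     (\<lambda>(a, f). \<forall>j\<in>L. f j 1 = \<beta> j a)"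

lemma tel_alg_carrier:
  "(a, f) \<in> cs_carrier tel_alg \<longleftrightarrow> a \<in> cs_carrier (nccw_alg (A 1)) \<and> f \<in> extensional L \<and>
     (\<forall>j\<in>L. f j \<in> extensional {0..1} \<and> continuous_map (top_of_set {0..1}) (cs_topology (nccw_alg (A j))) (f j) \<and>
        f j 0 = cs_zero (nccw_alg (A j)) \<and> f j 1 = \<beta> j a)"
  by (auto simp: tel_alg_def subalgebra_def direct_sum2_def PiE_iff)

text \<open>The isomorphism: the paths become functions on cylinders, with the path parameter in the last
coordinate \<open>k - 1\<close> of the \<open>k\<close>-cube. For \<open>j \<noteq> 1\<close> the set \<open>cells k\<close> contains \<open>j\<close> only if \<open>k\<close> is
positive.\<close>

definition glue :: "'f tuple \<times> (nat \<Rightarrow> real \<Rightarrow> 'f tuple) \<Rightarrow> (nat \<Rightarrow> 'f) tuple" where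
  "glue = (\<lambda>(a, f). \<lambda>k\<in>{..top_dim}. \<lambda>p\<in>topspace (cube k). \<lambda>j\<in>cells k.
     if j = 1 then a k p else f j (p (k - 1)) (k - 1) (restrict p {..<k - 1}))"

definition unglue :: "(nat \<Rightarrow> 'f) tuple \<Rightarrow> 'f tuple \<times> (nat \<Rightarrow> real \<Rightarrow> 'f tuple)" where
  "unglue x = (base (m 1) x, \<lambda>j\<in>L. \<lambda>t\<in>{0..1}. slice j (m j) x t)"

lemma dims_le: "m 1 \<le> top_dim" "j \<in> L \<Longrightarrow> Suc (m j) \<le> top_dim"
  using finite_L by (auto simp: top_dim_def Max_ge_iff)

lemma glue_base: "k \<le> top_dim \<Longrightarrow> k \<le> m 1 \<Longrightarrow> p \<in> topspace (cube k) \<Longrightarrow> glue (a, f) k p 1 = a k p"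
  by (simp add: glue_def)

lemma glue_slice:
  assumes "j \<in> L" "k \<le> m j" "p \<in> topspace (cube (Suc k))"
  shows "glue (a, f) (Suc k) p j = f j (p k) k (restrict p {..<k})"
proof -
  have "Suc k \<le> top_dim" "j \<noteq> 1" "j \<in> cells (Suc k)"
    using assms dims_le(2)[of j] one_notin slice_cells[of j k] by auto
  then show ?thesis using assms(3) by (simp add: glue_def)
qed

lemma slice_value_in:
  assumes "(a, f) \<in> cs_carrier tel_alg" "j \<in> L" "t \<in> {0..1}"
  shows "f j t \<in> cs_carrier (skeleton (A j) (m j))"
  using cstar_algebra.continuous_mapD(1)[OF nccw_alg_cstar, of j "top_of_set {0..1}" "f j" t] assms
  by (auto simp: tel_alg_carrier nccw_alg_def)

lemma base_glue:
  assumes af: "(a, f) \<in> cs_carrier tel_alg" and k: "k \<le> m 1"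
  shows "base k (glue (a, f)) = restrict a {..k}"
proof -
  have "a i \<in> extensional (topspace (cube i))" if "i \<le> k" for i
    using af skeleton_cell[of a "A 1" "m 1" i] that k by (simp add: tel_alg_carrier nccw_alg_def)
  moreover have "glue (a, f) i p 1 = a i p" if "i \<le> k" "p \<in> topspace (cube i)" for i p
    using glue_base that k dims_le(1) by simp
  ultimately show ?thesis by (auto simp: base_def fun_eq_iff restrict_def extensional_def)
qed

lemma slice_glue:
  assumes af: "(a, f) \<in> cs_carrier tel_alg" and j: "j \<in> L" and k: "k \<le> m j" and t: "t \<in> {0..1}"
  shows "slice j k (glue (a, f)) t = restrict (f j t) {..k}"
proof -
  have "f j t i \<in> extensional (topspace (cube i))" if "i \<le> k" for i
    using skeleton_cell[OF slice_value_in[OF af j t], of i] that k by simp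
  moreover have "glue (a, f) (Suc i) (q(i := t)) j = f j t i q" if "i \<le> k" "q \<in> topspace (cube i)" for i q
    using glue_slice[OF j, of i "q(i := t)"] cube_join[OF that(2) t] cube_join_split[OF that(2), of t] that k by simp
  ultimately show ?thesis by (auto simp: slice_def fun_eq_iff restrict_def extensional_def)
qed

lemma glue_component_continuous:
  assumes af: "(a, f) \<in> cs_carrier tel_alg" and j: "j \<in> cells k"
  shows "continuous_map (cube k) (cs_topology (summand k j)) (\<lambda>p. glue (a, f) k p j)"
  using j
proof (cases rule: cells_cases)
  case 1
  have "continuous_map (cube k) (cs_topology (nc_fibre (A 1) k)) (a k)"
    using af skeleton_cell[of a "A 1" "m 1" k] 1 by (simp add: tel_alg_carrier nccw_alg_def)
  then have "continuous_map (cube k) (cs_topology (summand k j)) (a k)" using 1 by simp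
  then show ?thesis
    by (rule continuous_map_eq) (use 1 glue_base dims_le(1) in auto)
next
  case (2 i)
  interpret F: cstar_algebra "nc_fibre (A j) i" using summand_fibre_cstar[of j i] 2 by simp
  have "continuous_map (prod_topology (top_of_set {0..1}) (cube i)) (cs_topology (nc_fibre (A j) i)) (\<lambda>(t, q). f j t i q)"
  proof (rule F.continuous_map_eval[OF nccw_alg_cstar[of j], where f="f j" and ev="\<lambda>b. b i"])
    show "continuous_map (top_of_set {0..1}) (cs_topology (nccw_alg (A j))) (f j)"
      using af 2 by (simp add: tel_alg_carrier)
    show "continuous_map (cube i) (cs_topology (nc_fibre (A j) i)) (b i)" if "b \<in> cs_carrier (nccw_alg (A j))" for b
      using skeleton_cell[of b "A j" "m j" i] that 2 by (simp add: nccw_alg_def)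
    show "cs_norm (nc_fibre (A j) i) (cs_diff (nc_fibre (A j) i) (b i q) (c i q))
        \<le> cs_norm (nccw_alg (A j)) (cs_diff (nccw_alg (A j)) b c)"
      if "b \<in> cs_carrier (nccw_alg (A j))" "c \<in> cs_carrier (nccw_alg (A j))" "q \<in> topspace (cube i)" for b c q
      using skeleton_eval_contractive[OF attached[of j "m j"] 2(4) that(3), of b c] that 2 unfolding nccw_alg_def by simp
  qed (use 2 in simp)
  from continuous_map_compose[OF continuous_map_cube_split this]
  have "continuous_map (cube k) (cs_topology (summand k j)) (\<lambda>p. f j (p i) i (restrict p {..<i}))"
    using 2 by (simp add: o_def)
  then show ?thesis
    by (rule continuous_map_eq) (use 2 glue_slice[of j i] in auto)
qed

text \<open>The boundary conditions of the complex are those of \<open>A 1\<close> and of the algebras \<open>A j\<close>, together with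
the conditions on the two ends of the paths.\<close>

lemma glue_in_tele:
  assumes af: "(a, f) \<in> cs_carrier tel_alg"
  shows "glue (a, f) \<in> cs_carrier (nccw_alg tele)"
proof -
  let ?x = "glue (a, f)"
  have a: "a \<in> cs_carrier (skeleton (A 1) (m 1))" using af by (simp add: tel_alg_carrier nccw_alg_def)
  have cell: "?x k \<in> cs_carrier (cell_alg tele k)" if k: "k \<le> top_dim" for k
  proof -
    have vals: "?x k p \<in> (\<Pi>\<^sub>E j\<in>cells k. cs_carrier (summand k j))" if p: "p \<in> topspace (cube k)" for p
    proof (rule PiE_I)
      show "?x k p j \<in> cs_carrier (summand k j)" if "j \<in> cells k" for j
        by (rule cstar_algebra.continuous_mapD(1)[OF summand_cstar[OF that] glue_component_continuous[OF af that] p])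
      show "?x k p j = undefined" if "j \<notin> cells k" for j
        using that p k by (simp add: glue_def)
    qed
    have ext: "?x k \<in> extensional (topspace (cube k))" using k by (simp add: glue_def)
    show ?thesis
      unfolding cell_iff by (intro conjI ballI ext vals glue_component_continuous[OF af])
  qed
  have bdry: "boundary_restrict (Suc k) (?x (Suc k)) = attach_map k (restrict ?x {..k})" if k: "k < top_dim" for k
  proof (rule ext)
    fix p
    show "boundary_restrict (Suc k) (?x (Suc k)) p = attach_map k (restrict ?x {..k}) p"
    proof (cases "p \<in> topspace (cube_boundary (Suc k))")
      case p: True
      note pc = boundary_subset[OF p]
      have "?x (Suc k) p j = attach_map k (restrict ?x {..k}) p j" for j
      proof (cases "j \<in> cells (Suc k)")
        case True
        then show ?thesis
        proof (cases rule: cells_cases)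
          case 1
          have "?x (Suc k) p j = nc_attach (A 1) (Suc k) (restrict a {..k}) p"
            using skeleton_boundary[OF a _ p] glue_base[of "Suc k" p a f] 1 k pc by simp
          then show ?thesis
            using 1 p base_glue[OF af, of k] by (simp add: attach_map_def)
        next
          case (2 i)
          then have j: "j \<in> L" and kj: "k \<le> m j" by auto
          have t: "p k \<in> {0..1}" using cube_split(2)[OF pc] .
          have x: "?x (Suc k) p j = f j (p k) k (restrict p {..<k})" by (rule glue_slice[OF j kj pc])
          note map = attach_map_slice[OF j kj p, of "restrict ?x {..k}"]
          consider "p k = 0" | "p k = 1" | "p k \<noteq> 0" "p k \<noteq> 1" by blast
          then show ?thesis
          proof cases
            case 1
            have "f j 0 = cs_zero (nccw_alg (A j))" using af j by (simp add: tel_alg_carrier)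
            then show ?thesis using map x 1 kj cube_split(1)[OF pc] by (simp add: nccw_alg_def)
          next
            case 2
            have "f j 1 = \<beta> j a" using af j by (simp add: tel_alg_carrier)
            moreover have "end_value j k (base (min k (m 1)) ?x) = \<beta> j a k"
              using end_value_eq[OF j kj, of a] base_glue[OF af, of "min k (m 1)"] af by (simp add: tel_alg_carrier)
            ultimately show ?thesis using map x 2 by simp
          next
            case 3
            then have q: "restrict p {..<k} \<in> topspace (cube_boundary k)" using p by (simp add: cube_boundary_Suc)
            then obtain i where i: "k = Suc i" by (cases k) (auto simp: topspace_cube_boundary)
            have "f j (p k) k (restrict p {..<k}) = nc_attach (A j) k (restrict (f j (p k)) {..i}) (restrict p {..<k})"
              using skeleton_boundary[OF slice_value_in[OF af j t], of i "restrict p {..<k}"] q kj i by simp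
            then show ?thesis using map x 3 slice_glue[OF af j _ t, of i] kj by (simp add: i)
          qed
        qed
      next
        case False
        then show ?thesis using p k pc by (simp add: glue_def attach_map_def)
      qed
      then show ?thesis using p by (auto simp: boundary_restrict_def)
    next
      case False
      then show ?thesis by (simp add: boundary_restrict_def attach_map_def)
    qed
  qed
  have "?x \<in> extensional {..top_dim}" by (simp add: glue_def)
  then have "?x \<in> (\<Pi>\<^sub>E k\<in>{..top_dim}. cs_carrier (cell_alg tele k))" using cell by (auto simp: PiE_iff simp del: cell_alg_simps)
  then show ?thesis
    unfolding nccw_alg_def skeleton_carrier using bdry by (simp del: cell_alg_simps)
qed

lemma unglue_in_tel_alg:
  assumes x: "x \<in> cs_carrier (nccw_alg tele)"
  shows "unglue x \<in> cs_carrier tel_alg"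
proof -
  have xs: "x \<in> cs_carrier (skeleton tele top_dim)" using x by (simp add: nccw_alg_def)
  have a: "base (m 1) x \<in> cs_carrier (nccw_alg (A 1))"
    unfolding nccw_alg_def by (rule base_in_skeleton[OF xs dims_le(1) order_refl])
  have "continuous_map (top_of_set {0..1}) (cs_topology (nccw_alg (A j))) (\<lambda>t\<in>{0..1}. slice j (m j) x t)" if j: "j \<in> L" for j
    unfolding nccw_alg_def
    by (rule continuous_map_eq[OF continuous_slice[OF xs j dims_le(2)[OF j] order_refl]]) auto
  moreover have "slice j (m j) x 0 = cs_zero (nccw_alg (A j))" if j: "j \<in> L" for j
    unfolding nccw_alg_def by (rule slice_zero[OF xs j dims_le(2)[OF j] order_refl])
  moreover have "slice j (m j) x 1 = \<beta> j (base (m 1) x)" if j: "j \<in> L" for j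
  proof -
    have "\<beta> j (base (m 1) x) \<in> extensional {..m j}"
      using cstar_homD(1)[OF hom[OF j] a] skeleton_ext unfolding nccw_alg_def by blast
    then show ?thesis
      using slice_one[OF xs j dims_le(2)[OF j] order_refl a] by (simp add: extensional_restrict)
  qed
  ultimately show ?thesis using a by (simp add: unglue_def tel_alg_carrier)
qed

text \<open>Extensional equality through the three layers of a tuple: dimension, point and summand.\<close>

lemma tuple_eqI:
  assumes x: "x \<in> cs_carrier (skeleton tele K)" and y: "y \<in> cs_carrier (skeleton tele K)"
    and eq: "\<And>k p j. \<lbrakk>k \<le> K; p \<in> topspace (cube k); j \<in> cells k\<rbrakk> \<Longrightarrow> x k p j = y k p j"
  shows "x = y"
proof (rule extensionalityI[OF skeleton_ext[OF x] skeleton_ext[OF y]])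
  fix k assume "k \<in> {..K}"
  then have k: "k \<le> K" by simp
  note cell = skeleton_cell[OF x k, unfolded cell_iff] skeleton_cell[OF y k, unfolded cell_iff]
  show "x k = y k"
  proof (rule extensionalityI[of _ "topspace (cube k)"])
    fix p assume p: "p \<in> topspace (cube k)"
    have "x k p \<in> (\<Pi>\<^sub>E j\<in>cells k. cs_carrier (summand k j))" "y k p \<in> (\<Pi>\<^sub>E j\<in>cells k. cs_carrier (summand k j))"
      using cell p by blast+
    then show "x k p = y k p" by (rule PiE_ext) (rule eq[OF k p])
  qed (use cell in blast)+
qed

lemma glue_unglue:
  assumes x: "x \<in> cs_carrier (nccw_alg tele)"
  shows "glue (unglue x) = x"
proof -
  have xs: "x \<in> cs_carrier (skeleton tele top_dim)" using x by (simp add: nccw_alg_def)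
  have "glue (unglue x) \<in> cs_carrier (skeleton tele top_dim)"
    using glue_in_tele unglue_in_tel_alg[OF x] by (cases "unglue x") (simp add: nccw_alg_def)
  then show ?thesis
  proof (rule tuple_eqI[OF _ xs])
    fix k p j assume k: "k \<le> top_dim" and p: "p \<in> topspace (cube k)" and "j \<in> cells k"
    from this(3) show "glue (unglue x) k p j = x k p j"
    proof (cases rule: cells_cases)
      case 1
      then show ?thesis using glue_base[OF k _ p] p by (simp add: unglue_def base_def)
    next
      case (2 i)
      have pi: "p \<in> topspace (cube (Suc i))" using p 2 by simp
      have "glue (unglue x) k p j = slice j (m j) x (p i) i (restrict p {..<i})"
        using glue_slice[OF 2(1) 2(4) pi] 2 cube_split(2)[OF pi] by (simp add: unglue_def)
      also have "\<dots> = x k p j"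
        using cube_split[OF pi] 2 by (simp add: slice_def)
      finally show ?thesis .
    qed
  qed
qed

lemma unglue_glue:
  assumes af: "(a, f) \<in> cs_carrier tel_alg"
  shows "unglue (glue (a, f)) = (a, f)"
proof -
  have "a \<in> extensional {..m 1}"
    using af skeleton_ext by (auto simp: tel_alg_carrier nccw_alg_def)
  then have a: "base (m 1) (glue (a, f)) = a"
    using base_glue[OF af order_refl] by (simp add: extensional_restrict)
  have "(\<lambda>j\<in>L. \<lambda>t\<in>{0..1}. slice j (m j) (glue (a, f)) t) = f"
  proof (rule extensionalityI[of _ L])
    fix j assume j: "j \<in> L"
    have "(\<lambda>t\<in>{0..1}. slice j (m j) (glue (a, f)) t) = f j"
    proof (rule extensionalityI[of _ "{0..1}"])
      fix t :: real assume t: "t \<in> {0..1}"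
      then show "(\<lambda>t\<in>{0..1}. slice j (m j) (glue (a, f)) t) t = f j t"
        using slice_glue[OF af j order_refl t] skeleton_ext[OF slice_value_in[OF af j t]]
        by (simp add: extensional_restrict)
    qed (use af j in \<open>auto simp: tel_alg_carrier\<close>)
    then show "(\<lambda>j\<in>L. \<lambda>t\<in>{0..1}. slice j (m j) (glue (a, f)) t) j = f j" using j by simp
  qed (use af in \<open>auto simp: tel_alg_carrier\<close>)
  with a show ?thesis by (simp add: unglue_def)
qed

lemma glue_bij: "bij_betw glue (cs_carrier tel_alg) (cs_carrier (nccw_alg tele))"
  by (rule bij_betw_byWitness[where f'=unglue])
    (use unglue_glue glue_unglue glue_in_tele unglue_in_tel_alg in auto)

lemma glue_hom: "glue \<in> cstar_hom tel_alg (nccw_alg tele)"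
proof (rule cstar_homI)
  show "glue x \<in> cs_carrier (nccw_alg tele)" if "x \<in> cs_carrier tel_alg" for x
    using that glue_in_tele by (cases x) auto
  fix u x y assume x: "x \<in> cs_carrier tel_alg" and y: "y \<in> cs_carrier tel_alg"
  obtain a f b g where ab: "x = (a, f)" "y = (b, g)" by (cases x, cases y)
  let ?xy = "cs_apply u tel_alg x y"
  have xy: "?xy = (cs_apply u (nccw_alg (A 1)) a b, \<lambda>j\<in>L. \<lambda>t\<in>{0..1}. cs_apply u (nccw_alg (A j)) (f j t) (g j t))"
    by (simp add: tel_alg_def ab cong: restrict_cong)
  have "glue ?xy k p j = cs_apply u (summand k j) (glue x k p j) (glue y k p j)"
    if k: "k \<le> top_dim" and p: "p \<in> topspace (cube k)" and j: "j \<in> cells k" for k p j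
    using j
  proof (cases rule: cells_cases)
    case 1
    then show ?thesis unfolding ab xy[unfolded ab] using glue_base[OF k _ p] p by (simp add: nccw_alg_def)
  next
    case (2 i)
    have pi: "p \<in> topspace (cube (Suc i))" using p 2 by simp
    show ?thesis
      unfolding ab xy[unfolded ab] using glue_slice[OF 2(1) 2(4) pi] 2 cube_split[OF pi] by (simp add: nccw_alg_def)
  qed
  note pt = this
  have mem: "glue x \<in> cs_carrier (skeleton tele top_dim)" "glue y \<in> cs_carrier (skeleton tele top_dim)"
    using x y glue_in_tele by (auto simp: ab nccw_alg_def)
  have op: "cs_apply u (skeleton tele top_dim) (glue x) (glue y) \<in> cs_carrier (skeleton tele top_dim)"
    using cstar_skeleton[OF attached_tele] mem by (rule cstar_algebra.apply_closed)
  show "glue ?xy = cs_apply u (nccw_alg tele) (glue x) (glue y)"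
    unfolding nccw_alg_def tele_simps
  proof (rule tuple_eqI[OF _ op])
    have "?xy \<in> cs_carrier tel_alg"
      unfolding xy tel_alg_carrier
    proof (intro conjI ballI)
      note a = x[unfolded ab tel_alg_carrier] and b = y[unfolded ab tel_alg_carrier]
      show "cs_apply u (nccw_alg (A 1)) a b \<in> cs_carrier (nccw_alg (A 1))"
        using cstar_algebra.apply_closed[OF nccw_alg_cstar[of 1]] a b by simp
      fix j assume j: "j \<in> L"
      interpret E: cstar_algebra "nccw_alg (A j)" by (rule nccw_alg_cstar) (use j in simp)
      have "continuous_map (top_of_set {0..1}) (cs_topology (nccw_alg (A j))) (\<lambda>t. cs_apply u (nccw_alg (A j)) (f j t) (g j t))"
        using a b j by (intro E.continuous_map_apply) auto
      then show "continuous_map (top_of_set {0..1}) (cs_topology (nccw_alg (A j)))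
          ((\<lambda>j\<in>L. \<lambda>t\<in>{0..1}. cs_apply u (nccw_alg (A j)) (f j t) (g j t)) j)"
        by (rule continuous_map_eq) (use j in auto)
      show "(\<lambda>j\<in>L. \<lambda>t\<in>{0..1}. cs_apply u (nccw_alg (A j)) (f j t) (g j t)) j 0 = cs_zero (nccw_alg (A j))"
        using a b j by simp
      show "(\<lambda>j\<in>L. \<lambda>t\<in>{0..1}. cs_apply u (nccw_alg (A j)) (f j t) (g j t)) j 1 = \<beta> j (cs_apply u (nccw_alg (A 1)) a b)"
        using a b j cstar_homD(2)[OF hom[OF j], of a b u] by simp
    qed auto
    then show "glue ?xy \<in> cs_carrier (skeleton tele top_dim)"
      using glue_in_tele by (cases ?xy) (auto simp: nccw_alg_def)
    show "glue ?xy k p j = cs_apply u (skeleton tele top_dim) (glue x) (glue y) k p j"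
      if "k \<le> top_dim" "p \<in> topspace (cube k)" "j \<in> cells k" for k p j
      using pt[OF that] that by simp
  qed
qed


section \<open>The dimension\<close>

text \<open>What is left to show is that the top canonical ideal is not zero. If the maximum is the dimension
of \<open>A 1\<close>, then all other \<open>A j\<close> have smaller dimension, so \<open>\<beta> j\<close> annihilates the top ideal of \<open>A 1\<close>
and its elements can be combined with constant zero paths. Otherwise the maximum is \<open>1 + m l\<close> for
some \<open>l\<close>, and a loop in the top ideal of \<open>A l\<close> is combined with zero everywhere else.\<close>

lemma nccw_complex_tele: "nccw_complex tele"
proof -
  let ?D = "nccw_alg (A 1)"
  have zero_ideal: "cs_zero (nccw_alg (A j)) \<in> cs_carrier (nccw_alg (A j))" if "j \<in> insert 1 L" for j
    using cstar_algebra.zero_closed[OF nccw_alg_cstar[OF that]] .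
  have hom0: "\<beta> j (cs_zero ?D) = cs_zero (nccw_alg (A j))" if "j \<in> L" for j
    using hom_zero[OF nccw_alg_cstar nccw_alg_cstar hom] that by simp
  let ?zf = "\<lambda>j\<in>L. \<lambda>t\<in>{0..1::real}. cs_zero (nccw_alg (A j))"
  have const: "continuous_map (top_of_set {0..1::real}) (cs_topology (nccw_alg (A j))) (\<lambda>t\<in>{0..1}. cs_zero (nccw_alg (A j)))"
    if "j \<in> L" for j
    by (rule continuous_map_eq[where f="\<lambda>_. cs_zero (nccw_alg (A j))"])
      (use zero_ideal[of j] that cstar_algebra.topspace_cs_topology[OF nccw_alg_cstar[of j]] in \<open>auto simp: continuous_map_const\<close>)
  have zero: "(cs_zero ?D, ?zf) \<in> cs_carrier tel_alg"
    using zero_ideal[of 1] hom0 const by (simp add: tel_alg_carrier)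
  have nontrivial: "\<exists>b\<in>cs_carrier (nccw_alg (A j)). b \<noteq> cs_zero (nccw_alg (A j)) \<and>
      (\<forall>k<m j. b k = cs_zero (nccw_alg (A j)) k)" if j: "j \<in> insert 1 L" for j
  proof -
    have "cs_zero (nccw_alg (A j)) \<in> canonical_ideal (A j) (m j)"
      using zero_ideal[OF j] by (simp add: canonical_ideal_def)
    then obtain b where b: "b \<in> canonical_ideal (A j) (m j)" "b \<noteq> cs_zero (nccw_alg (A j))"
      using complex[OF j] unfolding nccw_complex_def by blast
    have "b k = cs_zero (nccw_alg (A j)) k" if "k < m j" for k
    proof -
      have "restrict b {..<m j} = restrict (cs_zero (nccw_alg (A j))) {..<m j}"
        using b(1) by (simp add: canonical_ideal_def)
      from fun_cong[OF this, of k] that show ?thesis by simp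
    qed
    then show ?thesis using b by (auto simp: canonical_ideal_def)
  qed
  obtain a f where af: "(a, f) \<in> cs_carrier tel_alg" "(a, f) \<noteq> (cs_zero ?D, ?zf)"
    and low: "\<And>k p j. \<lbrakk>k < top_dim; p \<in> topspace (cube k); j \<in> cells k\<rbrakk> \<Longrightarrow>
      glue (a, f) k p j = cs_zero (summand k j)"
  proof (cases "top_dim = m 1")
    case True
    obtain a where a: "a \<in> cs_carrier ?D" "a \<noteq> cs_zero ?D" "\<forall>k<m 1. a k = cs_zero ?D k"
      using nontrivial[of 1] by blast
    have "\<beta> j a = cs_zero (nccw_alg (A j))" if j: "j \<in> L" for j
    proof -
      have "a \<in> canonical_ideal (A 1) (m 1)" using a by (auto simp: canonical_ideal_def fun_eq_iff)
      then have "\<beta> j a \<in> canonical_ideal (A j) (m 1)" using ideal[OF j] by blast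
      then have r: "\<beta> j a \<in> cs_carrier (nccw_alg (A j))"
        "restrict (\<beta> j a) {..<m 1} = restrict (cs_zero (nccw_alg (A j))) {..<m 1}"
        by (simp_all add: canonical_ideal_def)
      have ext: "\<beta> j a \<in> extensional {..m j}" "cs_zero (nccw_alg (A j)) \<in> extensional {..m j}"
        using skeleton_ext[OF r(1)[unfolded nccw_alg_def]] skeleton_ext[OF zero_ideal[of j, unfolded nccw_alg_def]] j
        by (simp_all add: nccw_alg_def)
      show ?thesis
      proof (rule extensionalityI[OF ext])
        fix k assume "k \<in> {..m j}"
        then have "k < m 1" using dims_le(2)[OF j] True by simp
        then show "\<beta> j a k = cs_zero (nccw_alg (A j)) k" using fun_cong[OF r(2), of k] by simp
      qed
    qed
    then have af: "(a, ?zf) \<in> cs_carrier tel_alg"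
      using a const by (simp add: tel_alg_carrier)
    show ?thesis
    proof (rule that[OF af])
      fix k p j assume k: "k < top_dim" and p: "p \<in> topspace (cube k)" and "j \<in> cells k"
      from this(3) show "glue (a, ?zf) k p j = cs_zero (summand k j)"
      proof (cases rule: cells_cases)
        case 1
        then show ?thesis using glue_base[of k p a ?zf] k p a(3) True by (simp add: nccw_alg_def)
      next
        case (2 i)
        have pi: "p \<in> topspace (cube (Suc i))" using p 2 by simp
        show ?thesis using glue_slice[OF 2(1) 2(4) pi, of a ?zf] 2 cube_split[OF pi] by (simp add: nccw_alg_def)
      qed
    qed (use a in simp)
  next
    case False
    have "top_dim \<in> insert (m 1) ((\<lambda>j. 1 + m j) ` L)"
      unfolding top_dim_def using finite_L by (intro Max_in) auto
    then obtain l where l: "l \<in> L" "top_dim = Suc (m l)" using False by auto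
    obtain b where b: "b \<in> cs_carrier (nccw_alg (A l))" "b \<noteq> cs_zero (nccw_alg (A l))"
      "\<forall>k<m l. b k = cs_zero (nccw_alg (A l)) k"
      using nontrivial[of l] l by blast
    interpret E: cstar_algebra "nccw_alg (A l)" by (rule nccw_alg_cstar) (use l in simp)
    \<comment> \<open>The factor \<open>t (1 - t)\<close> vanishes at both ends and not at \<open>1/2\<close>.\<close>
    let ?g = "\<lambda>t::real. cs_scale (nccw_alg (A l)) (complex_of_real (t * (1 - t))) b"
    let ?f = "\<lambda>j\<in>L. \<lambda>t\<in>{0..1}. if j = l then ?g t else cs_zero (nccw_alg (A j))"
    have "continuous_map (top_of_set {0..1}) (cs_topology (nccw_alg (A l))) ?g"
      by (intro E.continuous_map_scale) (auto simp: b(1) continuous_map_const intro!: continuous_intros)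
    then have g: "continuous_map (top_of_set {0..1}) (cs_topology (nccw_alg (A l))) (\<lambda>t\<in>{0..1}. ?g t)"
      by (rule continuous_map_eq) auto
    have af: "(cs_zero ?D, ?f) \<in> cs_carrier tel_alg"
      using zero_ideal[of 1] hom0 const g b(1) by (auto simp: tel_alg_carrier simp del: of_real_mult of_real_diff)
    have "?f \<noteq> ?zf"
    proof
      assume "?f = ?zf"
      from fun_cong[OF fun_cong[OF this, of l], of "1/2"]
      have "cs_scale (nccw_alg (A l)) (complex_of_real (1/4)) b = cs_zero (nccw_alg (A l))"
        using l by simp
      then have "cs_norm (nccw_alg (A l)) b = 0"
        using E.norm_scale[OF b(1), of "complex_of_real (1/4)"] by simp
      then show False using E.norm_eq_zero[OF b(1)] b(2) by simp
    qed
    show ?thesis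
    proof (rule that[OF af])
      fix k p j assume k: "k < top_dim" and p: "p \<in> topspace (cube k)" and "j \<in> cells k"
      from this(3) show "glue (cs_zero ?D, ?f) k p j = cs_zero (summand k j)"
      proof (cases rule: cells_cases)
        case 1
        then show ?thesis using glue_base[of k p "cs_zero ?D" ?f] k p by (simp add: nccw_alg_def)
      next
        case (2 i)
        have pi: "p \<in> topspace (cube (Suc i))" using p 2 by simp
        note v = glue_slice[OF 2(1) 2(4) pi, of "cs_zero ?D" ?f]
        show ?thesis
        proof (cases "j = l")
          case True
          interpret F: cstar_algebra "nc_fibre (A j) i" using summand_fibre_cstar[of j i] 2 by simp
          have "b i = cs_zero (cell_alg (A l) i)" using b(3) k l 2 True by (simp add: nccw_alg_def)
          moreover have "?g t i = cs_apply (Scale (complex_of_real (t * (1 - t)))) (skeleton (A l) (m l)) b b i" for t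
            by (simp add: nccw_alg_def del: skeleton_simps)
          ultimately show ?thesis
            using v 2 True cube_split[OF pi] F.scale_zero(2) by (simp add: nccw_alg_def)
        next
          case False
          then show ?thesis using v 2 cube_split[OF pi] by (simp add: nccw_alg_def)
        qed
      qed
    qed (use \<open>?f \<noteq> ?zf\<close> in simp)
  qed
  have low0: "glue (cs_zero ?D, ?zf) k p j = cs_zero (summand k j)"
    if k: "k \<le> top_dim" and p: "p \<in> topspace (cube k)" and j: "j \<in> cells k" for k p j
    using j
  proof (cases rule: cells_cases)
    case 1
    then show ?thesis using glue_base[OF k _ p] p by (simp add: nccw_alg_def)
  next
    case (2 i)
    have pi: "p \<in> topspace (cube (Suc i))" using p 2 by simp
    show ?thesis using glue_slice[OF 2(1) 2(4) pi, of "cs_zero ?D" ?zf] 2 cube_split[OF pi] by (simp add: nccw_alg_def)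
  qed
  have Z: "cs_zero (nccw_alg tele) \<in> cs_carrier (skeleton tele top_dim)"
    using cstar_algebra.zero_closed[OF cstar_skeleton[OF attached_tele]] by (simp add: nccw_alg_def)
  have G: "glue (a, f) \<in> cs_carrier (skeleton tele top_dim)" "glue (cs_zero ?D, ?zf) \<in> cs_carrier (skeleton tele top_dim)"
    using glue_in_tele[OF af(1)] glue_in_tele[OF zero] by (simp_all add: nccw_alg_def)
  have glue0: "glue (cs_zero ?D, ?zf) = cs_zero (nccw_alg tele)"
  proof (rule tuple_eqI[OF G(2) Z])
    fix k p j assume kpj: "k \<le> top_dim" "p \<in> topspace (cube k)" "j \<in> cells k"
    then have "cs_zero (nccw_alg tele) k p j = cs_zero (summand k j)" by (simp add: nccw_alg_def)
    with low0[OF kpj] show "glue (cs_zero ?D, ?zf) k p j = cs_zero (nccw_alg tele) k p j" by simp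
  qed
  have "restrict (glue (a, f)) {..<top_dim} k = restrict (cs_zero (nccw_alg tele)) {..<top_dim} k" for k
  proof (cases "k < top_dim")
    case True
    have "restrict (glue (a, f)) {..k} = restrict (cs_zero (nccw_alg tele)) {..k}"
      by (rule tuple_eqI[OF skeleton_restrict[OF G(1)] skeleton_restrict[OF Z]])
        (use True low in \<open>auto simp: nccw_alg_def\<close>)
    from fun_cong[OF this, of k] show ?thesis using True by simp
  qed simp
  then have "glue (a, f) \<in> canonical_ideal tele top_dim"
    unfolding canonical_ideal_def using glue_in_tele[OF af(1)] by blast
  moreover have "glue (a, f) \<noteq> cs_zero (nccw_alg tele)"
    using unglue_glue[OF af(1)] unglue_glue[OF zero] af(2) glue0 by metis
  ultimately have "canonical_ideal tele (nc_dim tele) \<noteq> {cs_zero (nccw_alg tele)}" by auto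
  moreover have "nc_attach tele k \<in> cstar_hom (skeleton tele (k - 1)) (cont_alg (cube_boundary k) (nc_fibre tele k))"
    if "k \<in> {1..nc_dim tele}" for k
    using attach_map_hom[of "k - 1"] that by (simp del: tele_simps(2)) (simp add: tele_def)
  ultimately show ?thesis
    unfolding nccw_complex_def using attached_uptoD(1)[OF attached_tele] by blast
qed

end

theorem proposition5p14:
  fixes n :: nat
    and A :: "nat \<Rightarrow> 'f nccw"
    and \<alpha> :: "nat \<Rightarrow> 'f tuple \<Rightarrow> 'f tuple"
    and m :: "nat \<Rightarrow> nat"
  assumes "1 \<le> n"
    and "\<And>j. j \<in> {1..n+1} \<Longrightarrow> nccw_complex (A j)"
    and "\<And>j. j \<in> {1..n+1} \<Longrightarrow> nc_dim (A j) = m j"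
    and "\<And>j. j \<in> {1..n} \<Longrightarrow> simplicial (A j) (A (j + 1)) (\<alpha> j)"
  shows "\<exists>N :: (nat \<Rightarrow> 'f) nccw.
           nccw_complex N \<and>
           nc_dim N = Max (insert (m 1) ((\<lambda>j. 1 + m j) ` {2..n+1})) \<and>
           cstar_isomorphic (conical_telescope n (\<lambda>j. nccw_alg (A j)) \<alpha>) (nccw_alg N)"
proof -
  have comp: "iter_comp \<alpha> k \<in> cstar_hom (nccw_alg (A 1)) (nccw_alg (A (k + 1))) \<and>
      (\<forall>i. iter_comp \<alpha> k ` canonical_ideal (A 1) i \<subseteq> canonical_ideal (A (k + 1)) i)" if "k \<le> n" for k
    using that
  proof (induction k)
    case 0
    show ?case by (simp add: cstar_hom_iff)
  next
    case (Suc k)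
    have sim: "simplicial (A (k + 1)) (A (Suc k + 1)) (\<alpha> (Suc k))"
      using assms(4)[of "Suc k"] Suc.prems by (simp add: Suc_eq_plus1[symmetric])
    have s: "\<alpha> (Suc k) \<in> cstar_hom (nccw_alg (A (k + 1))) (nccw_alg (A (Suc k + 1)))"
      "\<And>i. \<alpha> (Suc k) ` canonical_ideal (A (k + 1)) i \<subseteq> canonical_ideal (A (Suc k + 1)) i"
      using sim unfolding simplicial_def by blast+
    have IH: "iter_comp \<alpha> k \<in> cstar_hom (nccw_alg (A 1)) (nccw_alg (A (k + 1)))"
      "\<And>i. iter_comp \<alpha> k ` canonical_ideal (A 1) i \<subseteq> canonical_ideal (A (k + 1)) i"
      using Suc by simp_all
    have "iter_comp \<alpha> (Suc k) \<in> cstar_hom (nccw_alg (A 1)) (nccw_alg (A (Suc k + 1)))"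
      by (rule cstar_homI) (simp_all add: cstar_homD[OF IH(1)] cstar_homD[OF s(1)] del: add_Suc add_Suc_right)
    moreover have "iter_comp \<alpha> (Suc k) ` canonical_ideal (A 1) i \<subseteq> canonical_ideal (A (Suc k + 1)) i" for i
      unfolding iter_comp.simps image_comp[symmetric] using IH(2)[of i] s(2)[of i] by (meson image_mono order_trans)
    ultimately show ?case by blast
  qed
  interpret T: telescope A "{2..n+1}" "\<lambda>j. iter_comp \<alpha> (j - 1)"
  proof
    show "nccw_complex (A j)" if "j \<in> insert 1 {2..n+1}" for j
      using assms(2)[of j] that by auto
    show "iter_comp \<alpha> (j - 1) \<in> cstar_hom (nccw_alg (A 1)) (nccw_alg (A j))" if "j \<in> {2..n+1}" for j
      using comp[of "j - 1"] that by (simp add: le_diff_conv)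
    show "iter_comp \<alpha> (j - 1) ` canonical_ideal (A 1) k \<subseteq> canonical_ideal (A j) k" if "j \<in> {2..n+1}" for j k
      using comp[of "j - 1"] that by (simp add: le_diff_conv)
  qed auto
  have "(\<lambda>j. 1 + nc_dim (A j)) ` {2..n+1} = (\<lambda>j. 1 + m j) ` {2..n+1}"
    using assms(3) by (intro image_cong) auto
  then have dim: "T.top_dim = Max (insert (m 1) ((\<lambda>j. 1 + m j) ` {2..n+1}))"
    unfolding T.top_dim_def using assms(3)[of 1] by simp
  have ends: "(\<forall>k\<in>{1..n}. f (k + 1) 1 = iter_comp \<alpha> k a) \<longleftrightarrow> (\<forall>j\<in>{2..n+1}. f j 1 = iter_comp \<alpha> (j - 1) a)"
    for a and f :: "nat \<Rightarrow> real \<Rightarrow> 'f tuple"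
  proof
    assume *: "\<forall>k\<in>{1..n}. f (k + 1) 1 = iter_comp \<alpha> k a"
    show "\<forall>j\<in>{2..n+1}. f j 1 = iter_comp \<alpha> (j - 1) a"
    proof
      fix j assume "j \<in> {2..n+1}"
      then have "j - 1 \<in> {1..n}" "j - 1 + 1 = j" unfolding atLeastAtMost_iff by arith+
      then show "f j 1 = iter_comp \<alpha> (j - 1) a" using bspec[OF *, of "j - 1"] by metis
    qed
  next
    assume *: "\<forall>j\<in>{2..n+1}. f j 1 = iter_comp \<alpha> (j - 1) a"
    show "\<forall>k\<in>{1..n}. f (k + 1) 1 = iter_comp \<alpha> k a"
    proof
      fix k assume "k \<in> {1..n}"
      then show "f (k + 1) 1 = iter_comp \<alpha> k a" using bspec[OF *, of "k + 1"] by simp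
    qed
  qed
  have "conical_telescope n (\<lambda>j. nccw_alg (A j)) \<alpha> = T.tel_alg"
    unfolding conical_telescope_def T.tel_alg_def ends ..
  then have "cstar_isomorphic (conical_telescope n (\<lambda>j. nccw_alg (A j)) \<alpha>) (nccw_alg T.tele)"
    unfolding cstar_isomorphic_def using T.glue_hom T.glue_bij by auto
  then show ?thesis using T.nccw_complex_tele dim by (intro exI[of _ T.tele]) simp
qed

end
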